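(* Let $d\ge 1$, let $W$ be a finite dimensional complex Hilbert space, and let $U$ be a periodic unitary transition operator on $\ell^{2}(\mathbb{Z}^{d},W)$, with associated unitary matrix-valued function $\widehat{U}(z)$ on the torus $T^{d}$. Then: (1) A number $\omega$ is an eigenvalue of $U$ if and only if $\omega$ is an eigenvalue of $\widehat{U}(z)$ for all points $z\in T^{d}$. Hence the number of eigenvalues of $U$ is finite. (2) The continuous spectrum of $U$ is absolutely continuous with respect to the Lebesgue measure on the unit circle $S^{1}$ in $\mathbb{C}$.
   Context: $\ell^{2}(\mathbb{Z}^{d},W)$ is the Hilbert space of square summable $W$-valued functions on $\mathbb{Z}^d$ with inner product $\langle f,g\rangle=\sum_{x}\langle f(x),g(x)\rangle_{W}$. For $y\in\mathbb{Z}^{d}$ and $\phi\in W$, $\delta_{y}\otimes\phi$ is the function with value $\phi$ at $y$ and $0$ elsewhere. A unitary operator $U$ on $\ell^{2}(\mathbb{Z}^{d},W)$ is a periodic unitary transition operator if (a) $U$ commutes with the natural action (by translations) of $\mathbb{Z}^{d}$, and (b) there is a finite set $S\subset\mathbb{Z}^{d}$ (the set of steps) such that $U(\delta_{x}\otimes\phi)(y)=0$ for all $x\in\mathbb{Z}^{d}$, $y\in\mathbb{Z}^{d}\setminus(x+S)$, $\phi\in W$. $T^{d}=\{z\in\mathbb{C}^{d}: |z_{j}|=1,\ j=1,\dots,d\}$, with normalized Lebesgue measure $\nu_{d}$, and $z^{x}=z_{1}^{x_{1}}\cdots z_{d}^{x_{d}}$. The Fourier transform $\mathcal{F}:L^{2}(T^{d},W)\to\ell^{2}(\mathbb{Z}^{d},W)$,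 $\mathcal{F}(f)(x)=\int_{T^{d}}z^{x}f(z)\,d\nu_{d}(z)$, is unitary with inverse $(\mathcal{F}^{*}g)(z)=\sum_{x}g(x)z^{-x}$. Put $\mathcal{U}=\mathcal{F}^{*}U\mathcal{F}$. Then $(\mathcal{U}f)(z)=\widehat{U}(z)f(z)$, where $\widehat{U}(z)$ is the unitary operator on $W$ given by $\widehat{U}(z)\phi=\mathcal{U}(1\otimes\phi)(z)=\sum_{x\in\mathbb{Z}^{d}}z^{-x}\,U(\delta_{0}\otimes\phi)(x)$ (a finite sum) for $\phi\in W$, $z\in T^{d}$; here $1\otimes\phi$ is the constant function $\phi$ on $T^d$. Let $E$ be the projection-valued spectral measure of $U$ on $S^{1}$ and $\pi_{c}=I-\pi_{p}$, where $\pi_{p}$ is the orthogonal projection onto the closed linear span of all eigenvectors of $U$. "The continuous spectrum of $U$ is absolutely continuous" means that for every $u$ the measure $\Lambda\mapsto\|E(\Lambda)\pi_{c}u\|^{2}$ on $S^{1}$ is absolutely continuous with respect to Lebesgue measure. *)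

theory Defs
  imports "HOL-Analysis.Analysis"
begin

section \<open>Complex inner product spaces\<close>

text \<open>
  The complex inner product is linear in the first argument. The norm and the topology are those of
  the underlying real inner product space, whose inner product is the real part of the complex one.
\<close>

class complex_inner = real_inner +
  fixes scaleC :: "complex \<Rightarrow> 'a \<Rightarrow> 'a"  (infixr \<open>*\<^sub>C\<close> 75)
    and cinner :: "'a \<Rightarrow> 'a \<Rightarrow> complex"
  assumes scaleC_add_right: "c *\<^sub>C (u + v) = c *\<^sub>C u + c *\<^sub>C v"
    and scaleC_add_left: "(b + c) *\<^sub>C u = b *\<^sub>C u + c *\<^sub>C u"
    and scaleC_scaleC: "b *\<^sub>C c *\<^sub>C u = (b * c) *\<^sub>C u"
    and scaleR_scaleC: "scaleR r u = complex_of_real r *\<^sub>C u"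
    and cinner_commute: "cinner u v = cnj (cinner v u)"
    and cinner_add_left: "cinner (u + v) w = cinner u w + cinner v w"
    and cinner_scaleC_left: "cinner (c *\<^sub>C u) v = c * cinner u v"
    and inner_eq_Re_cinner: "inner u v = Re (cinner u v)"

lemma scaleC_one: "1 *\<^sub>C u = u" for u :: "'a::complex_inner"
  using scaleR_scaleC[of 1 u] by simp

interpretation complex_vector: vector_space "scaleC :: complex \<Rightarrow> 'a \<Rightarrow> 'a::complex_inner"
  by unfold_locales (simp_all add: scaleC_add_right scaleC_add_left scaleC_scaleC scaleC_one)

abbreviation clinear :: "('a::complex_inner \<Rightarrow> 'b::complex_inner) \<Rightarrow> bool"
  where "clinear \<equiv> Vector_Spaces.linear scaleC scaleC"

lemma cinner_self: "cinner u u = complex_of_real ((norm u)\<^sup>2)" for u :: "'a::complex_inner"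
proof -
  have "Im (cinner u u) = 0"
    using arg_cong[OF cinner_commute[of u u], of Im] by simp
  moreover have "Re (cinner u u) = (norm u)\<^sup>2"
    by (simp add: power2_norm_eq_inner inner_eq_Re_cinner)
  ultimately show ?thesis
    by (simp add: complex_eq_iff)
qed

lemma norm_scaleC: "norm (c *\<^sub>C u) = cmod c * norm u" for u :: "'a::complex_inner"
proof -
  have "cinner (c *\<^sub>C u) (c *\<^sub>C u) = c * cnj c * cinner u u"
    by (metis (no_types, lifting) cinner_commute cinner_scaleC_left complex_cnj_mult mult.assoc)
  then have "complex_of_real ((norm (c *\<^sub>C u))\<^sup>2) = complex_of_real ((cmod c * norm u)\<^sup>2)"
    by (simp add: cinner_self complex_norm_square power_mult_distrib flip: of_real_power)
  then have "(norm (c *\<^sub>C u))\<^sup>2 = (cmod c * norm u)\<^sup>2"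
    using of_real_eq_iff by blast
  then show ?thesis
    by (simp add: power2_eq_iff_nonneg)
qed

lemma norm_cinner_le: "cmod (cinner u v) \<le> norm u * norm v" for u v :: "'a::complex_inner"
proof (cases "cinner u v = 0")
  case False
  define c where "c = cnj (cinner u v) / cmod (cinner u v)"
  have "cmod c = 1"
    using False by (simp add: c_def norm_divide)
  have "c * cinner u v = cmod (cinner u v)"
    using False by (simp add: c_def field_simps complex_norm_square[symmetric] power2_eq_square
        flip: of_real_mult)
  then have "cmod (cinner u v) = inner (c *\<^sub>C u) v"
    by (simp add: inner_eq_Re_cinner cinner_scaleC_left)
  also have "\<dots> \<le> norm (c *\<^sub>C u) * norm v"
    by (rule norm_cauchy_schwarz)
  finally show ?thesis
    by (simp add: norm_scaleC \<open>cmod c = 1\<close>)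
qed simp


section \<open>The space of square summable functions\<close>

typedef (overloaded) ('i, 'w) ell2 =
  "{f :: 'i \<Rightarrow> 'w::complex_inner. (\<lambda>x. (norm (f x))\<^sup>2) summable_on UNIV}"
  morphisms ell2_apply Abs_ell2
  by (rule exI[of _ "\<lambda>_. 0"]) simp

setup_lifting type_definition_ell2

lemma ell2_cinner_summable:
  fixes f g :: "'i \<Rightarrow> 'w::complex_inner"
  assumes "(\<lambda>x. (norm (f x))\<^sup>2) summable_on UNIV" "(\<lambda>x. (norm (g x))\<^sup>2) summable_on UNIV"
  shows "(\<lambda>x. cinner (f x) (g x)) summable_on UNIV"
proof (rule abs_summable_summable, rule summable_on_comparison_test)
  show "(\<lambda>x. (norm (f x))\<^sup>2 + (norm (g x))\<^sup>2) summable_on UNIV"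
    by (intro summable_on_add assms)
  show "cmod (cinner (f x) (g x)) \<le> (norm (f x))\<^sup>2 + (norm (g x))\<^sup>2" for x
  proof -
    have "norm (f x) * norm (g x) \<le> (norm (f x))\<^sup>2 + (norm (g x))\<^sup>2"
      using sum_squares_bound[of "norm (f x)" "norm (g x)"]
        mult_nonneg_nonneg[OF norm_ge_zero norm_ge_zero, of "f x" "g x"] by linarith
    then show ?thesis
      using norm_cinner_le order_trans by blast
  qed
qed simp

lemma ell2_add_summable:
  fixes f g :: "'i \<Rightarrow> 'w::complex_inner"
  assumes "(\<lambda>x. (norm (f x))\<^sup>2) summable_on UNIV" "(\<lambda>x. (norm (g x))\<^sup>2) summable_on UNIV"
  shows "(\<lambda>x. (norm (f x + g x))\<^sup>2) summable_on UNIV"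
proof (rule summable_on_comparison_test)
  show "(\<lambda>x. 2 * (norm (f x))\<^sup>2 + 2 * (norm (g x))\<^sup>2) summable_on UNIV"
    by (intro summable_on_add summable_on_cmult_right assms)
  show "(norm (f x + g x))\<^sup>2 \<le> 2 * (norm (f x))\<^sup>2 + 2 * (norm (g x))\<^sup>2" for x
  proof -
    have "(norm (f x + g x))\<^sup>2 \<le> (norm (f x) + norm (g x))\<^sup>2"
      by (simp add: norm_triangle_ineq power_mono)
    also have "\<dots> \<le> 2 * (norm (f x))\<^sup>2 + 2 * (norm (g x))\<^sup>2"
      using sum_squares_bound[of "norm (f x)" "norm (g x)"] by (simp add: power2_sum)
    finally show ?thesis .
  qed
qed simp

lemma ell2_scaleC_summable:
  fixes f :: "'i \<Rightarrow> 'w::complex_inner"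
  assumes "(\<lambda>x. (norm (f x))\<^sup>2) summable_on UNIV"
  shows "(\<lambda>x. (norm (c *\<^sub>C f x))\<^sup>2) summable_on UNIV"
  using summable_on_cmult_right[OF assms, of "(cmod c)\<^sup>2"]
  by (simp add: norm_scaleC power_mult_distrib)

instantiation ell2 :: (type, complex_inner) complex_inner
begin

lift_definition zero_ell2 :: "('a, 'b) ell2" is "\<lambda>_. 0"
  by simp

lift_definition plus_ell2 :: "('a, 'b) ell2 \<Rightarrow> ('a, 'b) ell2 \<Rightarrow> ('a, 'b) ell2"
  is "\<lambda>f g x. f x + g x"
  by (rule ell2_add_summable)

lift_definition uminus_ell2 :: "('a, 'b) ell2 \<Rightarrow> ('a, 'b) ell2" is "\<lambda>f x. - f x"
  by simp

lift_definition minus_ell2 :: "('a, 'b) ell2 \<Rightarrow> ('a, 'b) ell2 \<Rightarrow> ('a, 'b) ell2"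
  is "\<lambda>f g x. f x - g x"
proof -
  fix f g :: "'a \<Rightarrow> 'b"
  assume "(\<lambda>x. (norm (f x))\<^sup>2) summable_on UNIV" "(\<lambda>x. (norm (g x))\<^sup>2) summable_on UNIV"
  then show "(\<lambda>x. (norm (f x - g x))\<^sup>2) summable_on UNIV"
    using ell2_add_summable[of f "\<lambda>x. - g x"] by simp
qed

lift_definition scaleC_ell2 :: "complex \<Rightarrow> ('a, 'b) ell2 \<Rightarrow> ('a, 'b) ell2"
  is "\<lambda>c f x. c *\<^sub>C f x"
  by (rule ell2_scaleC_summable)

lift_definition cinner_ell2 :: "('a, 'b) ell2 \<Rightarrow> ('a, 'b) ell2 \<Rightarrow> complex"
  is "\<lambda>f g. \<Sum>\<^sub>\<infinity>x. cinner (f x) (g x)" .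

definition scaleR_ell2 :: "real \<Rightarrow> ('a, 'b) ell2 \<Rightarrow> ('a, 'b) ell2"
  where "scaleR_ell2 r f = complex_of_real r *\<^sub>C f"

definition inner_ell2 :: "('a, 'b) ell2 \<Rightarrow> ('a, 'b) ell2 \<Rightarrow> real"
  where "inner_ell2 f g = Re (cinner f g)"

definition norm_ell2 :: "('a, 'b) ell2 \<Rightarrow> real"
  where "norm_ell2 f = sqrt (inner f f)"

definition sgn_ell2 :: "('a, 'b) ell2 \<Rightarrow> ('a, 'b) ell2"
  where "sgn_ell2 f = scaleR (inverse (norm f)) f"

definition dist_ell2 :: "('a, 'b) ell2 \<Rightarrow> ('a, 'b) ell2 \<Rightarrow> real"
  where "dist_ell2 f g = norm (f - g)"

definition uniformity_ell2 :: "(('a, 'b) ell2 \<times> ('a, 'b) ell2) filter"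
  where "uniformity_ell2 = (INF e\<in>{0<..}. principal {(f, g). dist f g < e})"

definition open_ell2 :: "('a, 'b) ell2 set \<Rightarrow> bool"
  where "open_ell2 S \<longleftrightarrow> (\<forall>f\<in>S. \<forall>\<^sub>F (f', g) in uniformity. f' = f \<longrightarrow> g \<in> S)"

instance
proof
  fix f g h :: "('a, 'b) ell2" and a b :: real and c d :: complex
  show "f + g + h = f + (g + h)" by transfer (simp add: add.assoc)
  show "f + g = g + f" by transfer (simp add: add.commute)
  show "0 + f = f" by transfer simp
  show "- f + f = 0" by transfer simp
  show "f - g = f + - g" by transfer simp
  show scaleC_right: "c *\<^sub>C (f + g) = c *\<^sub>C f + c *\<^sub>C g" for c and f g :: "('a, 'b) ell2"
    by transfer (simp add: scaleC_add_right)
  show scaleC_left: "(c + d) *\<^sub>C f = c *\<^sub>C f + d *\<^sub>C f" for c d and f :: "('a, 'b) ell2"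
    by transfer (simp add: scaleC_add_left)
  show scaleC_mult: "c *\<^sub>C d *\<^sub>C f = (c * d) *\<^sub>C f" for c d and f :: "('a, 'b) ell2"
    by transfer (simp add: scaleC_scaleC)
  have scaleC_1: "1 *\<^sub>C f = f" for f :: "('a, 'b) ell2"
    by transfer (simp add: scaleC_one)
  show "scaleR a (f + g) = scaleR a f + scaleR a g"
    by (simp add: scaleR_ell2_def scaleC_right)
  show "scaleR (a + b) f = scaleR a f + scaleR b f"
    by (simp add: scaleR_ell2_def scaleC_left)
  show "scaleR a (scaleR b f) = scaleR (a * b) f"
    by (simp add: scaleR_ell2_def scaleC_mult)
  show "scaleR 1 f = f"
    by (simp add: scaleR_ell2_def scaleC_1)
  show "scaleR a f = complex_of_real a *\<^sub>C f"
    by (rule scaleR_ell2_def)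
  show commute: "cinner f g = cnj (cinner g f)" for f g :: "('a, 'b) ell2"
  proof transfer
    fix f g :: "'a \<Rightarrow> 'b"
    have "(\<Sum>\<^sub>\<infinity>x. cinner (f x) (g x)) = (\<Sum>\<^sub>\<infinity>x. cnj (cinner (g x) (f x)))"
      by (rule infsum_cong) (rule cinner_commute)
    then show "(\<Sum>\<^sub>\<infinity>x. cinner (f x) (g x)) = cnj (\<Sum>\<^sub>\<infinity>x. cinner (g x) (f x))"
      by simp
  qed
  show add_left: "cinner (f + g) h = cinner f h + cinner g h" for f g h :: "('a, 'b) ell2"
    by transfer (simp add: cinner_add_left infsum_add ell2_cinner_summable)
  show scale_left: "cinner (c *\<^sub>C f) g = c * cinner f g" for c and f g :: "('a, 'b) ell2"
    by transfer (simp add: cinner_scaleC_left infsum_cmult_right ell2_cinner_summable)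
  show "inner f g = Re (cinner f g)"
    by (rule inner_ell2_def)
  show "inner f g = inner g f"
    by (simp add: inner_ell2_def commute[of f g])
  show "inner (f + g) h = inner f h + inner g h"
    by (simp add: inner_ell2_def add_left)
  show "inner (scaleR a f) g = a * inner f g"
    by (simp add: inner_ell2_def scaleR_ell2_def scale_left)
  have self: "inner f f = (\<Sum>\<^sub>\<infinity>x. (norm (ell2_apply f x))\<^sup>2)"
    for f :: "('a, 'b) ell2"
    using infsum_Re[OF ell2_cinner_summable, of "ell2_apply f" "ell2_apply f"] ell2_apply[of f]
    by (simp add: inner_ell2_def cinner_ell2.rep_eq cinner_self)
  show "0 \<le> inner f f"
    unfolding self by (rule infsum_nonneg) simp
  show "(inner f f = 0) = (f = 0)"
  proof
    assume "inner f f = 0"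
    then have "(norm (ell2_apply f x))\<^sup>2 = 0" for x
      using ell2_apply[of f] unfolding self
      by (intro nonneg_infsum_le_0D[where A = UNIV and f = "\<lambda>x. (norm (ell2_apply f x))\<^sup>2"])
        simp_all
    then have "ell2_apply f x = 0" for x
      by simp
    then show "f = 0"
      by (simp add: ell2_apply_inject[symmetric] zero_ell2.rep_eq fun_eq_iff)
  next
    assume "f = 0"
    then show "inner f f = 0"
      unfolding self by (simp add: zero_ell2.rep_eq)
  qed
  show "norm f = sqrt (inner f f)" by (rule norm_ell2_def)
  show "dist f g = norm (f - g)" by (rule dist_ell2_def)
  show "sgn f = scaleR (inverse (norm f)) f" by (rule sgn_ell2_def)
  show "uniformity = (INF e\<in>{0<..}. principal {(f :: ('a, 'b) ell2, g). dist f g < e})"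
    by (rule uniformity_ell2_def)
  show "open S \<longleftrightarrow> (\<forall>f\<in>S. \<forall>\<^sub>F (f', g) in uniformity. f' = f \<longrightarrow> g \<in> S)"
    for S :: "('a, 'b) ell2 set"
    by (rule open_ell2_def)
qed

end

text \<open>The function with value \<open>\<phi>\<close> at \<open>y\<close> and \<open>0\<close> elsewhere.\<close>

lift_definition delta :: "'i \<Rightarrow> 'w::complex_inner \<Rightarrow> ('i, 'w) ell2"
  is "\<lambda>y \<phi> x. if x = y then \<phi> else 0"
proof -
  fix y :: 'i and \<phi> :: 'w
  have "finite {y}" by simp
  then have "(\<lambda>x. (norm (if x = y then \<phi> else 0))\<^sup>2) summable_on {y}"
    by (rule summable_on_finite)
  then show "(\<lambda>x. (norm (if x = y then \<phi> else 0))\<^sup>2) summable_on UNIV"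
    by (rule summable_on_cong_neutral[THEN iffD1, rotated -1]) auto
qed

lift_definition translate ::
  "'i::ab_group_add \<Rightarrow> ('i, 'w::complex_inner) ell2 \<Rightarrow> ('i, 'w) ell2"
  is "\<lambda>a f x. f (x - a)"
proof -
  fix a :: 'i and f :: "'i \<Rightarrow> 'w"
  assume f: "(\<lambda>x. (norm (f x))\<^sup>2) summable_on UNIV"
  have "bij (\<lambda>x. x - a)"
    by (rule bijI') (auto intro: exI[of _ "_ + a"])
  then show "(\<lambda>x. (norm (f (x - a)))\<^sup>2) summable_on UNIV"
    using summable_on_reindex_bij_betw[of "\<lambda>x. x - a" UNIV UNIV "\<lambda>x. (norm (f x))\<^sup>2"] f by simp
qed


section \<open>Periodic unitary transition operators\<close>

definition unitary_operator :: "('h::complex_inner \<Rightarrow> 'h) \<Rightarrow> bool"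
  where "unitary_operator U \<longleftrightarrow>
    clinear U \<and> surj U \<and> (\<forall>f g. cinner (U f) (U g) = cinner f g)"

definition periodic_unitary_transition ::
  "((int ^ 'd, 'w::complex_inner) ell2 \<Rightarrow> (int ^ 'd, 'w) ell2) \<Rightarrow> bool"
  where "periodic_unitary_transition U \<longleftrightarrow>
    unitary_operator U \<and>
    (\<forall>a f. U (translate a f) = translate a (U f)) \<and>
    (\<exists>S. finite S \<and> (\<forall>x y \<phi>. y \<notin> (\<lambda>s. x + s) ` S \<longrightarrow> ell2_apply (U (delta x \<phi>)) y = 0))"

definition torus :: "(complex ^ 'd) set"
  where "torus = {z. \<forall>j. cmod (z $ j) = 1}"

definition monomial :: "complex ^ 'd \<Rightarrow> int ^ 'd \<Rightarrow> complex"
  where "monomial z x = (\<Prod>j\<in>UNIV. (z $ j) powi (x $ j))"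

text \<open>
  The operator usually written as \<open>U\<close> with a hat, evaluated at \<open>z\<close>. By the finiteness of the set of
  steps, only finitely many terms of the sum are nonzero.
\<close>

definition fourier_symbol ::
  "((int ^ 'd, 'w::complex_inner) ell2 \<Rightarrow> (int ^ 'd, 'w) ell2) \<Rightarrow> complex ^ 'd \<Rightarrow> 'w \<Rightarrow> 'w"
  where "fourier_symbol U z \<phi> = (\<Sum>\<^sub>\<infinity>x. monomial z (- x) *\<^sub>C ell2_apply (U (delta 0 \<phi>)) x)"


section \<open>Spectral notions\<close>

definition is_eigenvalue :: "('h::complex_inner \<Rightarrow> 'h) \<Rightarrow> complex \<Rightarrow> bool"
  where "is_eigenvalue T \<omega> \<longleftrightarrow> (\<exists>v. v \<noteq> 0 \<and> T v = \<omega> *\<^sub>C v)"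

definition eigenvectors :: "('h::complex_inner \<Rightarrow> 'h) \<Rightarrow> 'h set"
  where "eigenvectors T = {v. v \<noteq> 0 \<and> (\<exists>\<omega>. T v = \<omega> *\<^sub>C v)}"

text \<open>The description below is proper for closed subspaces \<open>M\<close> of a complete space.\<close>

definition orthogonal_projection :: "'h::complex_inner set \<Rightarrow> 'h \<Rightarrow> 'h"
  where "orthogonal_projection M u = (THE p. p \<in> M \<and> (\<forall>m\<in>M. cinner (u - p) m = 0))"

definition proj_point :: "('h::complex_inner \<Rightarrow> 'h) \<Rightarrow> 'h \<Rightarrow> 'h"
  where "proj_point U = orthogonal_projection (closure (complex_vector.span (eigenvectors U)))"

definition proj_cont :: "('h::complex_inner \<Rightarrow> 'h) \<Rightarrow> 'h \<Rightarrow> 'h"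
  where "proj_cont U u = u - proj_point U u"

definition circle_borel :: "complex measure"
  where "circle_borel = restrict_space borel (sphere 0 1)"

text \<open>Arc length on the Borel sets of the unit circle, of total mass \<open>2 * pi\<close>.\<close>

definition circle_lebesgue :: "complex measure"
  where "circle_lebesgue = distr (restrict_space lborel {0..<2 * pi}) circle_borel cis"

definition projection_valued_measure :: "(complex set \<Rightarrow> 'h::complex_inner \<Rightarrow> 'h) \<Rightarrow> bool"
  where "projection_valued_measure E \<longleftrightarrow>
    (\<forall>A\<in>sets circle_borel. clinear (E A) \<and> E A \<circ> E A = E A \<and>
        (\<forall>u v. cinner (E A u) v = cinner u (E A v))) \<and>
    E (sphere 0 1) = id \<and>
    (\<forall>A\<in>sets circle_borel. \<forall>B\<in>sets circle_borel. E (A \<inter> B) = E A \<circ> E B) \<and>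
    (\<forall>A :: nat \<Rightarrow> complex set. range A \<subseteq> sets circle_borel \<longrightarrow> disjoint_family A \<longrightarrow>
        (\<forall>u. (\<lambda>n. E (A n) u) sums E (\<Union>n. A n) u))"

definition spectral_distribution ::
  "(complex set \<Rightarrow> 'h::complex_inner \<Rightarrow> 'h) \<Rightarrow> 'h \<Rightarrow> complex measure"
  where "spectral_distribution E u =
    measure_of (sphere 0 1) (sets circle_borel) (\<lambda>A. ennreal ((norm (E A u))\<^sup>2))"

text \<open>
  The identity \<open>U = \<integral> \<lambda> dE(\<lambda>)\<close> in the weak sense. By polarization it suffices to state it for the
  positive measures \<open>\<langle>E(\<cdot>)u, u\<rangle> = \<parallel>E(\<cdot>)u\<parallel>\<^sup>2\<close>.
\<close>

definition is_spectral_measure ::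
  "('h::complex_inner \<Rightarrow> 'h) \<Rightarrow> (complex set \<Rightarrow> 'h \<Rightarrow> 'h) \<Rightarrow> bool"
  where "is_spectral_measure U E \<longleftrightarrow>
    projection_valued_measure E \<and>
    (\<forall>u. cinner (U u) u = (LINT l|spectral_distribution E u. l))"

definition continuous_spectrum_ac ::
  "('h::complex_inner \<Rightarrow> 'h) \<Rightarrow> (complex set \<Rightarrow> 'h \<Rightarrow> 'h) \<Rightarrow> bool"
  where "continuous_spectrum_ac U E \<longleftrightarrow>
    (\<forall>u. absolutely_continuous circle_lebesgue (spectral_distribution E (proj_cont U u)))"

end

theory Submission
  imports
    "HOL-Probability.Probability"
    "HOL-Computational_Algebra.Fundamental_Theorem_Algebra"
    "Jordan_Normal_Form.Determinant"
    Defs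
begin

text \<open>
  For finitely supported \<open>f\<close> and a polynomial \<open>r\<close>, Parseval expresses \<open>\<parallel>r(U) f\<parallel>\<^sup>2\<close> as the mean over the
  torus of \<open>\<parallel>r(\<Phi>(z)) F(z)\<parallel>\<^sup>2\<close>, where \<open>\<Phi>\<close> is the symbol and \<open>F\<close> the (trigonometric polynomial)
  transform of \<open>f\<close>; no Hilbert space of functions on the torus is needed. If polynomials \<open>r\<^sub>j\<close> are
  uniformly bounded on the unit circle and tend to zero there outside a Lebesgue null set \<open>K\<close> of numbers
  that are not eigenvalues of every \<open>\<Phi>(z)\<close>, then \<open>r\<^sub>j(U) f\<close> tends to zero by dominated convergence,
  because almost no \<open>\<Phi>(z)\<close> has an eigenvalue in \<open>K\<close>. To see the latter, restrict \<open>det (\<Phi>(z) - \<omega>)\<close> to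
  lines in an integer direction that separates all exponents of this Laurent polynomial: for every
  \<open>\<omega>\<close> in \<open>K\<close> one gets a nonzero exponential polynomial in one variable, so near each of its zeros some
  derivative vanishes simply, and the zeros are locally a Lipschitz function of \<open>\<omega>\<close>.

  Three choices of \<open>r\<^sub>j\<close> give the theorem. Cesaro means of \<open>(\<lambda> / \<omega>)\<^sup>k\<close> with \<open>K = {\<omega>}\<close> fix every
  eigenvector for \<open>\<omega>\<close>, which must therefore vanish unless \<open>\<omega>\<close> is an eigenvalue of all \<open>\<Phi>(z)\<close>.
  Differences of these means with \<open>K = {}\<close> show that the means converge strongly; if \<open>\<omega>\<close> is an
  eigenvalue of all \<open>\<Phi>(z)\<close>, the limit is not zero. Finally, polynomials approximating the indicator
  function of a compact null set \<open>K\<close> without eigenvalues of \<open>U\<close> show that \<open>E(K) = 0\<close>.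
\<close>

section \<open>Polynomials of isometries\<close>

no_notation vec_index (infixl \<open>$\<close> 100)
hide_const (open) Module.smult

text \<open>The eigenvalues of \<Phi>(z) cannot be followed smoothly through crossings. This is why
  the dependence is reversed, with the position on a line as a function of the eigenvalue. A
  multiple zero is handled by the derivative just before the first nonvanishing one, which is again
  an exponential polynomial with the same frequencies.

  Dominated convergence reaches only finitely supported functions. Arbitrary vectors are reached by
  pairing with \<open>delta x \<phi>\<close> and moving the operator across the inner product, not
  by a density argument.

  The spectral measure is given only through the quadratic form of U itself. The link to polynomials
  of U is one inequality: the norm of E(A) u is at most that of r(U) u as soon as |r| \<ge> 1 on A.
  As only |r| enters, ordinary polynomials serve as well as trigonometric ones, because powers of
  \<lambda> have modulus one on the circle.\<close>

lemma cinner_add_right: "cinner u (v + w) = cinner u v + cinner u w"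
  for u :: "'a::complex_inner"
  by (metis cinner_add_left cinner_commute complex_cnj_add)

lemma cinner_scaleC_right: "cinner u (c *\<^sub>C v) = cnj c * cinner u v"
  for u :: "'a::complex_inner"
  by (metis cinner_commute cinner_scaleC_left complex_cnj_mult)

lemma cinner_zero_left [simp]: "cinner 0 u = 0" for u :: "'a::complex_inner"
  using cinner_add_left[of 0 0 u] by simp

lemma cinner_zero_right [simp]: "cinner u 0 = 0" for u :: "'a::complex_inner"
  using cinner_add_right[of u 0 0] by simp

lemma cinner_minus_left: "cinner (- u) v = - cinner u v" for u :: "'a::complex_inner"
  using cinner_add_left[of u "- u" v] by (simp add: add_eq_0_iff)

lemma cinner_minus_right: "cinner u (- v) = - cinner u v" for u :: "'a::complex_inner"
  using cinner_add_right[of u v "- v"] by (simp add: add_eq_0_iff)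

lemma cinner_diff_left: "cinner (u - v) w = cinner u w - cinner v w" for u :: "'a::complex_inner"
  using cinner_add_left[of u "- v" w] by (simp add: cinner_minus_left)

lemma cinner_diff_right: "cinner u (v - w) = cinner u v - cinner u w"
  for u :: "'a::complex_inner"
  using cinner_add_right[of u v "- w"] by (simp add: cinner_minus_right)

lemma cinner_sum_left: "cinner (sum f S) v = (\<Sum>x\<in>S. cinner (f x) v)"
  for v :: "'a::complex_inner"
  by (induction S rule: infinite_finite_induct) (simp_all add: cinner_add_left)

lemma cinner_sum_right: "cinner u (sum f S) = (\<Sum>x\<in>S. cinner u (f x))"
  for u :: "'a::complex_inner"
  by (induction S rule: infinite_finite_induct) (simp_all add: cinner_add_right)

lemma norm_sq_eq_cinner: "(norm u)\<^sup>2 = Re (cinner u u)" for u :: "'a::complex_inner"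
  by (simp add: cinner_self)

lemma scaleC_diff_right: "c *\<^sub>C (u - v) = c *\<^sub>C u - c *\<^sub>C v" for u :: "'a::complex_inner"
  by (rule complex_vector.scale_right_diff_distrib)

lemma scaleC_diff_left: "(b - c) *\<^sub>C u = b *\<^sub>C u - c *\<^sub>C u" for u :: "'a::complex_inner"
  by (rule complex_vector.scale_left_diff_distrib)

lemma scaleC_sum_right: "c *\<^sub>C sum f S = (\<Sum>x\<in>S. c *\<^sub>C f x)" for f :: "'b \<Rightarrow> 'a::complex_inner"
  by (rule complex_vector.scale_sum_right)

lemma clinear_add: "clinear A \<Longrightarrow> A (u + v) = A u + A v"
  by (simp add: Vector_Spaces.linear_iff)

lemma clinear_scale: "clinear A \<Longrightarrow> A (c *\<^sub>C u) = c *\<^sub>C A u"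
  by (simp add: Vector_Spaces.linear_iff)

lemma clinear_zero: "clinear A \<Longrightarrow> A 0 = 0"
  using clinear_scale[of A 0 0] by simp

lemma clinear_diff: "clinear A \<Longrightarrow> A (u - v) = A u - A v"
  by (metis clinear_add diff_add_cancel eq_diff_eq)

lemma clinear_sum: "clinear A \<Longrightarrow> A (sum f S) = (\<Sum>x\<in>S. A (f x))"
  by (induction S rule: infinite_finite_induct) (simp_all add: clinear_zero clinear_add)

lemma clinearI:
  fixes A :: "'a::complex_inner \<Rightarrow> 'b::complex_inner"
  assumes "\<And>u v. A (u + v) = A u + A v" "\<And>c u. A (c *\<^sub>C u) = c *\<^sub>C A u"
  shows "clinear A"
  by (simp add: Vector_Spaces.linear_iff assms complex_vector.vector_space_axioms)

lemma clinear_funpow: "clinear A \<Longrightarrow> clinear (A ^^ n)" for A :: "'a::complex_inner \<Rightarrow> 'a"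
proof (induction n)
  case 0
  show ?case by (rule clinearI) simp_all
next
  case (Suc n)
  then show ?case
    by (intro clinearI) (simp_all add: clinear_add clinear_scale)
qed

lemma isometry_norm:
  fixes A :: "'a::complex_inner \<Rightarrow> 'b::complex_inner"
  assumes "\<And>u v. cinner (A u) (A v) = cinner u v"
  shows "norm (A u) = norm u"
proof -
  have "(norm (A u))\<^sup>2 = (norm u)\<^sup>2"
    by (simp add: norm_sq_eq_cinner assms)
  then show ?thesis by simp
qed

definition opoly :: "('a::complex_inner \<Rightarrow> 'a) \<Rightarrow> complex poly \<Rightarrow> 'a \<Rightarrow> 'a"
  where "opoly A r u = (\<Sum>i\<le>degree r. coeff r i *\<^sub>C (A ^^ i) u)"

lemma opoly_eq_sum: "degree r \<le> n \<Longrightarrow> opoly A r u = (\<Sum>i\<le>n. coeff r i *\<^sub>C (A ^^ i) u)"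
  unfolding opoly_def
  by (rule sum.mono_neutral_left) (auto simp: coeff_eq_0)

lemma opoly_0 [simp]: "opoly A 0 u = 0"
  by (simp add: opoly_def)

lemma opoly_pCons: "opoly A (pCons c r) u = c *\<^sub>C u + opoly A r (A u)"
proof -
  have "opoly A (pCons c r) u = (\<Sum>i\<le>Suc (degree r). coeff (pCons c r) i *\<^sub>C (A ^^ i) u)"
    by (rule opoly_eq_sum) (simp add: degree_pCons_le)
  also have "\<dots> = c *\<^sub>C u + (\<Sum>i\<le>degree r. coeff r i *\<^sub>C (A ^^ i) (A u))"
    by (subst sum.atMost_Suc_shift) (simp add: funpow_swap1)
  finally show ?thesis by (simp add: opoly_def)
qed

lemma opoly_add: "opoly A (p + q) u = opoly A p u + opoly A q u"
proof -
  let ?n = "max (degree p) (degree q)"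
  have "opoly A (p + q) u = (\<Sum>i\<le>?n. coeff (p + q) i *\<^sub>C (A ^^ i) u)"
    by (rule opoly_eq_sum) (simp add: degree_add_le_max)
  then show ?thesis
    by (simp add: opoly_eq_sum[of p ?n] opoly_eq_sum[of q ?n] scaleC_add_left sum.distrib)
qed

lemma opoly_smult: "opoly A (smult c p) u = c *\<^sub>C opoly A p u"
  using opoly_eq_sum[of "smult c p" "degree p" A u]
  by (simp add: opoly_def scaleC_sum_right scaleC_scaleC)

lemma opoly_diff: "opoly A (p - q) u = opoly A p u - opoly A q u"
  using opoly_add[of A "p - q" q u] by (simp add: algebra_simps)

lemma opoly_sum: "opoly A (\<Sum>i\<in>I. p i) u = (\<Sum>i\<in>I. opoly A (p i) u)"
  by (induction I rule: infinite_finite_induct) (simp_all add: opoly_add)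

lemma opoly_monom: "opoly A (monom c n) u = c *\<^sub>C (A ^^ n) u"
proof -
  have "opoly A (monom c n) u = (\<Sum>i\<le>n. coeff (monom c n) i *\<^sub>C (A ^^ i) u)"
    by (rule opoly_eq_sum) (simp add: degree_monom_le)
  also have "\<dots> = (\<Sum>i\<in>{n}. coeff (monom c n) i *\<^sub>C (A ^^ i) u)"
    by (rule sum.mono_neutral_right) auto
  finally show ?thesis by simp
qed

lemma clinear_opoly: "clinear A \<Longrightarrow> clinear (opoly A r)"
proof (rule clinearI)
  assume "clinear A"
  then have lin: "clinear (A ^^ i)" for i
    by (rule clinear_funpow)
  show "opoly A r (u + v) = opoly A r u + opoly A r v" for u v
    by (simp add: opoly_def clinear_add[OF lin] scaleC_add_right sum.distrib)
  show "opoly A r (c *\<^sub>C u) = c *\<^sub>C opoly A r u" for c u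
    by (simp add: opoly_def clinear_scale[OF lin] scaleC_sum_right mult.commute)
qed

lemma opoly_eigenvector:
  assumes "clinear A" "A u = \<eta> *\<^sub>C u"
  shows "opoly A r u = poly r \<eta> *\<^sub>C u"
proof (induction r)
  case 0
  show ?case by simp
next
  case (pCons c r)
  have "opoly A r (\<eta> *\<^sub>C u) = \<eta> *\<^sub>C opoly A r u"
    by (rule clinear_scale[OF clinear_opoly[OF assms(1)]])
  with pCons show ?case
    by (simp add: opoly_pCons assms(2) scaleC_add_left scaleC_scaleC)
qed

section \<open>Diagonalisation of isometries in finite dimension\<close>

lemma isometry_eigenvalue_norm:
  fixes A :: "'a::complex_inner \<Rightarrow> 'a"
  assumes "\<And>u v. cinner (A u) (A v) = cinner u v" "A u = \<eta> *\<^sub>C u" "u \<noteq> 0"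
  shows "cmod \<eta> = 1"
  using isometry_norm[of A u, OF assms(1)] assms(2,3) by (simp add: norm_scaleC)

text \<open>Plays the part of the adjoint: because \<open>\<eta> * cnj \<eta> = 1\<close>, an
  eigenvector of an isometry is one of its adjoint for the conjugate eigenvalue.\<close>

lemma isometry_cinner_eigenvector:
  fixes A :: "'a::complex_inner \<Rightarrow> 'a"
  assumes iso: "\<And>u v. cinner (A u) (A v) = cinner u v" and v: "A v = \<eta> *\<^sub>C v"
  shows "cinner (A u) v = \<eta> * cinner u v"
proof (cases "v = 0")
  case False
  have "\<eta> * cnj \<eta> = 1"
    using isometry_eigenvalue_norm[OF iso v False] complex_norm_square[of \<eta>] by simp
  moreover have "cinner u v = cnj \<eta> * cinner (A u) v"
    using iso[of u v] by (simp add: v cinner_scaleC_right)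
  ultimately show ?thesis
    by (metis mult.assoc mult_1)
qed simp

lemma isometry_eigenvectors_orthogonal:
  fixes A :: "'a::complex_inner \<Rightarrow> 'a"
  assumes iso: "\<And>u v. cinner (A u) (A v) = cinner u v"
    and "A u = \<mu> *\<^sub>C u" "A v = \<eta> *\<^sub>C v" "\<mu> \<noteq> \<eta>"
  shows "cinner u v = 0"
  using isometry_cinner_eigenvector[OF iso assms(3), of u] assms(2,4)
  by (simp add: cinner_scaleC_left)

text \<open>Induction on the degree of the annihilating polynomial, splitting off one root \<eta> at
  a time. There are no Jordan blocks, because for an isometry the kernel of A - \<eta> is orthogonal
  to its range.\<close>

lemma isometry_eigenvector_decomposition:
  fixes A :: "'a::complex_inner \<Rightarrow> 'a"
  assumes lin: "clinear A" and iso: "\<And>u v. cinner (A u) (A v) = cinner u v"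
    and "p \<noteq> 0" "opoly A p u = 0"
  shows "\<exists>S e. finite S \<and> u = (\<Sum>\<eta>\<in>S. e \<eta>) \<and> (\<forall>\<eta>\<in>S. e \<eta> \<noteq> 0 \<and> A (e \<eta>) = \<eta> *\<^sub>C e \<eta>)"
  using assms(3,4)
proof (induction "degree p" arbitrary: p u)
  case 0
  then obtain c where "p = [:c:]" "c \<noteq> 0"
    by (metis degree_eq_zeroE pCons_eq_0_iff)
  with 0 have "u = 0"
    by (simp add: opoly_pCons)
  then show ?case
    by (intro exI[of _ "{}"]) simp
next
  case (Suc n)
  obtain \<eta> where "poly p \<eta> = 0"
    using fundamental_theorem_of_algebra[of p] Suc.hyps(2) by (metis Zero_not_Suc constant_degree)
  then obtain q where p: "p = [:-\<eta>, 1:] * q"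
    by (metis dvdE poly_eq_0_iff_dvd)
  with Suc.prems have q: "q \<noteq> 0" by auto
  then have "degree p = Suc (degree q)"
    unfolding p by (subst degree_mult_eq) auto
  then have deg: "n = degree q" using Suc.hyps(2) by simp
  define w where "w = A u - \<eta> *\<^sub>C u"
  have "opoly A q w = 0"
    using Suc.prems(2) unfolding p w_def
    by (simp add: opoly_smult opoly_add opoly_pCons clinear_diff[OF clinear_opoly[OF lin]]
        clinear_scale[OF clinear_opoly[OF lin]] opoly_diff)
  then obtain S e where S: "finite S" "w = (\<Sum>\<mu>\<in>S. e \<mu>)"
    "\<And>\<mu>. \<mu> \<in> S \<Longrightarrow> e \<mu> \<noteq> 0 \<and> A (e \<mu>) = \<mu> *\<^sub>C e \<mu>"
    using Suc.hyps(1)[OF deg q] by blast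
  \<comment> \<open>Subtracting preimages under A - \<eta> removes from \<open>w\<close> every
    component except the one at \<eta>; this rest is \<open>g\<close>.\<close>
  define e' where "e' \<mu> = (1 / (\<mu> - \<eta>)) *\<^sub>C e \<mu>" for \<mu>
  define v where "v = u - (\<Sum>\<mu>\<in>S - {\<eta>}. e' \<mu>)"
  define g where "g = (if \<eta> \<in> S then e \<eta> else 0)"
  have e': "A (e' \<mu>) = \<mu> *\<^sub>C e' \<mu>" "A (e' \<mu>) - \<eta> *\<^sub>C e' \<mu> = e \<mu>" "e' \<mu> \<noteq> 0"
    if "\<mu> \<in> S - {\<eta>}" for \<mu>
  proof -
    have "e \<mu> \<noteq> 0" "A (e \<mu>) = \<mu> *\<^sub>C e \<mu>" "\<mu> \<noteq> \<eta>" using S that by auto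
    then show "A (e' \<mu>) = \<mu> *\<^sub>C e' \<mu>" "e' \<mu> \<noteq> 0"
      by (simp_all add: e'_def clinear_scale[OF lin] mult.commute)
    then have "A (e' \<mu>) - \<eta> *\<^sub>C e' \<mu> = (\<mu> - \<eta>) *\<^sub>C e' \<mu>"
      by (simp add: scaleC_diff_left)
    then show "A (e' \<mu>) - \<eta> *\<^sub>C e' \<mu> = e \<mu>"
      using \<open>\<mu> \<noteq> \<eta>\<close> by (simp add: e'_def)
  qed
  have "A v - \<eta> *\<^sub>C v = w - (\<Sum>\<mu>\<in>S - {\<eta>}. A (e' \<mu>) - \<eta> *\<^sub>C e' \<mu>)"
    by (simp add: v_def w_def clinear_diff[OF lin] clinear_sum[OF lin] scaleC_diff_right
        scaleC_sum_right sum_subtractf)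
  also have "\<dots> = w - (\<Sum>\<mu>\<in>S - {\<eta>}. e \<mu>)"
    using e' by simp
  also have "\<dots> = g"
    unfolding S(2) g_def using S(1) by (auto simp: sum.remove)
  finally have Av: "A v - \<eta> *\<^sub>C v = g" .
  have g: "A g = \<eta> *\<^sub>C g"
    using S by (simp add: g_def clinear_zero[OF lin])
  \<comment> \<open>\<open>g\<close> lies both in the range and in the kernel of A - \<eta>.\<close>
  have "cinner g g = cinner (A v - \<eta> *\<^sub>C v) g"
    by (simp add: Av)
  also have "\<dots> = 0"
    by (simp add: cinner_diff_left isometry_cinner_eigenvector[OF iso g] cinner_scaleC_left)
  finally have "g = 0"
    by (simp add: cinner_self)
  with Av have v: "A v = \<eta> *\<^sub>C v" by simp
  define e'' where "e'' \<mu> = (if \<mu> = \<eta> then v else e' \<mu>)" for \<mu>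
  have "u = v + (\<Sum>\<mu>\<in>S - {\<eta>}. e' \<mu>)"
    by (simp add: v_def)
  also have "(\<Sum>\<mu>\<in>S - {\<eta>}. e' \<mu>) = (\<Sum>\<mu>\<in>S - {\<eta>}. e'' \<mu>)"
    by (rule sum.cong) (auto simp: e''_def)
  finally have u: "u = v + (\<Sum>\<mu>\<in>S - {\<eta>}. e'' \<mu>)" .
  show ?case
  proof (cases "v = 0")
    case True
    then show ?thesis
      using u S(1) e' by (intro exI[of _ "S - {\<eta>}"] exI[of _ e'']) (auto simp: e''_def)
  next
    case False
    have "u = (\<Sum>\<mu>\<in>insert \<eta> (S - {\<eta>}). e'' \<mu>)"
      using u S(1) by (subst sum.insert) (auto simp: e''_def)
    then show ?thesis
      using S(1) e' v False
      by (intro exI[of _ "insert \<eta> (S - {\<eta>})"] exI[of _ e'']) (auto simp: e''_def)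
  qed
qed

lemma annihilating_polynomial:
  fixes A :: "'a::complex_inner \<Rightarrow> 'a"
  assumes B: "finite B" "complex_vector.span B = (UNIV :: 'a set)"
  shows "\<exists>p. p \<noteq> 0 \<and> opoly A p u = 0"
\<comment> \<open>Linear dependence concerns a set of vectors, so coinciding iterates are treated
  apart; they are annihilated by a difference of two monomials.\<close>
proof (cases "inj_on (\<lambda>i. (A ^^ i) u) {..card B}")
  case False
  then obtain i j where "i \<noteq> j" and eq: "(A ^^ i) u = (A ^^ j) u"
    by (auto simp: inj_on_def)
  then have "monom 1 i - monom 1 j \<noteq> (0 :: complex poly)"
    by (metis coeff_diff coeff_monom diff_zero one_neq_zero coeff_0)
  moreover have "opoly A (monom 1 i - monom 1 j) u = 0"
    by (simp add: opoly_diff opoly_monom eq)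
  ultimately show ?thesis by blast
next
  case True
  define f where "f i = (A ^^ i) u" for i
  have inj: "inj_on f {..card B}" using True unfolding f_def .
  then have "card (f ` {..card B}) = Suc (card B)"
    by (simp add: card_image)
  then have "complex_vector.dependent (f ` {..card B})"
    using complex_vector.independent_span_bound[OF B(1), of "f ` {..card B}"] B(2) by auto
  then obtain c where c: "\<exists>v\<in>f ` {..card B}. c v \<noteq> 0" "(\<Sum>v\<in>f ` {..card B}. c v *\<^sub>C v) = 0"
    using complex_vector.dependent_finite[of "f ` {..card B}"] by auto
  then obtain k where k: "k \<le> card B" "c (f k) \<noteq> 0" by auto
  define p where "p = (\<Sum>i\<le>card B. monom (c (f i)) i)"
  have "coeff p k = c (f k)"
    using k(1) by (simp add: p_def coeff_sum coeff_monom if_distrib cong: if_cong)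
  then have "p \<noteq> 0" using k(2) by auto
  moreover have "opoly A p u = (\<Sum>v\<in>f ` {..card B}. c v *\<^sub>C v)"
    unfolding p_def opoly_sum opoly_monom f_def[symmetric] sum.reindex[OF inj] by simp
  ultimately show ?thesis using c(2) by auto
qed

lemma norm_sum_orthogonal:
  fixes e :: "'b \<Rightarrow> 'a::complex_inner"
  assumes "finite S" "\<And>i j. i \<in> S \<Longrightarrow> j \<in> S \<Longrightarrow> i \<noteq> j \<Longrightarrow> cinner (e i) (e j) = 0"
  shows "(norm (\<Sum>i\<in>S. e i))\<^sup>2 = (\<Sum>i\<in>S. (norm (e i))\<^sup>2)"
proof -
  have "cinner (\<Sum>i\<in>S. e i) (\<Sum>i\<in>S. e i) = (\<Sum>i\<in>S. \<Sum>j\<in>S. cinner (e i) (e j))"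
    unfolding cinner_sum_left unfolding cinner_sum_right by simp
  also have "\<dots> = (\<Sum>i\<in>S. cinner (e i) (e i))"
  proof (rule sum.cong)
    fix i assume "i \<in> S"
    then have "(\<Sum>j\<in>S. cinner (e i) (e j)) = (\<Sum>j\<in>{i}. cinner (e i) (e j))"
      using assms by (intro sum.mono_neutral_right) auto
    then show "(\<Sum>j\<in>S. cinner (e i) (e j)) = cinner (e i) (e i)" by simp
  qed simp
  finally show ?thesis
    by (simp add: norm_sq_eq_cinner)
qed

text \<open>Pythagoras for orthogonal eigenvectors, on which the polynomial acts by its values on
  the circle. On the symbol this yields the dominating function.\<close>

lemma opoly_norm_le:
  fixes A :: "'a::complex_inner \<Rightarrow> 'a"
  assumes B: "finite B" "complex_vector.span B = (UNIV :: 'a set)"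
    and lin: "clinear A" and iso: "\<And>u v. cinner (A u) (A v) = cinner u v"
    and bound: "\<And>\<eta>. cmod \<eta> = 1 \<Longrightarrow> cmod (poly r \<eta>) \<le> C"
  shows "norm (opoly A r u) \<le> C * norm u"
proof -
  obtain p where "p \<noteq> 0" "opoly A p u = 0"
    using annihilating_polynomial[OF B] by blast
  then obtain S e where S: "finite S" "u = (\<Sum>\<eta>\<in>S. e \<eta>)"
    "\<And>\<eta>. \<eta> \<in> S \<Longrightarrow> e \<eta> \<noteq> 0" "\<And>\<eta>. \<eta> \<in> S \<Longrightarrow> A (e \<eta>) = \<eta> *\<^sub>C e \<eta>"
    using isometry_eigenvector_decomposition[OF lin iso] by metis
  have C: "0 \<le> C"
    using order_trans[OF norm_ge_zero bound[of 1]] by simp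
  have r: "opoly A r u = (\<Sum>\<eta>\<in>S. poly r \<eta> *\<^sub>C e \<eta>)"
    using S by (simp add: clinear_sum[OF clinear_opoly[OF lin]] opoly_eigenvector[OF lin])
  have orth: "cinner (e i) (e j) = 0" if "i \<in> S" "j \<in> S" "i \<noteq> j" for i j
    using isometry_eigenvectors_orthogonal[OF iso S(4) S(4)] that by blast
  have pythagoras: "(norm (sum e S))\<^sup>2 = (\<Sum>\<eta>\<in>S. (norm (e \<eta>))\<^sup>2)"
    by (rule norm_sum_orthogonal) (use S(1) orth in auto)
  have "(norm (opoly A r u))\<^sup>2 = (\<Sum>\<eta>\<in>S. (norm (poly r \<eta> *\<^sub>C e \<eta>))\<^sup>2)"
    unfolding r using S(1) orth
    by (intro norm_sum_orthogonal) (simp_all add: cinner_scaleC_left cinner_scaleC_right)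
  also have "\<dots> \<le> (\<Sum>\<eta>\<in>S. (C * norm (e \<eta>))\<^sup>2)"
    using S(3,4) C
    by (intro sum_mono power_mono)
      (auto simp: norm_scaleC intro!: mult_right_mono bound isometry_eigenvalue_norm[OF iso])
  also have "\<dots> = (C * norm u)\<^sup>2"
    unfolding power_mult_distrib sum_distrib_left[symmetric] S(2) pythagoras ..
  finally show ?thesis
    by (rule power2_le_imp_le) (simp add: C)
qed

text \<open>The decomposition of \<open>u\<close> does not depend on \<open>j\<close>, so
  convergence at its finitely many eigenvalues suffices.\<close>

lemma opoly_tendsto_0:
  fixes A :: "'a::complex_inner \<Rightarrow> 'a"
  assumes B: "finite B" "complex_vector.span B = (UNIV :: 'a set)"
    and lin: "clinear A" and iso: "\<And>u v. cinner (A u) (A v) = cinner u v"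
    and lim: "\<And>\<eta>. is_eigenvalue A \<eta> \<Longrightarrow> (\<lambda>j. poly (r j) \<eta>) \<longlonglongrightarrow> 0"
  shows "(\<lambda>j. norm (opoly A (r j) u)) \<longlonglongrightarrow> 0"
proof -
  obtain p where "p \<noteq> 0" "opoly A p u = 0"
    using annihilating_polynomial[OF B] by blast
  then obtain S e where S: "finite S" "u = (\<Sum>\<eta>\<in>S. e \<eta>)"
    "\<And>\<eta>. \<eta> \<in> S \<Longrightarrow> e \<eta> \<noteq> 0" "\<And>\<eta>. \<eta> \<in> S \<Longrightarrow> A (e \<eta>) = \<eta> *\<^sub>C e \<eta>"
    using isometry_eigenvector_decomposition[OF lin iso] by metis
  have r: "opoly A (r j) u = (\<Sum>\<eta>\<in>S. poly (r j) \<eta> *\<^sub>C e \<eta>)" for j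
    using S by (simp add: clinear_sum[OF clinear_opoly[OF lin]] opoly_eigenvector[OF lin])
  have "(\<lambda>j. \<Sum>\<eta>\<in>S. norm (poly (r j) \<eta> *\<^sub>C e \<eta>)) \<longlonglongrightarrow> (\<Sum>\<eta>\<in>S. 0 * norm (e \<eta>))"
  proof (rule tendsto_sum)
    fix \<eta> assume "\<eta> \<in> S"
    then have "is_eigenvalue A \<eta>"
      using S unfolding is_eigenvalue_def by blast
    then have "(\<lambda>j. cmod (poly (r j) \<eta>)) \<longlonglongrightarrow> 0"
      using lim tendsto_norm_zero by blast
    then show "(\<lambda>j. norm (poly (r j) \<eta> *\<^sub>C e \<eta>)) \<longlonglongrightarrow> 0 * norm (e \<eta>)"
      unfolding norm_scaleC by (intro tendsto_mult tendsto_const)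
  qed
  then have "(\<lambda>j. \<Sum>\<eta>\<in>S. norm (poly (r j) \<eta> *\<^sub>C e \<eta>)) \<longlonglongrightarrow> 0" by simp
  then show ?thesis
    unfolding r by (rule tendsto_0_le[where K = 1]) (auto intro!: always_eventually norm_sum
      order_trans[OF norm_sum] simp: sum_nonneg)
qed

section \<open>Orthonormal bases and characteristic polynomials\<close>

definition orthonormal_basis :: "'a::complex_inner set \<Rightarrow> bool"
  where "orthonormal_basis B \<longleftrightarrow> finite B \<and>
    (\<forall>b\<in>B. \<forall>c\<in>B. cinner b c = (if b = c then 1 else 0)) \<and> (\<forall>u. u = (\<Sum>b\<in>B. cinner u b *\<^sub>C b))"

text \<open>Gram-Schmidt; a vector already in the span of the earlier ones is dropped, so
  \<open>B\<close> may be dependent.\<close>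

lemma orthonormal_spanning_set:
  fixes B :: "'a::complex_inner set"
  assumes "finite B"
  shows "\<exists>Q. finite Q \<and> (\<forall>b\<in>Q. \<forall>c\<in>Q. cinner b c = (if b = c then 1 else 0)) \<and>
    complex_vector.span Q = complex_vector.span B"
  using assms
proof (induction B)
  case empty
  show ?case by (intro exI[of _ "{}"]) simp
next
  case (insert b B)
  then obtain Q where Q: "finite Q" "\<And>b c. b \<in> Q \<Longrightarrow> c \<in> Q \<Longrightarrow> cinner b c = (if b = c then 1 else 0)"
    and span: "complex_vector.span Q = complex_vector.span B"
    by blast
  define s where "s = (\<Sum>q\<in>Q. cinner b q *\<^sub>C q)"
  define c where "c = b - s"
  have s: "s \<in> complex_vector.span Q"
    unfolding s_def by (intro complex_vector.span_sum complex_vector.span_scale complex_vector.span_base)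
  have cq: "cinner c q = 0" if "q \<in> Q" for q
  proof -
    have "cinner s q = (\<Sum>r\<in>Q. if r = q then cinner b r else 0)"
      unfolding s_def cinner_sum_left
      by (rule sum.cong) (simp_all add: cinner_scaleC_left Q(2) that)
    also have "\<dots> = cinner b q"
      using Q(1) that by simp
    finally show ?thesis by (simp add: c_def cinner_diff_left)
  qed
  show ?case
  proof (cases "c = 0")
    case True
    then have "b \<in> complex_vector.span B"
      using s span by (simp add: c_def)
    then have "complex_vector.span (insert b B) = complex_vector.span B"
      by (rule complex_vector.span_redundant)
    then show ?thesis
      using Q span by (intro exI[of _ Q]) simp
  next
    case False
    define d where "d = complex_of_real (1 / norm c) *\<^sub>C c"
    have "norm d = 1"
      using False by (simp add: d_def norm_scaleC norm_divide)
    then have d: "cinner d d = 1"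
      by (simp add: cinner_self)
    have dq: "cinner d q = 0" "cinner q d = 0" if "q \<in> Q" for q
      using cq[OF that] cinner_commute[of q d] by (simp_all add: d_def cinner_scaleC_left)
    have "d \<notin> Q" using d dq by fastforce
    \<comment> \<open>Writing \<open>d\<close> as a multiple of \<open>b\<close> minus an element of
      the old span lets the two spans be compared by rescaling the coefficient
      \<open>k\<close>.\<close>
    define t where "t = complex_of_real (1 / norm c)"
    have t: "t \<noteq> 0" "d = t *\<^sub>C b - t *\<^sub>C s"
      using False by (simp_all add: t_def d_def c_def scaleC_diff_right)
    have "complex_vector.span (insert d Q) = complex_vector.span (insert b B)"
      unfolding complex_vector.span_insert span
    proof (intro Collect_cong iffI; elim exE)
      fix x k
      assume "x - k *\<^sub>C d \<in> complex_vector.span B"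
      moreover have "(k * t) *\<^sub>C s \<in> complex_vector.span B"
        using s span by (simp add: complex_vector.span_scale)
      ultimately have "x - k *\<^sub>C d - (k * t) *\<^sub>C s \<in> complex_vector.span B"
        by (rule complex_vector.span_diff)
      also have "x - k *\<^sub>C d - (k * t) *\<^sub>C s = x - (k * t) *\<^sub>C b"
        by (simp add: t(2) scaleC_diff_right)
      finally show "\<exists>k. x - k *\<^sub>C b \<in> complex_vector.span B" ..
    next
      fix x k
      assume "x - k *\<^sub>C b \<in> complex_vector.span B"
      moreover have "k *\<^sub>C s \<in> complex_vector.span B"
        using s span by (simp add: complex_vector.span_scale)
      ultimately have "x - k *\<^sub>C b + k *\<^sub>C s \<in> complex_vector.span B"
        by (rule complex_vector.span_add)
      also have "x - k *\<^sub>C b + k *\<^sub>C s = x - (k / t) *\<^sub>C d"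
        using t(1) by (simp add: t(2) scaleC_diff_right)
      finally show "\<exists>k. x - k *\<^sub>C d \<in> complex_vector.span B" ..
    qed
    then show ?thesis
      using Q d dq \<open>d \<notin> Q\<close> by (intro exI[of _ "insert d Q"]) auto
  qed
qed

lemma cinner_span_eq_0:
  fixes u :: "'a::complex_inner"
  assumes "v \<in> complex_vector.span B" "\<And>b. b \<in> B \<Longrightarrow> cinner u b = 0"
  shows "cinner u v = 0"
  using assms(1)
  by (induction rule: complex_vector.span_induct_alt)
    (simp_all add: cinner_add_right cinner_scaleC_right assms(2))

lemma orthonormal_basis_exists:
  fixes B :: "'a::complex_inner set"
  assumes "finite B" "complex_vector.span B = UNIV"
  shows "\<exists>Q :: 'a set. orthonormal_basis Q"
proof -
  obtain Q :: "'a set" where Q: "finite Q" "\<forall>b\<in>Q. \<forall>c\<in>Q. cinner b c = (if b = c then 1 else 0)"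
    and span: "complex_vector.span Q = UNIV"
    using orthonormal_spanning_set[OF assms(1)] unfolding assms(2) by blast
  have "u = (\<Sum>b\<in>Q. cinner u b *\<^sub>C b)" for u
  proof -
    define w where "w = u - (\<Sum>b\<in>Q. cinner u b *\<^sub>C b)"
    have "cinner w q = 0" if "q \<in> Q" for q
    proof -
      have "(\<Sum>b\<in>Q. cinner (cinner u b *\<^sub>C b) q) = (\<Sum>b\<in>Q. if b = q then cinner u b else 0)"
        by (rule sum.cong) (simp_all add: cinner_scaleC_left Q(2) that)
      also have "\<dots> = cinner u q"
        using Q(1) that by simp
      finally show ?thesis by (simp add: w_def cinner_diff_left cinner_sum_left)
    qed
    then have "cinner w w = 0"
      by (intro cinner_span_eq_0[of w Q]) (simp_all add: span)
    then show ?thesis by (simp add: cinner_self w_def)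
  qed
  with Q show ?thesis
    unfolding orthonormal_basis_def by blast
qed

lemma orthonormal_basis_finite: "orthonormal_basis B \<Longrightarrow> finite B"
  by (simp add: orthonormal_basis_def)

lemma orthonormal_basis_expand: "orthonormal_basis B \<Longrightarrow> (\<Sum>b\<in>B. cinner u b *\<^sub>C b) = u"
  unfolding orthonormal_basis_def by metis

lemma orthonormal_basis_cinner:
  "orthonormal_basis B \<Longrightarrow> b \<in> B \<Longrightarrow> c \<in> B \<Longrightarrow> cinner b c = (if b = c then 1 else 0)"
  unfolding orthonormal_basis_def by blast

lemma orthonormal_basis_span:
  assumes "orthonormal_basis B"
  shows "complex_vector.span B = UNIV"
proof -
  have "u \<in> complex_vector.span B" for u
  proof -
    have "(\<Sum>b\<in>B. cinner u b *\<^sub>C b) \<in> complex_vector.span B"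
      by (intro complex_vector.span_sum complex_vector.span_scale complex_vector.span_base)
    then show ?thesis by (simp only: orthonormal_basis_expand[OF assms])
  qed
  then show ?thesis by blast
qed

text \<open>Completeness of the fibre, obtained from its coordinates; \<open>ell2_convergent\<close>
  lifts it to the space of square summable functions.\<close>

lemma finite_dim_convergent:
  fixes X :: "nat \<Rightarrow> 'a::complex_inner"
  assumes B: "orthonormal_basis (B :: 'a set)" and X: "Cauchy X"
  shows "convergent X"
proof -
  have "\<exists>l. (\<lambda>n. cinner (X n) b) \<longlonglongrightarrow> l" for b
  proof -
    have "Cauchy (\<lambda>n. cinner (X n) b)"
    proof (rule metric_CauchyI)
      fix e :: real assume "0 < e"
      then have "0 < e / (norm b + 1)"
        by (simp add: add_nonneg_pos)
      then obtain M where M: "\<And>m n. m \<ge> M \<Longrightarrow> n \<ge> M \<Longrightarrow> dist (X m) (X n) < e / (norm b + 1)"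
        using metric_CauchyD[OF X] by blast
      have "dist (cinner (X m) b) (cinner (X n) b) < e" if "m \<ge> M" "n \<ge> M" for m n
      proof -
        have "dist (cinner (X m) b) (cinner (X n) b) \<le> norm (X m - X n) * norm b"
          using norm_cinner_le[of "X m - X n" b] by (simp add: dist_norm cinner_diff_left)
        also have "\<dots> \<le> norm (X m - X n) * (norm b + 1)"
          by (intro mult_left_mono) simp_all
        also have "\<dots> < e"
          using M[OF that] by (simp add: dist_norm pos_less_divide_eq add_nonneg_pos)
        finally show ?thesis .
      qed
      then show "\<exists>M. \<forall>m\<ge>M. \<forall>n\<ge>M. dist (cinner (X m) b) (cinner (X n) b) < e" by blast
    qed
    then show ?thesis
      using Cauchy_convergent_iff convergent_def by blast
  qed
  then obtain l where l: "\<And>b. (\<lambda>n. cinner (X n) b) \<longlonglongrightarrow> l b" by metis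
  have "(\<lambda>n. \<Sum>b\<in>B. cinner (X n) b *\<^sub>C b) \<longlonglongrightarrow> (\<Sum>b\<in>B. l b *\<^sub>C b)"
  proof (rule tendsto_sum)
    fix b
    have "(\<lambda>n. cmod (cinner (X n) b - l b) * norm b) \<longlonglongrightarrow> 0 * norm b"
      by (intro tendsto_mult tendsto_const tendsto_norm_zero) (use l in \<open>simp add: LIM_zero_iff\<close>)
    then have "(\<lambda>n. norm (cinner (X n) b *\<^sub>C b - l b *\<^sub>C b)) \<longlonglongrightarrow> 0"
      by (simp add: norm_scaleC flip: scaleC_diff_left)
    then show "(\<lambda>n. cinner (X n) b *\<^sub>C b) \<longlonglongrightarrow> l b *\<^sub>C b"
      by (simp add: LIM_zero_iff tendsto_norm_zero_iff)
  qed
  then show ?thesis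
    unfolding orthonormal_basis_expand[OF B] convergent_def by blast
qed

text \<open>Turns eigenvalues of the symbol into zeros of a determinant, whose dependence on z and
  \<omega> is explicit.\<close>

lemma eigenvalue_iff_det:
  fixes A :: "'a::complex_inner \<Rightarrow> 'a"
  assumes B: "orthonormal_basis B" and b: "bij_betw b {..<n} B" and lin: "clinear A"
  shows "is_eigenvalue A \<omega> \<longleftrightarrow>
    Determinant.det (mat n n (\<lambda>(i, j). cinner (A (b j)) (b i) - (if i = j then \<omega> else 0))) = 0"
proof -
  define M where "M = mat n n (\<lambda>(i, j). cinner (A (b j)) (b i) - (if i = j then \<omega> else 0))"
  have bb: "cinner (b i) (b j) = (if i = j then 1 else 0)" if "i < n" "j < n" for i j
    using orthonormal_basis_cinner[OF B, of "b i" "b j"] b that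
    by (auto simp: bij_betw_def inj_on_def)
  have expand: "(\<Sum>j<n. cinner u (b j) *\<^sub>C b j) = u" for u
    using sum.reindex_bij_betw[OF b, of "\<lambda>c. cinner u c *\<^sub>C c"] orthonormal_basis_expand[OF B]
    by simp
  have eq0: "u = 0" if "\<And>i. i < n \<Longrightarrow> cinner u (b i) = 0" for u
    using expand[of u] that by simp
  \<comment> \<open>The matrix acts on the coordinates of \<open>u\<close> as A - \<omega> acts on
    \<open>u\<close>.\<close>
  have Mv: "vec_index (M *\<^sub>v vec n v) i = cinner (A u - \<omega> *\<^sub>C u) (b i)"
    if "i < n" and u: "u = (\<Sum>j<n. v j *\<^sub>C b j)" for i u v
  proof -
    have "vec_index (M *\<^sub>v vec n v) i =
        (\<Sum>j<n. (cinner (A (b j)) (b i) - (if i = j then \<omega> else 0)) * v j)"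
      using that(1) by (simp add: M_def scalar_prod_def atLeast0LessThan)
    also have "\<dots> = (\<Sum>j<n. v j * cinner (A (b j)) (b i) - \<omega> * (v j * cinner (b j) (b i)))"
      by (rule sum.cong) (auto simp: bb that(1) algebra_simps)
    also have "\<dots> = cinner (A u - \<omega> *\<^sub>C u) (b i)"
      unfolding u
      by (simp add: clinear_sum[OF lin] clinear_scale[OF lin] cinner_diff_left cinner_sum_left
          cinner_scaleC_left sum_subtractf sum_distrib_left)
    finally show ?thesis .
  qed
  have "is_eigenvalue A \<omega> \<longleftrightarrow> (\<exists>v. v \<in> carrier_vec n \<and> v \<noteq> 0\<^sub>v n \<and> M *\<^sub>v v = 0\<^sub>v n)"
  proof
    assume "is_eigenvalue A \<omega>"
    then obtain u where u: "u \<noteq> 0" "A u = \<omega> *\<^sub>C u"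
      unfolding is_eigenvalue_def by blast
    define v where "v = vec n (\<lambda>j. cinner u (b j))"
    have "v \<noteq> 0\<^sub>v n"
    proof
      assume "v = 0\<^sub>v n"
      then have "cinner u (b i) = 0" if "i < n" for i
        using that by (auto simp: v_def vec_eq_iff)
      then show False using eq0 u(1) by blast
    qed
    moreover have "M *\<^sub>v v = 0\<^sub>v n"
    proof (rule eq_vecI)
      show "vec_index (M *\<^sub>v v) i = vec_index (0\<^sub>v n) i" if "i < dim_vec (0\<^sub>v n)" for i
        using Mv[of i u "\<lambda>j. cinner u (b j)"] that u(2) by (simp add: v_def expand)
    qed (simp add: M_def)
    ultimately show "\<exists>v. v \<in> carrier_vec n \<and> v \<noteq> 0\<^sub>v n \<and> M *\<^sub>v v = 0\<^sub>v n"
      by (intro exI[of _ v]) (simp add: v_def)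
  next
    assume "\<exists>v. v \<in> carrier_vec n \<and> v \<noteq> 0\<^sub>v n \<and> M *\<^sub>v v = 0\<^sub>v n"
    then obtain v where v: "v \<in> carrier_vec n" "v \<noteq> 0\<^sub>v n" "M *\<^sub>v v = 0\<^sub>v n" by blast
    define u where "u = (\<Sum>j<n. vec_index v j *\<^sub>C b j)"
    have v': "v = vec n (vec_index v)" using v(1) by auto
    have "cinner (A u - \<omega> *\<^sub>C u) (b i) = 0" if "i < n" for i
      using Mv[OF that u_def] v(3) v' that by simp
    then have "A u - \<omega> *\<^sub>C u = 0" by (rule eq0)
    moreover have "u \<noteq> 0"
    proof
      assume "u = 0"
      have "vec_index v i = 0" if "i < n" for i
      proof -
        have "cinner u (b i) = (\<Sum>j<n. if j = i then vec_index v j else 0)"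
          unfolding u_def cinner_sum_left
          by (rule sum.cong) (simp_all add: cinner_scaleC_left bb that)
        then show ?thesis using \<open>u = 0\<close> that by simp
      qed
      then have "v = 0\<^sub>v n" using v(1) by (intro eq_vecI) auto
      then show False using v(2) by simp
    qed
    ultimately show "is_eigenvalue A \<omega>"
      unfolding is_eigenvalue_def by (intro exI[of _ u]) simp
  qed
  also have "\<dots> \<longleftrightarrow> Determinant.det M = 0"
    by (rule det_0_iff_vec_prod_zero_field[symmetric]) (simp add: M_def)
  finally show ?thesis unfolding M_def .
qed

section \<open>Laurent polynomials on the torus\<close>

lemma monomial_add:
  assumes "z \<in> torus"
  shows "monomial z (x + y) = monomial z x * monomial z y"
proof -
  have "vec_nth z j \<noteq> 0" for j
    using assms by (auto simp: torus_def dest: spec[of _ j])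
  then show ?thesis
    by (simp add: monomial_def power_int_add prod.distrib)
qed

lemma monomial_0 [simp]: "monomial z 0 = 1"
  by (simp add: monomial_def)

text \<open>Laurent polynomials in z whose coefficients are polynomials in \<omega>. The identity is
  asked for on the torus only, where no coordinate vanishes and \<open>monomial\<close> is
  multiplicative in the exponent.\<close>

definition laurent_family :: "(complex ^ 'd \<Rightarrow> complex \<Rightarrow> complex) \<Rightarrow> bool"
  where "laurent_family f \<longleftrightarrow> (\<exists>X p. finite X \<and>
    (\<forall>z\<in>torus. \<forall>\<omega>. f z \<omega> = (\<Sum>x\<in>X. poly (p x) \<omega> * monomial z x)))"

text \<open>Merges terms with equal exponents once and for all, so that sums and products may be
  written over any finite index set. Distinct exponents matter later, when a single coefficient is
  isolated.\<close>

lemma laurent_familyI: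
  fixes x :: "'i \<Rightarrow> int ^ 'd"
  assumes I: "finite I"
    and f: "\<And>z \<omega>. z \<in> torus \<Longrightarrow> f z \<omega> = (\<Sum>i\<in>I. poly (p i) \<omega> * monomial z (x i))"
  shows "laurent_family f"
proof -
  define q where "q y = (\<Sum>i\<in>{i \<in> I. x i = y}. p i)" for y
  have "f z \<omega> = (\<Sum>y\<in>x ` I. poly (q y) \<omega> * monomial z y)" if "z \<in> torus" for z \<omega>
  proof -
    have "f z \<omega> = (\<Sum>y\<in>x ` I. \<Sum>i\<in>{i \<in> I. x i = y}. poly (p i) \<omega> * monomial z (x i))"
      unfolding f[OF that] by (rule sum.image_gen[OF I])
    also have "\<dots> = (\<Sum>y\<in>x ` I. poly (q y) \<omega> * monomial z y)"
      by (rule sum.cong) (simp_all add: q_def poly_sum sum_distrib_right)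
    finally show ?thesis .
  qed
  then show ?thesis
    unfolding laurent_family_def using I by (intro exI[of _ "x ` I"] exI[of _ q]) auto
qed

lemma laurent_family_poly: "laurent_family (\<lambda>z \<omega>. poly q \<omega>)"
  by (rule laurent_familyI[of "{0 :: nat}" _ "\<lambda>_. q" "\<lambda>_. 0"]) auto

lemma laurent_family_const: "laurent_family (\<lambda>z \<omega>. c)"
  using laurent_family_poly[of "[:c:]"] by simp

lemma laurent_family_monomial: "laurent_family (\<lambda>z \<omega>. c * monomial z x)"
  by (rule laurent_familyI[of "{0 :: nat}" _ "\<lambda>_. [:c:]" "\<lambda>_. x"]) auto

lemma laurent_family_add:
  assumes "laurent_family f" "laurent_family g"
  shows "laurent_family (\<lambda>z \<omega>. f z \<omega> + g z \<omega>)"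
proof -
  obtain X p where X: "finite X"
    "\<And>z \<omega>. z \<in> torus \<Longrightarrow> f z \<omega> = (\<Sum>x\<in>X. poly (p x) \<omega> * monomial z x)"
    using assms(1) unfolding laurent_family_def by blast
  obtain Y q where Y: "finite Y"
    "\<And>z \<omega>. z \<in> torus \<Longrightarrow> g z \<omega> = (\<Sum>x\<in>Y. poly (q x) \<omega> * monomial z x)"
    using assms(2) unfolding laurent_family_def by blast
  show ?thesis
    by (rule laurent_familyI[of "X <+> Y" _ "case_sum p q" "case_sum id id"])
      (simp_all add: X Y sum.Plus)
qed

lemma laurent_family_mult:
  assumes "laurent_family f" "laurent_family g"
  shows "laurent_family (\<lambda>z \<omega>. f z \<omega> * g z \<omega>)"
proof -
  obtain X p where X: "finite X"
    "\<And>z \<omega>. z \<in> torus \<Longrightarrow> f z \<omega> = (\<Sum>x\<in>X. poly (p x) \<omega> * monomial z x)"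
    using assms(1) unfolding laurent_family_def by blast
  obtain Y q where Y: "finite Y"
    "\<And>z \<omega>. z \<in> torus \<Longrightarrow> g z \<omega> = (\<Sum>x\<in>Y. poly (q x) \<omega> * monomial z x)"
    using assms(2) unfolding laurent_family_def by blast
  show ?thesis
    by (rule laurent_familyI[of "X \<times> Y" _ "\<lambda>(x, y). p x * q y" "\<lambda>(x, y). x + y"])
      (simp_all add: X Y sum_product sum.cartesian_product monomial_add case_prod_beta mult_ac)
qed

lemma laurent_family_sum:
  "(\<And>i. i \<in> I \<Longrightarrow> laurent_family (f i)) \<Longrightarrow> laurent_family (\<lambda>z \<omega>. \<Sum>i\<in>I. f i z \<omega>)"
  by (induction I rule: infinite_finite_induct) (simp_all add: laurent_family_const laurent_family_add)

lemma laurent_family_prod: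
  "(\<And>i. i \<in> I \<Longrightarrow> laurent_family (f i)) \<Longrightarrow> laurent_family (\<lambda>z \<omega>. \<Prod>i\<in>I. f i z \<omega>)"
  by (induction I rule: infinite_finite_induct) (simp_all add: laurent_family_const laurent_family_mult)

lemma laurent_family_det:
  assumes "\<And>i j. laurent_family (f i j)"
  shows "laurent_family (\<lambda>z \<omega>. Determinant.det (mat n n (\<lambda>(i, j). f i j z \<omega>)))"
proof -
  have "laurent_family (\<lambda>z \<omega>. \<Sum>p | p permutes {0..<n}. signof p * (\<Prod>i = 0..<n. f i (p i) z \<omega>))"
    by (intro laurent_family_sum laurent_family_mult laurent_family_prod laurent_family_const assms)
  moreover have "Determinant.det (mat n n (\<lambda>(i, j). f i j z \<omega>)) =
      (\<Sum>p | p permutes {0..<n}. signof p * (\<Prod>i = 0..<n. f i (p i) z \<omega>))" for z \<omega>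
  proof -
    have "p i < n" if "p permutes {0..<n}" "i < n" for p i
      using permutes_in_image[OF that(1), of i] that(2) by simp
    then show ?thesis
      by (subst det_def'[of _ n]) (auto intro!: sum.cong prod.cong)
  qed
  ultimately show ?thesis by simp
qed

section \<open>Square summable functions and their transforms\<close>

lemmas ell2_apply_simps [simp] = zero_ell2.rep_eq plus_ell2.rep_eq uminus_ell2.rep_eq
  minus_ell2.rep_eq scaleC_ell2.rep_eq translate.rep_eq delta.rep_eq

lemma ell2_eqI: "(\<And>x. ell2_apply f x = ell2_apply g x) \<Longrightarrow> f = g"
  using ell2_apply_inject by blast

lemma ell2_apply_sum: "ell2_apply (sum f S) x = (\<Sum>i\<in>S. ell2_apply (f i) x)"
  by (induction S rule: infinite_finite_induct) simp_all

lemma ell2_summable: "(\<lambda>x. (norm (ell2_apply f x))\<^sup>2) summable_on UNIV"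
  using ell2_apply[of f] by simp

lemma norm_ell2_sq: "(norm f)\<^sup>2 = (\<Sum>\<^sub>\<infinity>x. (norm (ell2_apply f x))\<^sup>2)"
  for f :: "('i, 'w::complex_inner) ell2"
proof -
  have "(norm f)\<^sup>2 = Re (\<Sum>\<^sub>\<infinity>x. cinner (ell2_apply f x) (ell2_apply f x))"
    by (simp add: norm_sq_eq_cinner cinner_ell2.rep_eq)
  also have "\<dots> = (\<Sum>\<^sub>\<infinity>x. Re (cinner (ell2_apply f x) (ell2_apply f x)))"
    by (intro infsum_Re[symmetric] ell2_cinner_summable ell2_summable)
  finally show ?thesis
    by (simp add: norm_sq_eq_cinner)
qed

lemma norm_ell2_apply_le: "norm (ell2_apply f x) \<le> norm f"
proof -
  have "(norm (ell2_apply f x))\<^sup>2 = (\<Sum>\<^sub>\<infinity>y\<in>{x}. (norm (ell2_apply f y))\<^sup>2)"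
    by simp
  also have "\<dots> \<le> (norm f)\<^sup>2"
    unfolding norm_ell2_sq by (rule infsum_mono_neutral) (auto simp: ell2_summable)
  finally show ?thesis
    by (rule power2_le_imp_le) simp
qed

lemma cinner_delta: "cinner f (delta x \<phi>) = cinner (ell2_apply f x) \<phi>"
proof -
  have "cinner f (delta x \<phi>) = (\<Sum>\<^sub>\<infinity>y. cinner (ell2_apply f y) (if y = x then \<phi> else 0))"
    by (simp add: cinner_ell2.rep_eq)
  also have "\<dots> = (\<Sum>\<^sub>\<infinity>y\<in>{x}. cinner (ell2_apply f y) (if y = x then \<phi> else 0))"
    by (rule infsum_cong_neutral) auto
  finally show ?thesis by simp
qed

text \<open>The limit is taken pointwise in the fibre. The Cauchy estimate for finite partial sums
  survives this limit and then controls the whole series.\<close>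

lemma ell2_convergent:
  fixes X :: "nat \<Rightarrow> ('i, 'w::complex_inner) ell2"
  assumes B: "orthonormal_basis (B :: 'w set)" and X: "Cauchy X"
  shows "convergent X"
proof -
  have "convergent (\<lambda>n. ell2_apply (X n) x)" for x
  proof (rule finite_dim_convergent[OF B])
    have "dist (ell2_apply (X m) x) (ell2_apply (X n) x) \<le> dist (X m) (X n)" for m n
      using norm_ell2_apply_le[of "X m - X n" x] by (simp add: dist_norm)
    then show "Cauchy (\<lambda>n. ell2_apply (X n) x)"
      using X unfolding Cauchy_def by (meson le_less_trans)
  qed
  then obtain g where g: "\<And>x. (\<lambda>n. ell2_apply (X n) x) \<longlonglongrightarrow> g x"
    unfolding convergent_def by metis
  have fin: "(\<Sum>x\<in>F. (norm (ell2_apply (X n) x - g x))\<^sup>2) \<le> e\<^sup>2"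
    if "finite F" "0 < e" and close: "\<And>m. m \<ge> n \<Longrightarrow> dist (X n) (X m) < e" for F n e
  proof (rule LIMSEQ_le_const2)
    show "(\<lambda>m. \<Sum>x\<in>F. (norm (ell2_apply (X n) x - ell2_apply (X m) x))\<^sup>2)
        \<longlonglongrightarrow> (\<Sum>x\<in>F. (norm (ell2_apply (X n) x - g x))\<^sup>2)"
      by (intro tendsto_intros g)
    have "(\<Sum>x\<in>F. (norm (ell2_apply (X n) x - ell2_apply (X m) x))\<^sup>2) \<le> e\<^sup>2" if "m \<ge> n" for m
    proof -
      have "(\<Sum>x\<in>F. (norm (ell2_apply (X n) x - ell2_apply (X m) x))\<^sup>2)
          = (\<Sum>\<^sub>\<infinity>x\<in>F. (norm (ell2_apply (X n - X m) x))\<^sup>2)"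
        using \<open>finite F\<close> by simp
      also have "\<dots> \<le> (norm (X n - X m))\<^sup>2"
        unfolding norm_ell2_sq
        by (rule infsum_mono_neutral) (use \<open>finite F\<close> ell2_summable in \<open>auto simp del: ell2_apply_simps\<close>)
      also have "\<dots> \<le> e\<^sup>2"
        using close[OF that] by (intro power_mono) (simp_all add: dist_norm)
      finally show ?thesis .
    qed
    then show "\<exists>N. \<forall>m\<ge>N. (\<Sum>x\<in>F. (norm (ell2_apply (X n) x - ell2_apply (X m) x))\<^sup>2) \<le> e\<^sup>2"
      by blast
  qed
  have sq_summable: "(\<lambda>x. (norm (ell2_apply (X n) x - g x))\<^sup>2) summable_on UNIV"
    if "0 < e" "\<And>m. m \<ge> n \<Longrightarrow> dist (X n) (X m) < e" for n e
    by (rule nonneg_bdd_above_summable_on) (auto intro!: bdd_aboveI fin that)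
  have ex: "\<exists>N. \<forall>n\<ge>N. \<forall>m\<ge>n. dist (X n) (X m) < e" if "0 < e" for e
    using metric_CauchyD[OF X that] by (meson order_trans)
  obtain N where "\<And>m. m \<ge> N \<Longrightarrow> dist (X N) (X m) < 1"
    using ex[of 1] by auto
  then have "(\<lambda>x. (norm (ell2_apply (X N) x - g x))\<^sup>2) summable_on UNIV"
    by (intro sq_summable[of 1]) simp_all
  \<comment> \<open>\<open>g\<close> is \<open>X N\<close> minus the square summable function
    \<open>X N - g\<close>.\<close>
  then have "(\<lambda>x. (norm (ell2_apply (X N) x + - (ell2_apply (X N) x - g x)))\<^sup>2) summable_on UNIV"
    by (intro ell2_add_summable ell2_summable) (simp only: norm_minus_cancel)
  then have "(\<lambda>x. (norm (g x))\<^sup>2) summable_on UNIV"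
    by simp
  then obtain f where f: "ell2_apply f = g"
    using Abs_ell2_inverse[of g] by blast
  have "X \<longlonglongrightarrow> f"
  proof (rule metric_LIMSEQ_I)
    fix e :: real assume "0 < e"
    then obtain N where N: "\<And>n m. n \<ge> N \<Longrightarrow> m \<ge> n \<Longrightarrow> dist (X n) (X m) < e / 2"
      using ex[of "e / 2"] by auto
    have "dist (X n) f < e" if "n \<ge> N" for n
    proof -
      have "(norm (X n - f))\<^sup>2 \<le> (e / 2)\<^sup>2"
        unfolding norm_ell2_sq
        by (rule infsum_le_finite_sums[OF ell2_summable])
          (use fin[of _ "e / 2" n] N[OF that] \<open>0 < e\<close> in \<open>simp add: f\<close>)
      then have "norm (X n - f) \<le> e / 2"
        using \<open>0 < e\<close> by (simp add: power2_le_iff_abs_le)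
      then show ?thesis
        using \<open>0 < e\<close> by (simp add: dist_norm)
    qed
    then show "\<exists>N. \<forall>n\<ge>N. dist (X n) f < e" by blast
  qed
  then show ?thesis
    unfolding convergent_def by blast
qed

section \<open>Finitely supported functions and their transforms\<close>

definition fin_supp :: "('i, 'w::complex_inner) ell2 \<Rightarrow> bool"
  where "fin_supp f \<longleftrightarrow> finite {x. ell2_apply f x \<noteq> 0}"

text \<open>The inverse Fourier transform of \<open>f\<close> as a finite sum. For infinite support
  the sum has the default value 0, which is why additivity asks for \<open>fin_supp\<close>.\<close>

definition fhat :: "(int ^ 'd, 'w::complex_inner) ell2 \<Rightarrow> complex ^ 'd \<Rightarrow> 'w"
  where "fhat f z = (\<Sum>x | ell2_apply f x \<noteq> 0. monomial z (- x) *\<^sub>C ell2_apply f x)"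

lemma fhat_eq_sum:
  assumes "finite X" "\<And>x. ell2_apply f x \<noteq> 0 \<Longrightarrow> x \<in> X"
  shows "fhat f z = (\<Sum>x\<in>X. monomial z (- x) *\<^sub>C ell2_apply f x)"
  unfolding fhat_def by (rule sum.mono_neutral_left) (use assms in auto)

lemma fin_suppI: "finite X \<Longrightarrow> (\<And>x. ell2_apply f x \<noteq> 0 \<Longrightarrow> x \<in> X) \<Longrightarrow> fin_supp f"
  unfolding fin_supp_def by (rule finite_subset[of _ X]) auto

lemma fin_supp_0 [simp]: "fin_supp 0"
  by (simp add: fin_supp_def)

lemma fin_supp_delta [simp]: "fin_supp (delta x \<phi>)"
  by (rule fin_suppI[of "{x}"]) (auto split: if_splits)

lemma fin_supp_scaleC: "fin_supp f \<Longrightarrow> fin_supp (c *\<^sub>C f)"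
  by (rule fin_suppI[of "{x. ell2_apply f x \<noteq> 0}"]) (auto simp: fin_supp_def)

lemma fin_supp_add: "fin_supp f \<Longrightarrow> fin_supp g \<Longrightarrow> fin_supp (f + g)"
  by (rule fin_suppI[of "{x. ell2_apply f x \<noteq> 0} \<union> {x. ell2_apply g x \<noteq> 0}"])
    (auto simp: fin_supp_def)

lemma fin_supp_sum: "(\<And>i. i \<in> I \<Longrightarrow> fin_supp (f i)) \<Longrightarrow> fin_supp (sum f I)"
  by (induction I rule: infinite_finite_induct) (simp_all add: fin_supp_add)

lemma fhat_scaleC: "fin_supp f \<Longrightarrow> fhat (c *\<^sub>C f) z = c *\<^sub>C fhat f z"
  using fhat_eq_sum[of "{x. ell2_apply f x \<noteq> 0}" "c *\<^sub>C f" z]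
  by (simp add: fin_supp_def fhat_def scaleC_sum_right mult.commute)

lemma fhat_add:
  assumes "fin_supp f" "fin_supp g"
  shows "fhat (f + g) z = fhat f z + fhat g z"
proof -
  let ?X = "{x. ell2_apply f x \<noteq> 0} \<union> {x. ell2_apply g x \<noteq> 0}"
  have X: "finite ?X" using assms by (simp add: fin_supp_def)
  have "fhat f z = (\<Sum>x\<in>?X. monomial z (- x) *\<^sub>C ell2_apply f x)"
    "fhat g z = (\<Sum>x\<in>?X. monomial z (- x) *\<^sub>C ell2_apply g x)"
    "fhat (f + g) z = (\<Sum>x\<in>?X. monomial z (- x) *\<^sub>C ell2_apply (f + g) x)"
    by (intro fhat_eq_sum[OF X]; auto)+
  then show ?thesis by (simp add: scaleC_add_right sum.distrib)
qed

lemma fhat_0 [simp]: "fhat 0 z = 0"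
  by (simp add: fhat_def)

lemma fhat_sum: "(\<And>i. i \<in> I \<Longrightarrow> fin_supp (f i)) \<Longrightarrow> fhat (sum f I) z = (\<Sum>i\<in>I. fhat (f i) z)"
  by (induction I rule: infinite_finite_induct) (simp_all add: fhat_add fin_supp_sum)

lemma fhat_delta: "fhat (delta x \<phi>) z = monomial z (- x) *\<^sub>C \<phi>"
  by (subst fhat_eq_sum[of "{x}"]) (auto split: if_splits)

lemma translate_support:
  "{x. ell2_apply (translate a f) x \<noteq> 0} = (\<lambda>x. x + a) ` {x. ell2_apply f x \<noteq> 0}"
  by (auto intro!: image_eqI[of _ _ "_ - a"])

lemma fhat_translate:
  assumes "z \<in> torus"
  shows "fhat (translate a f) z = monomial z (- a) *\<^sub>C fhat f z"
proof -
  have "fhat (translate a f) z =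
      (\<Sum>x | ell2_apply f x \<noteq> 0. monomial z (- x - a) *\<^sub>C ell2_apply f x)"
    unfolding fhat_def translate_support by (subst sum.reindex) (auto simp: inj_on_def)
  moreover have "monomial z (- x - a) = monomial z (- a) * monomial z (- x)" for x
    using monomial_add[OF assms, of "- x" "- a"] by simp
  ultimately show ?thesis
    by (simp add: fhat_def scaleC_sum_right)
qed

lemma fin_supp_expand:
  assumes "fin_supp f"
  shows "f = (\<Sum>x | ell2_apply f x \<noteq> 0. delta x (ell2_apply f x))"
  by (rule ell2_eqI) (use assms in \<open>simp add: ell2_apply_sum fin_supp_def\<close>)

lemma translate_delta: "translate a (delta x \<phi>) = delta (x + a) \<phi>"
  by (rule ell2_eqI) (auto simp: algebra_simps)

lemma cnj_monomial:
  assumes "z \<in> torus"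
  shows "cnj (monomial z x) = monomial z (- x)"
proof -
  have "cnj (vec_nth z j) = inverse (vec_nth z j)" for j
    using assms by (simp add: torus_def inverse_complex_def complex_eq_iff cmod_def)
  then have "cnj (vec_nth z j powi k) = vec_nth z j powi (- k)" for j k
    by (simp add: power_int_minus power_int_inverse )
  then show ?thesis by (simp add: monomial_def)
qed

lemma cmod_monomial:
  assumes "z \<in> torus"
  shows "cmod (monomial z x) = 1"
  using assms by (simp add: monomial_def torus_def prod_norm[symmetric] norm_power_int)

lemma norm_fhat_le:
  assumes "z \<in> torus"
  shows "norm (fhat f z) \<le> (\<Sum>x | ell2_apply f x \<noteq> 0. norm (ell2_apply f x))"
  unfolding fhat_def
  by (rule order_trans[OF norm_sum]) (simp add: norm_scaleC cmod_monomial[OF assms])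

text \<open>The coefficients are correlations of \<open>f\<close> with translates of
  \<open>g\<close>. An isometry that commutes with translations preserves them, and the one at
  \<open>w = 0\<close> is the inner product; the first fact gives the isometry of the symbol, the
  second Parseval.\<close>

lemma cinner_fhat:
  fixes f g :: "(int ^ 'd, 'w::complex_inner) ell2"
  assumes f: "fin_supp f" and g: "fin_supp g"
  shows "\<exists>D. finite D \<and> 0 \<in> D \<and> (\<forall>z\<in>torus. cinner (fhat f z) (fhat g z) =
    (\<Sum>w\<in>D. monomial z (- w) * cinner (translate (- w) f) g))"
proof -
  define X where "X = {x. ell2_apply f x \<noteq> 0}"
  define Y where "Y = {x. ell2_apply g x \<noteq> 0}"
  have fin: "finite X" "finite Y"
    using assms by (simp_all add: X_def Y_def fin_supp_def)
  \<comment> \<open>Zero is inserted so that the constant term can be singled out even if the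
    supports of \<open>f\<close> and \<open>g\<close> are disjoint.\<close>
  define D where "D = insert 0 ((\<lambda>(x, y). x - y) ` (X \<times> Y))"
  have D: "finite D" using fin by (simp add: D_def)
  have corr: "cinner (translate (- w) f) g =
      (\<Sum>(x, y)\<in>{xy \<in> X \<times> Y. (\<lambda>(x, y). x - y) xy = w}. cinner (ell2_apply f x) (ell2_apply g y))" for w
  proof -
    have "cinner (translate (- w) f) g = (\<Sum>\<^sub>\<infinity>y. cinner (ell2_apply f (y + w)) (ell2_apply g y))"
      by (simp add: cinner_ell2.rep_eq)
    also have "\<dots> = (\<Sum>\<^sub>\<infinity>y\<in>{y \<in> Y. y + w \<in> X}. cinner (ell2_apply f (y + w)) (ell2_apply g y))"
      by (rule infsum_cong_neutral) (auto simp: X_def Y_def)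
    also have "\<dots> = (\<Sum>y\<in>{y \<in> Y. y + w \<in> X}. cinner (ell2_apply f (y + w)) (ell2_apply g y))"
      using fin by simp
    also have "\<dots> = (\<Sum>(x, y)\<in>{xy \<in> X \<times> Y. (\<lambda>(x, y). x - y) xy = w}.
        cinner (ell2_apply f x) (ell2_apply g y))"
      by (rule sum.reindex_bij_witness[of _ snd "\<lambda>y. (y + w, y)"]) auto
    finally show ?thesis .
  qed
  have "cinner (fhat f z) (fhat g z) = (\<Sum>w\<in>D. monomial z (- w) * cinner (translate (- w) f) g)"
    if z: "z \<in> torus" for z
  proof -
    have "cinner (fhat f z) (fhat g z) = (\<Sum>x\<in>X. \<Sum>y\<in>Y.
        monomial z (- x) * (cnj (monomial z (- y)) * cinner (ell2_apply f x) (ell2_apply g y)))"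
      unfolding fhat_def X_def[symmetric] Y_def[symmetric] cinner_sum_left
      unfolding cinner_sum_right by (simp add: cinner_scaleC_left cinner_scaleC_right mult_ac)
    also have "\<dots> = (\<Sum>(x, y)\<in>X \<times> Y. monomial z (- (x - y)) * cinner (ell2_apply f x) (ell2_apply g y))"
      unfolding sum.cartesian_product
      by (rule sum.cong) (auto simp: cnj_monomial[OF z] mult.assoc[symmetric]
          simp flip: monomial_add[OF z])
    also have "\<dots> = (\<Sum>w\<in>D. \<Sum>(x, y)\<in>{xy \<in> X \<times> Y. (\<lambda>(x, y). x - y) xy = w}.
        monomial z (- (x - y)) * cinner (ell2_apply f x) (ell2_apply g y))"
      by (rule sum.group[symmetric]) (use fin D in \<open>auto simp: D_def\<close>)
    also have "\<dots> = (\<Sum>w\<in>D. monomial z (- w) * cinner (translate (- w) f) g)"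
      unfolding corr sum_distrib_left by (intro sum.cong) (auto simp: case_prod_beta)
    finally show ?thesis .
  qed
  with D show ?thesis
    by (intro exI[of _ D]) (auto simp: D_def)
qed

section \<open>The symbol and the Parseval formula\<close>

locale periodic_walk =
  fixes U :: "(int ^ 'd, 'w::complex_inner) ell2 \<Rightarrow> (int ^ 'd, 'w) ell2"
    and B :: "'w set"
  assumes periodic: "periodic_unitary_transition U"
    and basis: "orthonormal_basis B"
begin

lemma lin: "clinear U"
  using periodic by (simp add: periodic_unitary_transition_def unitary_operator_def)

lemma iso: "cinner (U f) (U g) = cinner f g"
  using periodic by (simp add: periodic_unitary_transition_def unitary_operator_def)

lemma U_translate: "U (translate a f) = translate a (U f)"
  using periodic by (simp add: periodic_unitary_transition_def)

lemma fin_supp_U_delta: "fin_supp (U (delta x \<phi>))"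
proof -
  obtain S where "finite S"
    "\<And>x y \<phi>. y \<notin> (\<lambda>s. x + s) ` S \<Longrightarrow> ell2_apply (U (delta x \<phi>)) y = 0"
    using periodic unfolding periodic_unitary_transition_def by blast
  then show ?thesis
    by (intro fin_suppI[of "(\<lambda>s. x + s) ` S"]) auto
qed

lemma U_expand:
  assumes "fin_supp f"
  shows "U f = (\<Sum>x | ell2_apply f x \<noteq> 0. U (delta x (ell2_apply f x)))"
proof -
  have "U f = U (\<Sum>x | ell2_apply f x \<noteq> 0. delta x (ell2_apply f x))"
    by (rule arg_cong[OF fin_supp_expand[OF assms]])
  also have "\<dots> = (\<Sum>x | ell2_apply f x \<noteq> 0. U (delta x (ell2_apply f x)))"
    by (rule clinear_sum[OF lin])
  finally show ?thesis .
qed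

lemma fin_supp_U: "fin_supp f \<Longrightarrow> fin_supp (U f)"
  by (subst U_expand) (auto intro: fin_supp_sum fin_supp_U_delta)

lemma fin_supp_opoly: "fin_supp f \<Longrightarrow> fin_supp (opoly U r f)"
proof (induction r arbitrary: f)
  case (pCons c r)
  then show ?case
    by (simp add: opoly_pCons fin_supp_add fin_supp_scaleC fin_supp_U)
qed simp

abbreviation symbol :: "complex ^ 'd \<Rightarrow> 'w \<Rightarrow> 'w"
  where "symbol \<equiv> fourier_symbol U"

lemma symbol_eq: "symbol z \<phi> = fhat (U (delta 0 \<phi>)) z"
proof -
  let ?X = "{x. ell2_apply (U (delta 0 \<phi>)) x \<noteq> 0}"
  have "symbol z \<phi> = (\<Sum>\<^sub>\<infinity>x\<in>?X. monomial z (- x) *\<^sub>C ell2_apply (U (delta 0 \<phi>)) x)"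
    unfolding fourier_symbol_def by (rule infsum_cong_neutral) auto
  then show ?thesis
    using fin_supp_U_delta[of 0 \<phi>] by (simp add: fin_supp_def fhat_def)
qed

lemma delta_add: "delta x (\<phi> + \<psi>) = delta x \<phi> + delta x \<psi>" for \<phi> :: 'w and x :: "int ^ 'd"
  by (rule ell2_eqI) simp

lemma delta_scaleC: "delta x (c *\<^sub>C \<phi>) = c *\<^sub>C delta x \<phi>" for \<phi> :: 'w and x :: "int ^ 'd"
  by (rule ell2_eqI) simp

lemma symbol_lin: "clinear (symbol z)"
  by (rule clinearI)
    (simp_all add: symbol_eq delta_add delta_scaleC clinear_add[OF lin] clinear_scale[OF lin]
      fhat_add fhat_scaleC fin_supp_U_delta)

text \<open>The correlations of \<open>U (delta 0 \<phi>)\<close> and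
  \<open>U (delta 0 \<psi>)\<close> equal those of the two delta functions, which vanish unless
  \<open>w = 0\<close>. Only the constant term remains.\<close>

lemma symbol_iso:
  assumes "z \<in> torus"
  shows "cinner (symbol z \<phi>) (symbol z \<psi>) = cinner \<phi> \<psi>"
proof -
  obtain D where D: "finite D" "0 \<in> D" "cinner (fhat (U (delta 0 \<phi>)) z) (fhat (U (delta 0 \<psi>)) z) =
      (\<Sum>w\<in>D. monomial z (- w) * cinner (translate (- w) (U (delta 0 \<phi>))) (U (delta 0 \<psi>)))"
    using cinner_fhat[OF fin_supp_U_delta fin_supp_U_delta, of 0 \<phi> 0 \<psi>] assms by blast
  have "cinner (translate (- w) (U (delta 0 \<phi>))) (U (delta 0 \<psi>)) =
      (if w = 0 then cinner \<phi> \<psi> else 0)" for w :: "int ^ 'd"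
    by (simp add: iso translate_delta cinner_delta flip: U_translate)
  then have "cinner (symbol z \<phi>) (symbol z \<psi>) =
      (\<Sum>w\<in>D. monomial z (- w) * (if w = 0 then cinner \<phi> \<psi> else 0))"
    unfolding symbol_eq D(3) by simp
  also have "\<dots> = (\<Sum>w\<in>D. if w = 0 then cinner \<phi> \<psi> else 0)"
    by (rule sum.cong) auto
  also have "\<dots> = cinner \<phi> \<psi>"
    using D by simp
  finally show ?thesis .
qed

lemma fhat_U:
  assumes z: "z \<in> torus" and f: "fin_supp f"
  shows "fhat (U f) z = symbol z (fhat f z)"
proof -
  have shift: "U (delta x \<phi>) = translate x (U (delta 0 \<phi>))" for x \<phi>
    by (simp add: translate_delta flip: U_translate)
  have "fhat (U (delta x \<phi>)) z = monomial z (- x) *\<^sub>C symbol z \<phi>" for x \<phi>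
    by (subst shift) (simp add: fhat_translate[OF z] symbol_eq)
  then have "fhat (U f) z = (\<Sum>x | ell2_apply f x \<noteq> 0. monomial z (- x) *\<^sub>C symbol z (ell2_apply f x))"
    unfolding U_expand[OF f] by (simp add: fhat_sum fin_supp_U_delta)
  also have "\<dots> = symbol z (fhat f z)"
    by (simp add: fhat_def clinear_sum[OF symbol_lin] clinear_scale[OF symbol_lin])
  finally show ?thesis .
qed

lemma fhat_opoly:
  assumes z: "z \<in> torus" and f: "fin_supp f"
  shows "fhat (opoly U r f) z = opoly (symbol z) r (fhat f z)"
  using f
proof (induction r arbitrary: f)
  case (pCons c r)
  then show ?case
    by (simp add: opoly_pCons fhat_add fhat_scaleC fin_supp_scaleC fin_supp_opoly fin_supp_U
        fhat_U[OF z])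
qed simp

lemma symbol_laurent: "laurent_family (\<lambda>z \<omega>. cinner (symbol z \<phi>) \<psi>)"
proof -
  have eq: "cinner (symbol z \<phi>) \<psi> = (\<Sum>x | ell2_apply (U (delta 0 \<phi>)) x \<noteq> 0.
      cinner (ell2_apply (U (delta 0 \<phi>)) x) \<psi> * monomial z (- x))" for z
    by (simp add: symbol_eq fhat_def cinner_sum_left cinner_scaleC_left mult.commute)
  show ?thesis
    unfolding eq by (intro laurent_family_sum laurent_family_monomial)
qed

lemma eigenvalue_laurent:
  "\<exists>X p. finite X \<and> (\<forall>z\<in>torus. \<forall>\<omega>. is_eigenvalue (symbol z) \<omega> \<longleftrightarrow>
    (\<Sum>x\<in>X. poly (p x) \<omega> * monomial z x) = 0)"
proof -
  obtain b where b: "bij_betw b {..<card B} B"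
    using ex_bij_betw_nat_finite[OF orthonormal_basis_finite[OF basis]] by (metis atLeast0LessThan)
  \<comment> \<open>The diagonal term -\<omega> is read as the value of a polynomial, so that the
    whole determinant is polynomial in \<omega>.\<close>
  have "laurent_family (\<lambda>z \<omega>. if i = j then poly [:0, -1:] \<omega> else 0)" for i j :: nat
    using laurent_family_poly[of "[:0, -1:]"] laurent_family_const[of 0] by (cases "i = j") simp_all
  then have "laurent_family (\<lambda>z \<omega>. cinner (symbol z (b j)) (b i) + (if i = j then poly [:0, -1:] \<omega> else 0))" for i j
    by (intro laurent_family_add symbol_laurent)
  then have "laurent_family (\<lambda>z \<omega>. Determinant.det (mat (card B) (card B)
      (\<lambda>(i, j). cinner (symbol z (b j)) (b i) + (if i = j then poly [:0, -1:] \<omega> else 0))))"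
    by (rule laurent_family_det)
  then obtain X p where "finite X" and X: "\<forall>z\<in>torus. \<forall>\<omega>. Determinant.det (mat (card B) (card B)
      (\<lambda>(i, j). cinner (symbol z (b j)) (b i) + (if i = j then poly [:0, -1:] \<omega> else 0))) =
      (\<Sum>x\<in>X. poly (p x) \<omega> * monomial z x)"
    unfolding laurent_family_def by blast
  have entry: "cinner (symbol z (b j)) (b i) + (if i = j then poly [:0, -1:] \<omega> else 0) =
      cinner (symbol z (b j)) (b i) - (if i = j then \<omega> else 0)" for z i j \<omega>
    by simp
  show ?thesis
    unfolding eigenvalue_iff_det[OF basis b symbol_lin]
    using \<open>finite X\<close> X unfolding entry by (intro exI[of _ X] exI[of _ p]) simp
qed

end

section \<open>Averages over the torus\<close>

definition unit_interval :: "real measure"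
  where "unit_interval = restrict_space lborel {0..1}"

definition unit_cube :: "('d::finite \<Rightarrow> real) measure"
  where "unit_cube = PiM UNIV (\<lambda>_. unit_interval)"

text \<open>
  The point \<open>\<zeta>\<close> moved by \<open>t\<close> along the direction \<open>n\<close>. Averaging over \<open>\<zeta>\<close> alone would already give the
  mean over the torus; the redundant inner average over \<open>t\<close> replaces an argument about null sets of the
  torus by one about null sets of the line.
\<close>

definition torus_point :: "int ^ 'd \<Rightarrow> ('d \<Rightarrow> real) \<Rightarrow> real \<Rightarrow> complex ^ 'd"
  where "torus_point n \<zeta> t = (\<chi> j. cis (2 * pi * (\<zeta> j + of_int (vec_nth n j) * t)))"

definition int_dot :: "int ^ 'd \<Rightarrow> int ^ 'd \<Rightarrow> int"
  where "int_dot n x = (\<Sum>j\<in>UNIV. vec_nth n j * vec_nth x j)"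

lemma torus_point_in_torus: "torus_point n \<zeta> t \<in> torus"
  by (simp add: torus_def torus_point_def)

lemma cis_sum: "cis (sum f S) = (\<Prod>x\<in>S. cis (f x))"
  by (induction S rule: infinite_finite_induct) (simp_all flip: cis_mult)

text \<open>Separates the base point from the motion along the line: a Laurent polynomial becomes an
  exponential polynomial in \<open>t\<close> with frequencies \<open>2 * pi * int_dot n x\<close>,
  and \<zeta> contributes only phases of its coefficients.\<close>

lemma monomial_torus_point:
  "monomial (torus_point n \<zeta> t) x =
    (\<Prod>j\<in>UNIV. cis (2 * pi * of_int (vec_nth x j) * \<zeta> j)) * cis (2 * pi * of_int (int_dot n x) * t)"
proof -
  have "monomial (torus_point n \<zeta> t) x = (\<Prod>j\<in>UNIV. cis (2 * pi * of_int (vec_nth x j) * \<zeta> j) *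
      cis (2 * pi * of_int (vec_nth n j * vec_nth x j) * t))"
    unfolding monomial_def torus_point_def
    by (rule prod.cong) (simp_all add: cis_power_int cis_mult algebra_simps)
  also have "\<dots> = (\<Prod>j\<in>UNIV. cis (2 * pi * of_int (vec_nth x j) * \<zeta> j)) *
      cis (\<Sum>j\<in>UNIV. 2 * pi * of_int (vec_nth n j * vec_nth x j) * t)"
    by (simp only: prod.distrib cis_sum)
  also have "(\<Sum>j\<in>UNIV. 2 * pi * of_int (vec_nth n j * vec_nth x j) * t) =
      2 * pi * of_int (int_dot n x) * t"
    by (simp add: int_dot_def sum_distrib_left sum_distrib_right)
  finally show ?thesis .
qed

lemma prob_space_unit_interval: "prob_space unit_interval"
  unfolding unit_interval_def by (rule prob_space_restrict_space) simp_all

lemma prob_space_unit_cube: "prob_space unit_cube"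
  unfolding unit_cube_def by (intro prob_space_PiM prob_space_unit_interval)

lemma cis_measurable [measurable]: "cis \<in> borel_measurable borel"
  by (intro borel_measurable_continuous_onI continuous_on_cis continuous_on_id)

lemma measurable_unit_interval_id [measurable]: "(\<lambda>x. x) \<in> borel_measurable unit_interval"
  unfolding unit_interval_def by (intro measurable_restrict_space1) simp

lemma integral_cis_unit_interval:
  "(LINT t|unit_interval. cis (2 * pi * of_int m * t)) = (if m = 0 then 1 else 0)"
proof -
  have cont: "continuous_on {0..1} (\<lambda>t. cis (2 * pi * of_int m * t))"
    by (intro continuous_intros)
  have "(LINT t|unit_interval. cis (2 * pi * of_int m * t)) =
      integral {0..1} (\<lambda>t. cis (2 * pi * of_int m * t))"
    unfolding unit_interval_def
    by (subst integral_restrict_space, simp, fold set_lebesgue_integral_def)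
      (intro set_borel_integral_eq_integral(2) borel_integrable_atLeastAtMost' cont)
  also have "\<dots> = (if m = 0 then 1 else 0)"
  proof (cases "m = 0")
    case False
    define a where "a = 2 * pi * real_of_int m"
    have "a \<noteq> 0" using False by (simp add: a_def)
    have "((\<lambda>t. cis (a * t)) has_integral (cis (a * 1) / (\<i> * a) - cis (a * 0) / (\<i> * a))) {0..1}"
    proof (rule fundamental_theorem_of_calculus)
      show "((\<lambda>t. cis (a * t) / (\<i> * a)) has_vector_derivative cis (a * t)) (at t within {0..1})" for t
        unfolding cis_conv_exp using \<open>a \<noteq> 0\<close>
        by (auto intro!: derivative_eq_intros has_vector_derivative_real_field simp: field_simps)
    qed simp
    moreover have "cis a = 1"
      using cis_multiple_2pi[of "of_int m"] by (simp add: a_def)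
    ultimately show ?thesis
      using False by (simp add: a_def integral_unique)
  qed simp
  finally show ?thesis .
qed

text \<open>For nonzero \<open>x\<close> the average over \<zeta> already vanishes, and for
  \<open>x = 0\<close> so does the frequency along the line. The mean is therefore the same for
  every direction \<open>n\<close>, which can be chosen later to suit the determinant.\<close>

lemma integral_monomial:
  "(LINT \<zeta>|unit_cube. LINT t|unit_interval. monomial (torus_point n \<zeta> t) x) = (if x = 0 then 1 else 0)"
proof -
  interpret product_sigma_finite "\<lambda>_ :: 'a. unit_interval"
    by (simp add: product_sigma_finite_def prob_space_imp_sigma_finite prob_space_unit_interval)
  interpret I: prob_space unit_interval by (rule prob_space_unit_interval)
  have int: "integrable unit_interval (\<lambda>t. cis (2 * pi * of_int m * t))" for m
    by (rule I.integrable_const_bound[where B = 1]) auto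
  have "(LINT \<zeta>|unit_cube. LINT t|unit_interval. monomial (torus_point n \<zeta> t) x) =
      (LINT \<zeta>|unit_cube. (\<Prod>j\<in>UNIV. cis (2 * pi * of_int (vec_nth x j) * \<zeta> j))) *
      (if int_dot n x = 0 then 1 else 0)"
    unfolding monomial_torus_point by (simp add: integral_cis_unit_interval)
  also have "(LINT \<zeta>|unit_cube. (\<Prod>j\<in>UNIV. cis (2 * pi * of_int (vec_nth x j) * \<zeta> j))) =
      (\<Prod>j\<in>UNIV. if vec_nth x j = 0 then 1 else 0)"
    unfolding unit_cube_def
    by (subst product_integral_prod) (simp_all add: int integral_cis_unit_interval)
  also have "\<dots> * (if int_dot n x = 0 then 1 else 0) = (if x = 0 then 1 else 0)"
  proof (cases "x = 0")
    case True
    then show ?thesis by (simp add: int_dot_def)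
  next
    case False
    then obtain j where "vec_nth x j \<noteq> 0" by (auto simp: Finite_Cartesian_Product.vec_eq_iff)
    then have "(\<Prod>j\<in>UNIV. if vec_nth x j = 0 then 1 else 0 :: complex) = 0"
      by (intro prod_zero) auto
    with False show ?thesis by simp
  qed
  finally show ?thesis .
qed

lemma measurable_monomial [measurable]:
  "(\<lambda>(\<zeta>, t). monomial (torus_point n \<zeta> t) x) \<in> borel_measurable (unit_cube \<Otimes>\<^sub>M unit_interval)"
proof -
  have "(\<lambda>\<zeta>. \<zeta> j) \<in> borel_measurable unit_cube" for j :: 'a
    unfolding unit_cube_def
    by (rule measurable_compose[where g = "\<lambda>x. x" and N = unit_interval])
      (simp_all add: measurable_component_singleton)
  note [measurable] = this
  show ?thesis
    unfolding monomial_torus_point split_beta by measurable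
qed

text \<open>The squared norm is written as a scalar trigonometric polynomial, so that measurability
  of functions with values in the fibre does not enter.\<close>

lemma measurable_norm_fhat:
  assumes "fin_supp f"
  shows "(\<lambda>(\<zeta>, t). (norm (fhat f (torus_point n \<zeta> t)))\<^sup>2) \<in>
    borel_measurable (unit_cube \<Otimes>\<^sub>M unit_interval)"
proof -
  obtain D where "\<And>z. z \<in> torus \<Longrightarrow> cinner (fhat f z) (fhat f z) =
      (\<Sum>w\<in>D. monomial z (- w) * cinner (translate (- w) f) f)"
    using cinner_fhat[OF assms assms] by blast
  then have "(norm (fhat f (torus_point n \<zeta> t)))\<^sup>2 =
      Re (\<Sum>w\<in>D. monomial (torus_point n \<zeta> t) (- w) * cinner (translate (- w) f) f)" for \<zeta> t
    by (simp add: norm_sq_eq_cinner torus_point_in_torus)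
  then show ?thesis
    by (simp add: split_beta')
qed

text \<open>Averaging the expansion of \<open>cinner_fhat\<close> leaves its constant term.\<close>

lemma parseval:
  assumes "fin_supp f"
  shows "(norm f)\<^sup>2 =
    (LINT \<zeta>|unit_cube. LINT t|unit_interval. (norm (fhat f (torus_point n \<zeta> t)))\<^sup>2)"
proof -
  interpret I: prob_space unit_interval by (rule prob_space_unit_interval)
  interpret Q: prob_space "unit_cube :: ('a \<Rightarrow> real) measure" by (rule prob_space_unit_cube)
  interpret pair_sigma_finite "unit_cube :: ('a \<Rightarrow> real) measure" unit_interval ..
  interpret QI: pair_prob_space "unit_cube :: ('a \<Rightarrow> real) measure" unit_interval ..
  define e where "e \<zeta> t w = monomial (torus_point n \<zeta> t) (- w)" for \<zeta> t w
  have "integrable (unit_cube \<Otimes>\<^sub>M unit_interval) (\<lambda>(\<zeta>, t). e \<zeta> t w)" for w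
    unfolding e_def
    by (rule QI.integrable_const_bound[where B = 1])
      (auto simp: cmod_monomial torus_point_in_torus)
  then have int1: "integrable unit_cube (\<lambda>\<zeta>. LINT t|unit_interval. e \<zeta> t w)" for w
    using integrable_fst by fastforce
  have int2: "integrable unit_interval (\<lambda>t. e \<zeta> t w)" for \<zeta> w
    unfolding e_def
    by (rule I.integrable_const_bound[where B = 1])
      (auto simp: cmod_monomial torus_point_in_torus, simp add: monomial_torus_point)
  obtain D where D: "finite D" "0 \<in> D" "\<And>z. z \<in> torus \<Longrightarrow> cinner (fhat f z) (fhat f z) =
      (\<Sum>w\<in>D. monomial z (- w) * cinner (translate (- w) f) f)"
    using cinner_fhat[OF assms assms] by blast
  define c where "c w = cinner (translate (- w) f) f" for w
  have "complex_of_real (LINT \<zeta>|unit_cube. LINT t|unit_interval. (norm (fhat f (torus_point n \<zeta> t)))\<^sup>2) =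
      (LINT \<zeta>|unit_cube. LINT t|unit_interval. (\<Sum>w\<in>D. e \<zeta> t w * c w))"
    by (simp add: D(3) torus_point_in_torus e_def c_def
        flip: integral_complex_of_real cinner_self del: of_real_power)
  also have "\<dots> = (\<Sum>w\<in>D. (LINT \<zeta>|unit_cube. LINT t|unit_interval. e \<zeta> t w) * c w)"
    by (simp add: Bochner_Integration.integral_sum int1 int2)
  also have "\<dots> = (\<Sum>w\<in>D. if w = 0 then c w else 0)"
    by (rule sum.cong) (simp_all add: e_def integral_monomial)
  also have "\<dots> = c 0"
    using D(1,2) by simp
  also have "translate (- 0) f = f"
    by (rule ell2_eqI) simp
  then have "c 0 = complex_of_real ((norm f)\<^sup>2)"
    by (simp only: c_def cinner_self)
  finally show ?thesis
    using of_real_eq_iff by metis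
qed

section \<open>Zeros of exponential polynomials\<close>

lemma cmod_cis_diff_le: "cmod (cis s - cis s') \<le> \<bar>s - s'\<bar>"
proof -
  have "cis s - cis s' = cis s' * (cis (s - s') - 1)"
    by (simp add: right_diff_distrib cis_mult)
  then have "cmod (cis s - cis s') = cmod (cis (s - s') - 1)"
    by (simp add: norm_mult)
  also have "\<dots> \<le> \<bar>s - s'\<bar>"
    using iexp_approx1[of "s - s'" 0] by (simp add: cis_conv_exp)
  finally show ?thesis .
qed

text \<open>Measured in the angle and through \<open>negligible\<close>, which passes to arbitrary
  subsets and through Lipschitz images.\<close>

definition circle_null :: "complex set \<Rightarrow> bool"
  where "circle_null K \<longleftrightarrow> negligible {s \<in> {0..<2 * pi}. cis s \<in> K}"

text \<open>Near a point where the first-order coefficient does not vanish, the zero set is the graph of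
  a Lipschitz function of the second variable.\<close>

lemma negligible_zero_parameters:
  fixes G G' :: "real \<Rightarrow> complex \<Rightarrow> complex"
  assumes K: "K \<subseteq> sphere 0 1" "circle_null K" and "0 \<le> C1" "0 \<le> C2"
    and taylor: "\<And>t t' \<omega>. \<omega> \<in> sphere 0 1 \<Longrightarrow>
      cmod (G t' \<omega> - G t \<omega> - of_real (t' - t) * G' t \<omega>) \<le> C2 * (t' - t)\<^sup>2"
    and lipschitz: "\<And>t \<omega> \<omega>'. \<omega> \<in> sphere 0 1 \<Longrightarrow> \<omega>' \<in> sphere 0 1 \<Longrightarrow>
      cmod (G t \<omega> - G t \<omega>') \<le> C1 * cmod (\<omega> - \<omega>')"
  shows "negligible {t \<in> {0..1}. \<exists>\<omega>\<in>K. G t \<omega> = 0 \<and> G' t \<omega> \<noteq> 0}"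
proof -
  define L where "L = {s \<in> {0..<2 * pi}. cis s \<in> K}"
  \<comment> \<open>On an interval of this length the quadratic Taylor error is at most half of the
    linear term once \<open>G'\<close> is at least \<open>1 / (real m + 1)\<close>. Adding 1 to
    \<open>C2\<close> keeps the denominator positive.\<close>
  define \<delta> where "\<delta> m = 1 / (2 * (real m + 1) * (C2 + 1))" for m
  \<comment> \<open>Countably many pieces: \<open>m\<close> bounds the derivative from below, and
    \<open>j\<close> confines \<open>t\<close> to a short interval.\<close>
  define P where "P m j s t \<longleftrightarrow> s \<in> L \<and> t \<in> {real j * \<delta> m..(real j + 1) * \<delta> m} \<and>
    G t (cis s) = 0 \<and> 1 / (real m + 1) \<le> cmod (G' t (cis s))" for m j s t
  have \<delta>: "0 < \<delta> m" for m
    using \<open>0 \<le> C2\<close> by (simp add: \<delta>_def)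
  have half: "a * (1 / M) - (1 / (2 * M)) * a = a / (2 * M)" if "0 < M" for a M :: real
    using that by (simp add: field_simps)
  have close: "\<bar>t' - t\<bar> \<le> (2 * (real m + 1) * C1) * \<bar>s' - s\<bar>"
    if "P m j s t" "P m j s' t'" for m j s t s' t'
  proof -
    have "\<bar>t' - t\<bar> \<le> \<delta> m"
      using that unfolding P_def by (auto simp: distrib_right)
    have "\<bar>t' - t\<bar> * (1 / (real m + 1)) \<le> \<bar>t' - t\<bar> * cmod (G' t (cis s))"
      using that unfolding P_def by (intro mult_left_mono) auto
    also have "\<dots> = cmod (of_real (t' - t) * G' t (cis s))"
      by (simp only: norm_mult norm_of_real)
    also have "\<dots> \<le> cmod (G t' (cis s)) + C2 * (t' - t)\<^sup>2"
      using taylor[of "cis s" t' t] that norm_triangle_ineq4[of "G t' (cis s)"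
          "G t' (cis s) - of_real (t' - t) * G' t (cis s)"] unfolding P_def by simp
    \<comment> \<open>\<open>t'\<close> is a zero for the parameter \<open>cis s'\<close>, so this
      value is only the effect of changing the parameter.\<close>
    also have "cmod (G t' (cis s)) \<le> C1 * cmod (cis s - cis s')"
      using lipschitz[of "cis s" "cis s'" t'] that unfolding P_def by simp
    also have "\<dots> \<le> C1 * \<bar>s' - s\<bar>"
      using cmod_cis_diff_le[of s s'] \<open>0 \<le> C1\<close> by (intro mult_left_mono) auto
    also have "C2 * (t' - t)\<^sup>2 \<le> (C2 * \<delta> m) * \<bar>t' - t\<bar>"
    proof -
      have "(t' - t)\<^sup>2 = \<bar>t' - t\<bar> * \<bar>t' - t\<bar>"
        by (simp add: power2_eq_square abs_mult_self_eq)
      also have "\<dots> \<le> \<delta> m * \<bar>t' - t\<bar>"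
        using \<open>\<bar>t' - t\<bar> \<le> \<delta> m\<close> by (intro mult_right_mono) auto
      finally show ?thesis
        using \<open>0 \<le> C2\<close> mult_left_mono[of _ _ C2] by (simp add: mult.assoc)
    qed
    also have "(C2 * \<delta> m) * \<bar>t' - t\<bar> \<le> (1 / (2 * (real m + 1))) * \<bar>t' - t\<bar>"
    proof (rule mult_right_mono)
      have "C2 / (C2 + 1) \<le> 1" using \<open>0 \<le> C2\<close> by simp
      then have "(1 / (2 * (real m + 1))) * (C2 / (C2 + 1)) \<le> (1 / (2 * (real m + 1))) * 1"
        by (intro mult_left_mono) auto
      then show "C2 * \<delta> m \<le> 1 / (2 * (real m + 1))"
        by (simp add: \<delta>_def)
    qed simp
    finally have "\<bar>t' - t\<bar> * (1 / (real m + 1)) - (1 / (2 * (real m + 1))) * \<bar>t' - t\<bar> \<le> C1 * \<bar>s' - s\<bar>"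
      by simp
    moreover have "\<bar>t' - t\<bar> * (1 / (real m + 1)) - (1 / (2 * (real m + 1))) * \<bar>t' - t\<bar> =
        \<bar>t' - t\<bar> / (2 * (real m + 1))"
      by (rule half) simp
    ultimately have "\<bar>t' - t\<bar> / (2 * (real m + 1)) \<le> C1 * \<bar>s' - s\<bar>" by simp
    then show ?thesis
      by (simp add: pos_divide_le_eq mult_ac)
  qed
  have neg: "negligible {t. \<exists>s. P m j s t}" for m j
  proof -
    define S where "S = {s. \<exists>t. P m j s t}"
    define f where "f s = (SOME t. P m j s t)" for s
    have f: "P m j s (f s)" if "s \<in> S" for s
      using that someI_ex[of "P m j s"] unfolding S_def f_def by blast
    have "negligible S"
      by (rule negligible_subset[of L]) (use K(2) in \<open>auto simp: S_def P_def L_def circle_null_def\<close>)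
    then have "negligible (f ` S)"
    proof (rule negligible_locally_Lipschitz_image[rotated])
      fix s assume "s \<in> S"
      then show "\<exists>T C. open T \<and> s \<in> T \<and> (\<forall>s'\<in>S \<inter> T. norm (f s' - f s) \<le> C * norm (s' - s))"
        using close[OF f f] by (intro exI[of _ UNIV] exI[of _ "2 * (real m + 1) * C1"]) auto
    qed simp
    moreover have "{t. \<exists>s. P m j s t} \<subseteq> f ` S"
    proof
      fix t assume "t \<in> {t. \<exists>s. P m j s t}"
      then obtain s where s: "P m j s t" by blast
      then have "s \<in> S" by (auto simp: S_def)
      \<comment> \<open>With equal parameters the Lipschitz estimate shows that \<open>t\<close> is
        unique, so the arbitrary choice \<open>f\<close> misses nothing.\<close>
      have "\<bar>f s - t\<bar> \<le> 0"
        using close[OF s f[OF \<open>s \<in> S\<close>]] by simp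
      then show "t \<in> f ` S" using \<open>s \<in> S\<close> by auto
    qed
    ultimately show ?thesis by (rule negligible_subset)
  qed
  have "negligible (\<Union>m. \<Union>j. {t. \<exists>s. P m j s t})"
    by (intro negligible_Union_nat neg)
  then show ?thesis
  proof (rule negligible_subset, safe)
    fix t \<omega> assume t: "t \<in> {0..1}" and \<omega>: "\<omega> \<in> K" "G t \<omega> = 0" "G' t \<omega> \<noteq> 0"
    obtain m where "inverse (real (Suc m)) < cmod (G' t \<omega>)"
      using reals_Archimedean[of "cmod (G' t \<omega>)"] \<omega>(3) by auto
    then have m: "1 / (real m + 1) \<le> cmod (G' t \<omega>)"
      by (simp add: inverse_eq_divide add.commute)
    obtain s where s: "0 \<le> s" "s < 2 * pi" "\<omega> = cis s"
    proof -
      have "cmod \<omega> = 1" using \<omega>(1) K(1) by auto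
      then obtain s where "0 \<le> s" "s < 2 * pi" "\<omega> = Complex (cos s) (sin s)"
        using complex_unimodular_polar by blast
      with that[of s] show ?thesis by (simp add: cis.code)
    qed
    define j where "j = nat \<lfloor>t / \<delta> m\<rfloor>"
    have "0 \<le> t / \<delta> m" using t \<delta>[of m] by simp
    then have "real j \<le> t / \<delta> m" "t / \<delta> m \<le> real j + 1"
      unfolding j_def by linarith+
    then have "t \<in> {real j * \<delta> m..(real j + 1) * \<delta> m}"
      using \<delta>[of m] by (simp add: field_simps)
    then have "P m j s t"
      using s \<omega> m by (simp add: P_def L_def)
    then show "t \<in> (\<Union>m. \<Union>j. {t. \<exists>s. P m j s t})" by blast
  qed
qed

text \<open>Induction along the Horner scheme. The Lipschitz bound for the next polynomial uses the
  sup bound for the present one, so both are carried together.\<close>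

lemma poly_lipschitz_disc:
  "\<exists>C\<ge>0. \<forall>a b :: complex. cmod a \<le> 1 \<longrightarrow> cmod b \<le> 1 \<longrightarrow>
    cmod (poly p a - poly p b) \<le> C * cmod (a - b) \<and> cmod (poly p a) \<le> C"
proof (induction p)
  case 0
  show ?case by (intro exI[of _ 0]) simp
next
  case (pCons c p)
  then obtain C where C: "0 \<le> C" "\<And>a b. cmod a \<le> 1 \<Longrightarrow> cmod b \<le> 1 \<Longrightarrow>
      cmod (poly p a - poly p b) \<le> C * cmod (a - b) \<and> cmod (poly p a) \<le> C" by blast
  have "cmod (poly (pCons c p) a - poly (pCons c p) b) \<le> (2 * C + cmod c) * cmod (a - b) \<and>
      cmod (poly (pCons c p) a) \<le> 2 * C + cmod c" if "cmod a \<le> 1" "cmod b \<le> 1" for a b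
  proof
    have "poly (pCons c p) a - poly (pCons c p) b = (a - b) * poly p a + b * (poly p a - poly p b)"
      by (simp add: algebra_simps)
    then have "cmod (poly (pCons c p) a - poly (pCons c p) b) \<le>
        cmod (a - b) * cmod (poly p a) + cmod b * cmod (poly p a - poly p b)"
      by (simp add: norm_triangle_le norm_mult)
    also have "\<dots> \<le> cmod (a - b) * C + 1 * (C * cmod (a - b))"
      using C(2)[OF that] that C(1) by (intro add_mono mult_mono) auto
    also have "\<dots> \<le> (2 * C + cmod c) * cmod (a - b)"
      by (simp add: algebra_simps)
    finally show "cmod (poly (pCons c p) a - poly (pCons c p) b) \<le> (2 * C + cmod c) * cmod (a - b)" .
    have "cmod (poly (pCons c p) a) \<le> cmod c + cmod a * cmod (poly p a)"
      by (simp add: norm_triangle_le norm_mult)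
    also have "cmod a * cmod (poly p a) \<le> 1 * C"
      using C(2)[OF that] that by (intro mult_mono) auto
    finally show "cmod (poly (pCons c p) a) \<le> 2 * C + cmod c"
      using C(1) by simp
  qed
  then show ?case
    using C(1) by (intro exI[of _ "2 * C + cmod c"]) auto
qed

text \<open>Closed under differentiation in \<open>t\<close>: the derivative of order k has
  coefficients \<open>a x * (\<i> * \<mu> x) ^ k\<close>. All derivatives below are written in this
  form.\<close>

definition exp_sum :: "'i set \<Rightarrow> ('i \<Rightarrow> complex) \<Rightarrow> ('i \<Rightarrow> real) \<Rightarrow> real \<Rightarrow> complex"
  where "exp_sum X a \<mu> t = (\<Sum>x\<in>X. a x * cis (\<mu> x * t))"

lemma exp_sum_taylor:
  "cmod (exp_sum X a \<mu> t' - exp_sum X a \<mu> t - of_real (t' - t) * exp_sum X (\<lambda>x. a x * (\<i> * \<mu> x)) \<mu> t)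
    \<le> (\<Sum>x\<in>X. cmod (a x) * (\<mu> x)\<^sup>2) * (t' - t)\<^sup>2"
proof -
  have "exp_sum X a \<mu> t' - exp_sum X a \<mu> t - of_real (t' - t) * exp_sum X (\<lambda>x. a x * (\<i> * \<mu> x)) \<mu> t =
      (\<Sum>x\<in>X. a x * cis (\<mu> x * t) * (cis (\<mu> x * (t' - t)) - 1 - \<i> * (\<mu> x * (t' - t))))"
    unfolding exp_sum_def sum_distrib_left sum_subtractf[symmetric]
  proof (rule sum.cong)
    fix x
    have "cis (\<mu> x * t') = cis (\<mu> x * t) * cis (\<mu> x * (t' - t))"
      by (simp add: cis_mult algebra_simps)
    then show "a x * cis (\<mu> x * t') - a x * cis (\<mu> x * t) -
        of_real (t' - t) * (a x * (\<i> * \<mu> x) * cis (\<mu> x * t)) =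
        a x * cis (\<mu> x * t) * (cis (\<mu> x * (t' - t)) - 1 - \<i> * (\<mu> x * (t' - t)))"
      by (simp add: algebra_simps)
  qed simp
  also have "cmod \<dots> \<le> (\<Sum>x\<in>X. cmod (a x) * ((\<mu> x)\<^sup>2 * (t' - t)\<^sup>2))"
  proof (rule sum_norm_le)
    fix x
    have "cmod (cis (\<mu> x * (t' - t)) - 1 - \<i> * (\<mu> x * (t' - t))) \<le> \<bar>\<mu> x * (t' - t)\<bar> ^ 2 / 2"
      using iexp_approx1[of "\<mu> x * (t' - t)" 1]
      by (simp add: cis_conv_exp numeral_2_eq_2 algebra_simps)
    also have "\<dots> \<le> (\<mu> x)\<^sup>2 * (t' - t)\<^sup>2"
      by (simp add: power_mult_distrib)
    finally show "cmod (a x * cis (\<mu> x * t) * (cis (\<mu> x * (t' - t)) - 1 - \<i> * (\<mu> x * (t' - t))))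
        \<le> cmod (a x) * ((\<mu> x)\<^sup>2 * (t' - t)\<^sup>2)"
      by (simp add: norm_mult mult_left_mono)
  qed
  finally show ?thesis
    by (simp add: sum_distrib_right mult.assoc)
qed

text \<open>If all derivatives vanished at \<open>t\<close>, so would every polynomial in d/dt
  applied to the sum. A polynomial with roots at all frequencies except that of \<open>y\<close>
  isolates the term of \<open>y\<close>, which is not zero.\<close>

lemma exp_sum_derivative_nonzero:
  assumes X: "finite X" "inj_on \<mu> X" and y: "y \<in> X" "a y \<noteq> 0"
  shows "\<exists>k. exp_sum X (\<lambda>x. a x * (\<i> * \<mu> x) ^ k) \<mu> t \<noteq> 0"
proof (rule ccontr)
  assume "\<not> ?thesis"
  then have zero: "(\<Sum>x\<in>X. a x * (\<i> * \<mu> x) ^ k * cis (\<mu> x * t)) = 0" for k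
    by (simp add: exp_sum_def)
  have all: "(\<Sum>x\<in>X. a x * poly q (\<i> * \<mu> x) * cis (\<mu> x * t)) = 0" for q
  proof -
    have "(\<Sum>x\<in>X. a x * poly q (\<i> * \<mu> x) * cis (\<mu> x * t)) =
        (\<Sum>x\<in>X. \<Sum>k\<le>degree q. coeff q k * (a x * (\<i> * \<mu> x) ^ k * cis (\<mu> x * t)))"
      by (simp add: poly_altdef sum_distrib_left sum_distrib_right mult_ac)
    also have "\<dots> = (\<Sum>k\<le>degree q. coeff q k * (\<Sum>x\<in>X. a x * (\<i> * \<mu> x) ^ k * cis (\<mu> x * t)))"
      by (subst sum.swap) (simp add: sum_distrib_left)
    finally show ?thesis by (simp add: zero)
  qed
  define q where "q = (\<Prod>x\<in>X - {y}. [:- (\<i> * \<mu> x), 1:])"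
  have "poly q (\<i> * \<mu> x) = 0" if "x \<in> X" "x \<noteq> y" for x
    unfolding q_def poly_prod using X(1) that by (intro prod_zero) auto
  then have "(\<Sum>x\<in>X. a x * poly q (\<i> * \<mu> x) * cis (\<mu> x * t)) =
      (\<Sum>x\<in>{y}. a x * poly q (\<i> * \<mu> x) * cis (\<mu> x * t))"
    using X y by (intro sum.mono_neutral_right) auto
  moreover have "poly q (\<i> * \<mu> y) \<noteq> 0"
    unfolding q_def poly_prod using X y by (auto simp: inj_on_def)
  ultimately show False
    using all[of q] y(2) by simp
qed

lemma negligible_exp_sum_zeros:
  assumes X: "finite X" "inj_on \<mu> X" and K: "K \<subseteq> sphere 0 1" "circle_null K"
    and nz: "\<And>\<omega>. \<omega> \<in> K \<Longrightarrow> \<exists>x\<in>X. c x * poly (p x) \<omega> \<noteq> 0"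
  shows "negligible {t \<in> {0..1}. \<exists>\<omega>\<in>K. exp_sum X (\<lambda>x. c x * poly (p x) \<omega>) \<mu> t = 0}"
proof -
  obtain C where C: "\<And>x. 0 \<le> C x" "\<And>x a b. cmod a \<le> 1 \<Longrightarrow> cmod b \<le> 1 \<Longrightarrow>
      cmod (poly (p x) a - poly (p x) b) \<le> C x * cmod (a - b)"
    "\<And>x a. cmod a \<le> 1 \<Longrightarrow> cmod (poly (p x) a) \<le> C x"
    using poly_lipschitz_disc[of "p _"] by metis
  define g where "g k t \<omega> = exp_sum X (\<lambda>x. c x * poly (p x) \<omega> * (\<i> * \<mu> x) ^ k) \<mu> t" for k t \<omega>
  have neg: "negligible {t \<in> {0..1}. \<exists>\<omega>\<in>K. g k t \<omega> = 0 \<and> g (Suc k) t \<omega> \<noteq> 0}" for k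
  proof (rule negligible_zero_parameters[OF K])
    let ?C1 = "\<Sum>x\<in>X. cmod (c x) * \<bar>\<mu> x\<bar> ^ k * C x"
    let ?C2 = "\<Sum>x\<in>X. cmod (c x) * \<bar>\<mu> x\<bar> ^ k * C x * (\<mu> x)\<^sup>2"
    show "0 \<le> ?C1" "0 \<le> ?C2"
      by (intro sum_nonneg mult_nonneg_nonneg C(1); simp)+
    fix t t' :: real and \<omega> \<omega>' :: complex
    assume \<omega>: "\<omega> \<in> sphere 0 1"
    have "cmod (g k t' \<omega> - g k t \<omega> - of_real (t' - t) * g (Suc k) t \<omega>) \<le>
        (\<Sum>x\<in>X. cmod (c x * poly (p x) \<omega> * (\<i> * \<mu> x) ^ k) * (\<mu> x)\<^sup>2) * (t' - t)\<^sup>2"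
      using exp_sum_taylor[of X "\<lambda>x. c x * poly (p x) \<omega> * (\<i> * \<mu> x) ^ k" \<mu> t' t]
      by (simp add: g_def mult_ac)
    also have "\<dots> \<le> ?C2 * (t' - t)\<^sup>2"
    proof (intro mult_right_mono sum_mono)
      fix x
      have "cmod (c x * poly (p x) \<omega> * (\<i> * \<mu> x) ^ k) = cmod (c x) * \<bar>\<mu> x\<bar> ^ k * cmod (poly (p x) \<omega>)"
        by (simp add: norm_mult norm_power)
      also have "\<dots> \<le> cmod (c x) * \<bar>\<mu> x\<bar> ^ k * C x"
        using C(3)[of \<omega>] \<omega> by (intro mult_left_mono) auto
      finally show "cmod (c x * poly (p x) \<omega> * (\<i> * \<mu> x) ^ k) \<le> cmod (c x) * \<bar>\<mu> x\<bar> ^ k * C x" .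
    qed simp_all
    finally show "cmod (g k t' \<omega> - g k t \<omega> - of_real (t' - t) * g (Suc k) t \<omega>) \<le> ?C2 * (t' - t)\<^sup>2" .
    assume \<omega>': "\<omega>' \<in> sphere 0 1"
    have "g k t \<omega> - g k t \<omega>' =
        (\<Sum>x\<in>X. c x * (\<i> * \<mu> x) ^ k * cis (\<mu> x * t) * (poly (p x) \<omega> - poly (p x) \<omega>'))"
      by (simp add: g_def exp_sum_def right_diff_distrib sum_subtractf mult_ac)
    also have "cmod \<dots> \<le> (\<Sum>x\<in>X. cmod (c x) * \<bar>\<mu> x\<bar> ^ k * C x * cmod (\<omega> - \<omega>'))"
    proof (rule sum_norm_le)
      fix x
      have "cmod (c x * (\<i> * \<mu> x) ^ k * cis (\<mu> x * t) * (poly (p x) \<omega> - poly (p x) \<omega>')) =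
          cmod (c x) * \<bar>\<mu> x\<bar> ^ k * cmod (poly (p x) \<omega> - poly (p x) \<omega>')"
        by (simp add: norm_mult norm_power)
      also have "\<dots> \<le> cmod (c x) * \<bar>\<mu> x\<bar> ^ k * (C x * cmod (\<omega> - \<omega>'))"
        using C(2)[of \<omega> \<omega>'] \<omega> \<omega>' by (intro mult_left_mono) auto
      finally show "cmod (c x * (\<i> * \<mu> x) ^ k * cis (\<mu> x * t) * (poly (p x) \<omega> - poly (p x) \<omega>')) \<le>
          cmod (c x) * \<bar>\<mu> x\<bar> ^ k * C x * cmod (\<omega> - \<omega>')" by (simp add: mult.assoc)
    qed
    finally show "cmod (g k t \<omega> - g k t \<omega>') \<le> ?C1 * cmod (\<omega> - \<omega>')"
      by (simp add: sum_distrib_right)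
  qed
  have "negligible (\<Union>k. {t \<in> {0..1}. \<exists>\<omega>\<in>K. g k t \<omega> = 0 \<and> g (Suc k) t \<omega> \<noteq> 0})"
    by (rule negligible_Union_nat) (rule neg)
  then show ?thesis
  proof (rule negligible_subset, safe)
    fix t \<omega> assume t: "t \<in> {0..1}" and \<omega>: "\<omega> \<in> K" "exp_sum X (\<lambda>x. c x * poly (p x) \<omega>) \<mu> t = 0"
    then have "g 0 t \<omega> = 0" by (simp add: g_def)
    obtain k where "g k t \<omega> \<noteq> 0"
      using exp_sum_derivative_nonzero[OF X, of _ "\<lambda>x. c x * poly (p x) \<omega>" t] nz[OF \<omega>(1)]
      unfolding g_def by blast
    \<comment> \<open>The least order of a nonvanishing derivative is positive, and the derivative
      one order lower has a simple zero at \<open>t\<close>.\<close>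
    then obtain k where "g k t \<omega> \<noteq> 0" "\<And>i. i < k \<Longrightarrow> g i t \<omega> = 0"
      using exists_least_iff[of "\<lambda>k. g k t \<omega> \<noteq> 0"] by blast
    then obtain k' where "g k' t \<omega> = 0" "g (Suc k') t \<omega> \<noteq> 0"
      using \<open>g 0 t \<omega> = 0\<close> by (cases k) auto
    then show "t \<in> (\<Union>k. {t \<in> {0..1}. \<exists>\<omega>\<in>K. g k t \<omega> = 0 \<and> g (Suc k) t \<omega> \<noteq> 0})"
      using t \<omega>(1) by blast
  qed
qed

section \<open>Dominated convergence for polynomials of the walk\<close>

text \<open>Directions are sought on the moment curve, with coordinates \<open>t ^ e j\<close> for
  distinct exponents. Two points of \<open>X\<close> get equal products only if \<open>t\<close> is
  a root of the nonzero polynomial \<open>q x y\<close>, which excludes finitely many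
  integers.\<close>

lemma int_dot_inj_on:
  fixes X :: "(int ^ 'd) set"
  assumes "finite X"
  shows "\<exists>n. inj_on (int_dot n) X"
proof -
  obtain e :: "'d \<Rightarrow> nat" where e: "inj e"
    using finite_imp_inj_to_nat_seg[of "UNIV :: 'd set"] by auto
  define q where "q x y = (\<Sum>j\<in>UNIV. monom (vec_nth x j - vec_nth y j) (e j))" for x y :: "int ^ 'd"
  have q: "q x y \<noteq> 0" if neq: "x \<noteq> y" for x y
  proof -
    obtain j where j: "vec_nth x j \<noteq> vec_nth y j"
      using neq Finite_Cartesian_Product.vec_eq_iff[of x y] by blast
    have "coeff (q x y) (e j) = (\<Sum>i\<in>UNIV. if i = j then vec_nth x i - vec_nth y i else 0)"
      unfolding q_def coeff_sum coeff_monom by (rule sum.cong) (use e in \<open>auto simp: inj_def\<close>)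
    then have "coeff (q x y) (e j) \<noteq> 0" using j by simp
    then show ?thesis by auto
  qed
  have "finite (\<Union>x\<in>X. \<Union>y\<in>X - {x}. {t. poly (q x y) t = 0})"
    using assms q by (intro finite_UN_I finite_Diff poly_roots_finite) auto
  then obtain t where t: "t \<notin> (\<Union>x\<in>X. \<Union>y\<in>X - {x}. {t. poly (q x y) t = 0})"
    using ex_new_if_finite[OF infinite_UNIV_int] by blast
  have "poly (q x y) t = int_dot (\<chi> j. t ^ e j) x - int_dot (\<chi> j. t ^ e j) y" for x y
    by (simp add: q_def poly_sum poly_monom int_dot_def algebra_simps sum_subtractf)
  with t have "inj_on (int_dot (\<chi> j. t ^ e j)) X"
    by (auto simp: inj_on_def)
  then show ?thesis ..
qed

lemma AE_unit_interval_negligible: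
  assumes "negligible N"
  shows "AE t in unit_interval. t \<notin> N"
proof -
  have "AE t in lebesgue. t \<notin> N"
    using assms by (intro AE_not_in) (simp add: negligible_iff_null_sets)
  then show ?thesis
    unfolding unit_interval_def by (subst AE_restrict_space_iff) (auto simp: AE_completion_iff)
qed

context periodic_walk
begin

text \<open>The direction depends only on the exponents, hence serves all base points. The phases
  \<open>c x\<close> never vanish, so all coefficients of the restricted determinant vanish at
  \<omega> only if \<omega> is an eigenvalue at every point of the torus.\<close>

lemma negligible_eigenvalue_in:
  assumes K: "K \<subseteq> sphere 0 1" "circle_null K"
    and nz: "\<And>\<omega>. \<omega> \<in> K \<Longrightarrow> \<exists>z\<in>torus. \<not> is_eigenvalue (symbol z) \<omega>"
  shows "\<exists>n. \<forall>\<zeta>. negligible {t \<in> {0..1}. \<exists>\<omega>\<in>K. is_eigenvalue (symbol (torus_point n \<zeta> t)) \<omega>}"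
proof -
  obtain X p where X: "finite X" and ev: "\<And>z \<omega>. z \<in> torus \<Longrightarrow>
      is_eigenvalue (symbol z) \<omega> \<longleftrightarrow> (\<Sum>x\<in>X. poly (p x) \<omega> * monomial z x) = 0"
    using eigenvalue_laurent by blast
  obtain n where n: "inj_on (int_dot n) X"
    using int_dot_inj_on[OF X] by blast
  have "negligible {t \<in> {0..1}. \<exists>\<omega>\<in>K. is_eigenvalue (symbol (torus_point n \<zeta> t)) \<omega>}" for \<zeta>
  proof -
    define c where "c x = (\<Prod>j\<in>UNIV. cis (2 * pi * of_int (vec_nth x j) * \<zeta> j))" for x :: "int ^ 'd"
    define \<mu> where "\<mu> x = 2 * pi * of_int (int_dot n x)" for x :: "int ^ 'd"
    have c: "c x \<noteq> 0" for x by (simp add: c_def)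
    have \<mu>: "inj_on \<mu> X" using n by (simp add: \<mu>_def inj_on_def)
    have "\<exists>x\<in>X. c x * poly (p x) \<omega> \<noteq> 0" if \<omega>: "\<omega> \<in> K" for \<omega>
    proof (rule ccontr)
      assume "\<not> ?thesis"
      then have "poly (p x) \<omega> = 0" if "x \<in> X" for x using c that by auto
      then have "is_eigenvalue (symbol z) \<omega>" if "z \<in> torus" for z
        by (simp add: ev[OF that])
      then show False using nz[OF \<omega>] by blast
    qed
    then have "negligible {t \<in> {0..1}. \<exists>\<omega>\<in>K. exp_sum X (\<lambda>x. c x * poly (p x) \<omega>) \<mu> t = 0}"
      by (rule negligible_exp_sum_zeros[OF X \<mu> K])
    moreover have "is_eigenvalue (symbol (torus_point n \<zeta> t)) \<omega> \<longleftrightarrow>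
        exp_sum X (\<lambda>x. c x * poly (p x) \<omega>) \<mu> t = 0" for t \<omega>
      unfolding ev[OF torus_point_in_torus] exp_sum_def monomial_torus_point c_def \<mu>_def
      by (simp only: mult_ac)
    ultimately show ?thesis by simp
  qed
  then show ?thesis by blast
qed

lemma symbol_opoly_bound:
  assumes "z \<in> torus" "\<And>\<omega>. cmod \<omega> = 1 \<Longrightarrow> cmod (poly r \<omega>) \<le> C"
  shows "norm (opoly (symbol z) r \<phi>) \<le> C * norm \<phi>"
  by (rule opoly_norm_le[OF orthonormal_basis_finite[OF basis] orthonormal_basis_span[OF basis]
      symbol_lin symbol_iso[OF assms(1)] assms(2)])

text \<open>The exceptional points are known to form a null set on each line, so dominated
  convergence is applied twice, first in \<open>t\<close> and then in \<zeta>. Measurability of the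
  exceptional set in the torus does not arise.\<close>

lemma opoly_U_tendsto_0:
  assumes K: "K \<subseteq> sphere 0 1" "circle_null K"
    and nz: "\<And>\<omega>. \<omega> \<in> K \<Longrightarrow> \<exists>z\<in>torus. \<not> is_eigenvalue (symbol z) \<omega>"
    and bound: "\<And>j \<omega>. cmod \<omega> = 1 \<Longrightarrow> cmod (poly (r j) \<omega>) \<le> C"
    and lim: "\<And>\<omega>. cmod \<omega> = 1 \<Longrightarrow> \<omega> \<notin> K \<Longrightarrow> (\<lambda>j. poly (r j) \<omega>) \<longlonglongrightarrow> 0"
    and f: "fin_supp f"
  shows "(\<lambda>j. norm (opoly U (r j) f)) \<longlonglongrightarrow> 0"
proof -
  interpret I: prob_space unit_interval by (rule prob_space_unit_interval)
  interpret Q: prob_space "unit_cube :: ('d \<Rightarrow> real) measure" by (rule prob_space_unit_cube)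
  obtain n where n: "\<And>\<zeta>. negligible {t \<in> {0..1}. \<exists>\<omega>\<in>K. is_eigenvalue (symbol (torus_point n \<zeta> t)) \<omega>}"
    using negligible_eigenvalue_in[OF K nz] by blast
  define h where "h j \<zeta> t = (norm (fhat (opoly U (r j) f) (torus_point n \<zeta> t)))\<^sup>2" for j \<zeta> t
  define R where "R = C * (\<Sum>x | ell2_apply f x \<noteq> 0. norm (ell2_apply f x))"
  have C: "0 \<le> C" using order_trans[OF norm_ge_zero bound[of 1]] by simp
  have h_eq: "h j \<zeta> t = (norm (opoly (symbol (torus_point n \<zeta> t)) (r j) (fhat f (torus_point n \<zeta> t))))\<^sup>2"
    for j \<zeta> t
    by (simp add: h_def fhat_opoly torus_point_in_torus f)
  have h_bound: "norm (h j \<zeta> t) \<le> R\<^sup>2" for j \<zeta> t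
  proof -
    have "norm (opoly (symbol (torus_point n \<zeta> t)) (r j) (fhat f (torus_point n \<zeta> t))) \<le>
        C * norm (fhat f (torus_point n \<zeta> t))"
      by (rule symbol_opoly_bound[OF torus_point_in_torus bound])
    also have "\<dots> \<le> R"
      unfolding R_def by (intro mult_left_mono norm_fhat_le torus_point_in_torus C)
    finally show ?thesis
      unfolding h_eq by (simp add: power_mono)
  qed
  have meas: "(\<lambda>(\<zeta>, t). h j \<zeta> t) \<in> borel_measurable (unit_cube \<Otimes>\<^sub>M unit_interval)" for j
    unfolding h_def by (rule measurable_norm_fhat[OF fin_supp_opoly[OF f]])
  have meas_t: "h j \<zeta> \<in> borel_measurable unit_interval" if "\<zeta> \<in> space unit_cube" for j \<zeta>
    using measurable_compose_Pair1[OF that meas] by simp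
  have inner: "(\<lambda>j. LINT t|unit_interval. h j \<zeta> t) \<longlonglongrightarrow> 0" if \<zeta>: "\<zeta> \<in> space unit_cube" for \<zeta>
  proof -
    have "AE t in unit_interval. (\<lambda>j. h j \<zeta> t) \<longlonglongrightarrow> 0"
      using AE_unit_interval_negligible[OF n[of \<zeta>]] AE_space
    proof eventually_elim
      case (elim t)
      have "(\<lambda>j. norm (opoly (symbol (torus_point n \<zeta> t)) (r j) (fhat f (torus_point n \<zeta> t)))) \<longlonglongrightarrow> 0"
      proof (rule opoly_tendsto_0[OF orthonormal_basis_finite[OF basis]
            orthonormal_basis_span[OF basis] symbol_lin symbol_iso[OF torus_point_in_torus]])
        fix \<eta> assume \<eta>: "is_eigenvalue (symbol (torus_point n \<zeta> t)) \<eta>"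
        then have "cmod \<eta> = 1"
          unfolding is_eigenvalue_def
          using isometry_eigenvalue_norm[OF symbol_iso[OF torus_point_in_torus]] by blast
        moreover have "\<eta> \<notin> K"
          using elim \<eta> by (auto simp: unit_interval_def space_restrict_space)
        ultimately show "(\<lambda>j. poly (r j) \<eta>) \<longlonglongrightarrow> 0"
          by (rule lim)
      qed
      then show ?case
        unfolding h_eq using tendsto_power[of _ 0 _ 2] by fastforce
    qed
    then have "(\<lambda>j. LINT t|unit_interval. h j \<zeta> t) \<longlonglongrightarrow> (LINT t|unit_interval. 0)"
      by (intro integral_dominated_convergence[where w = "\<lambda>_. R\<^sup>2"])
        (use h_bound in \<open>auto simp: meas_t[OF \<zeta>]\<close>)
    then show ?thesis by simp
  qed
  have "(\<lambda>j. LINT \<zeta>|unit_cube. LINT t|unit_interval. h j \<zeta> t) \<longlonglongrightarrow> (LINT \<zeta>|(unit_cube :: ('d \<Rightarrow> real) measure). 0)"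
  proof (rule integral_dominated_convergence[where w = "\<lambda>_. R\<^sup>2"])
    show "(\<lambda>\<zeta>. LINT t|unit_interval. h j \<zeta> t) \<in> borel_measurable unit_cube" for j
      by (rule I.borel_measurable_lebesgue_integral) (rule meas)
    show "AE \<zeta> in unit_cube. norm (LINT t|unit_interval. h j \<zeta> t) \<le> R\<^sup>2" for j
    proof (rule AE_I2)
      fix \<zeta> :: "'d \<Rightarrow> real" assume \<zeta>: "\<zeta> \<in> space unit_cube"
      note [measurable] = meas_t[OF \<zeta>, of j]
      have "norm (LINT t|unit_interval. h j \<zeta> t) \<le> (LINT t|unit_interval. norm (h j \<zeta> t))"
        by (rule integral_norm_bound)
      also have "\<dots> \<le> R\<^sup>2"
        by (rule I.integral_le_const) (use h_bound in \<open>auto intro!: I.integrable_const_bound[where B = "R\<^sup>2"] simp: meas_t[OF \<zeta>]\<close>)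
      finally show "norm (LINT t|unit_interval. h j \<zeta> t) \<le> R\<^sup>2" .
    qed
  qed (use inner in auto)
  then have "(\<lambda>j. (norm (opoly U (r j) f))\<^sup>2) \<longlonglongrightarrow> 0"
    by (simp add: h_def flip: parseval[OF fin_supp_opoly[OF f]])
  then have "(\<lambda>j. sqrt ((norm (opoly U (r j) f))\<^sup>2)) \<longlonglongrightarrow> sqrt 0"
    by (rule tendsto_real_sqrt)
  then show ?thesis by simp
qed

end

section \<open>Spectral measures on the circle\<close>

lemma sets_circle_borel: "A \<in> sets circle_borel \<longleftrightarrow> A \<in> sets borel \<and> A \<subseteq> sphere 0 1"
  unfolding circle_borel_def by (auto simp: sets_restrict_space_iff)

lemma sets_circle_borel_subset: "sets circle_borel \<subseteq> Pow (sphere 0 1)"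
  using sets_circle_borel by blast

lemma space_circle_borel: "space circle_borel = sphere 0 1"
  by (simp add: circle_borel_def space_restrict_space)

text \<open>Polarisation against the multiple \<open>v\<close> of \<open>D u\<close> that has the
  norm of \<open>u\<close>. The parallelogram law bounds the four terms by
  \<open>8 * e * (norm u)\<^sup>2\<close>, and the polarisation factor 4 leaves the constant
  2.\<close>

lemma quadratic_form_norm_le:
  fixes D :: "'a::complex_inner \<Rightarrow> 'a"
  assumes lin: "clinear D" and "0 \<le> e"
    and D: "\<And>u. cmod (cinner (D u) u) \<le> e * (norm u)\<^sup>2"
  shows "norm (D u) \<le> 2 * e * norm u"
proof (cases "u = 0 \<or> D u = 0")
  case False
  define v where "v = complex_of_real (norm u / norm (D u)) *\<^sub>C D u"
  have v: "norm v = norm u" "cinner (D u) v = complex_of_real (norm u * norm (D u))"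
    using False by (simp_all add: v_def norm_scaleC norm_divide cinner_scaleC_right cinner_self
        power2_eq_square)
  have "4 * cinner (D u) v = cinner (D (u + v)) (u + v) - cinner (D (u - v)) (u - v) +
      (\<i> * cinner (D (u + \<i> *\<^sub>C v)) (u + \<i> *\<^sub>C v) - \<i> * cinner (D (u - \<i> *\<^sub>C v)) (u - \<i> *\<^sub>C v))"
    by (simp add: clinear_add[OF lin] clinear_diff[OF lin] clinear_scale[OF lin] cinner_add_left
        cinner_add_right cinner_diff_left cinner_diff_right cinner_scaleC_left cinner_scaleC_right
        algebra_simps)
  also have "cmod \<dots> \<le> cmod (cinner (D (u + v)) (u + v)) + cmod (cinner (D (u - v)) (u - v)) +
      (cmod (cinner (D (u + \<i> *\<^sub>C v)) (u + \<i> *\<^sub>C v)) + cmod (cinner (D (u - \<i> *\<^sub>C v)) (u - \<i> *\<^sub>C v)))"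
    by (intro norm_triangle_le add_mono norm_triangle_le_diff) (simp_all add: norm_mult)
  also have "\<dots> \<le> e * (norm (u + v))\<^sup>2 + e * (norm (u - v))\<^sup>2 +
      (e * (norm (u + \<i> *\<^sub>C v))\<^sup>2 + e * (norm (u - \<i> *\<^sub>C v))\<^sup>2)"
    by (intro add_mono D)
  also have "\<dots> = e * (4 * (norm u)\<^sup>2 + 4 * (norm v)\<^sup>2)"
  proof -
    have par: "(norm (u + w))\<^sup>2 + (norm (u - w))\<^sup>2 = 2 * (norm u)\<^sup>2 + 2 * (norm w)\<^sup>2" for w
      by (simp add: power2_norm_eq_inner inner_add_left inner_add_right inner_diff_left
          inner_diff_right)
    have "e * (norm (u + v))\<^sup>2 + e * (norm (u - v))\<^sup>2 +
        (e * (norm (u + \<i> *\<^sub>C v))\<^sup>2 + e * (norm (u - \<i> *\<^sub>C v))\<^sup>2) =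
        e * (((norm (u + v))\<^sup>2 + (norm (u - v))\<^sup>2) +
          ((norm (u + \<i> *\<^sub>C v))\<^sup>2 + (norm (u - \<i> *\<^sub>C v))\<^sup>2))"
      by (simp only: distrib_left)
    then show ?thesis
      unfolding par by (simp add: norm_scaleC)
  qed
  finally have "4 * (norm u * norm (D u)) \<le> 8 * e * (norm u)\<^sup>2"
    by (simp add: v norm_mult)
  then have "norm u * norm (D u) \<le> norm u * (2 * e * norm u)"
    by (simp add: power2_eq_square mult_ac)
  then show ?thesis
    using False by simp
qed (use assms clinear_zero[OF lin] in auto)

lemma opoly_norm_le_coeffs:
  assumes "\<And>u. norm (V u) \<le> norm u"
  shows "norm (opoly V r u) \<le> (\<Sum>i\<le>degree r. cmod (coeff r i)) * norm u"
proof -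
  have "norm ((V ^^ i) u) \<le> norm u" for i
    by (induction i) (auto intro: order_trans[OF assms])
  then show ?thesis
    unfolding opoly_def sum_distrib_right
    by (intro sum_norm_le) (simp add: norm_scaleC mult_left_mono)
qed

text \<open>The order of the quantifiers is the point: \<open>C\<close> is fixed before
  \<open>V\<close> and \<open>e\<close>, so \<open>V\<close> may approach \<open>U\<close> while
  \<open>r\<close> is kept.\<close>

lemma opoly_perturbation:
  fixes U :: "'a::complex_inner \<Rightarrow> 'a"
  assumes U: "\<And>u. norm (U u) \<le> norm u"
  shows "\<exists>C\<ge>0. \<forall>V e. clinear V \<longrightarrow> (\<forall>u. norm (V u) \<le> norm u) \<longrightarrow>
    0 \<le> e \<longrightarrow> (\<forall>u. norm (U u - V u) \<le> e * norm u) \<longrightarrow>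
    (\<forall>u. norm (opoly U r u - opoly V r u) \<le> C * e * norm u)"
proof (induction r)
  case 0
  show ?case by (intro exI[of _ 0]) simp
next
  case (pCons c r)
  then obtain C where C: "0 \<le> C" "\<And>V e u. clinear V \<Longrightarrow> (\<And>u. norm (V u) \<le> norm u) \<Longrightarrow> 0 \<le> e \<Longrightarrow>
      (\<And>u. norm (U u - V u) \<le> e * norm u) \<Longrightarrow> norm (opoly U r u - opoly V r u) \<le> C * e * norm u"
    by blast
  define S where "S = (\<Sum>i\<le>degree r. cmod (coeff r i))"
  have S: "0 \<le> S" by (simp add: S_def sum_nonneg)
  have "norm (opoly U (pCons c r) u - opoly V (pCons c r) u) \<le> (C + S) * e * norm u"
    if V: "clinear V" "\<And>u. norm (V u) \<le> norm u" and e: "0 \<le> e"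
      "\<And>u. norm (U u - V u) \<le> e * norm u" for V e u
  proof -
    \<comment> \<open>Telescoping: one factor \<open>U\<close> is exchanged for \<open>V\<close> at
      a time.\<close>
    have "opoly U (pCons c r) u - opoly V (pCons c r) u =
        (opoly U r (U u) - opoly V r (U u)) + opoly V r (U u - V u)"
      by (simp add: opoly_pCons clinear_diff[OF clinear_opoly[OF V(1)]])
    then have "norm (opoly U (pCons c r) u - opoly V (pCons c r) u) \<le>
        norm (opoly U r (U u) - opoly V r (U u)) + norm (opoly V r (U u - V u))"
      by (simp add: norm_triangle_ineq)
    also have "norm (opoly U r (U u) - opoly V r (U u)) \<le> C * e * norm (U u)"
      by (intro C(2) V e)
    also have "\<dots> \<le> C * e * norm u"
      using C(1) e(1) U by (intro mult_left_mono) auto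
    also have "norm (opoly V r (U u - V u)) \<le> S * norm (U u - V u)"
      unfolding S_def by (rule opoly_norm_le_coeffs) (rule V)
    also have "\<dots> \<le> S * (e * norm u)"
      by (intro mult_left_mono e S)
    finally show ?thesis
      by (simp add: algebra_simps)
  qed
  then show ?case
    using C(1) S by (intro exI[of _ "C + S"]) auto
qed

locale circle_spectral_measure =
  fixes U :: "'h::complex_inner \<Rightarrow> 'h" and E :: "complex set \<Rightarrow> 'h \<Rightarrow> 'h"
  assumes U_lin: "clinear U" and U_iso: "\<And>u v. cinner (U u) (U v) = cinner u v"
    and spectral: "is_spectral_measure U E"
begin

lemma pvm: "projection_valued_measure E"
  using spectral by (simp add: is_spectral_measure_def)

lemma E_lin: "A \<in> sets circle_borel \<Longrightarrow> clinear (E A)"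
  using pvm by (simp add: projection_valued_measure_def)

lemma E_sym: "A \<in> sets circle_borel \<Longrightarrow> cinner (E A u) v = cinner u (E A v)"
  using pvm by (simp add: projection_valued_measure_def)

lemma E_sphere: "E (sphere 0 1) u = u"
  using pvm by (simp add: projection_valued_measure_def)

lemma E_Int: "A \<in> sets circle_borel \<Longrightarrow> A' \<in> sets circle_borel \<Longrightarrow> E A (E A' u) = E (A \<inter> A') u"
  using pvm by (simp add: projection_valued_measure_def)

lemma E_sums: "range A \<subseteq> sets circle_borel \<Longrightarrow> disjoint_family A \<Longrightarrow>
    (\<lambda>n. E (A n) u) sums E (\<Union>n :: nat. A n) u"
  using pvm by (simp add: projection_valued_measure_def)

lemma E_empty [simp]: "E {} u = 0"
proof -
  have "(\<lambda>n :: nat. E {} u) sums E {} u"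
    using E_sums[of "\<lambda>_. {}" u] by (simp add: disjoint_family_on_def)
  then have "(\<lambda>n :: nat. E {} u) \<longlonglongrightarrow> 0"
    by (intro summable_LIMSEQ_zero) (rule sums_summable)
  then show ?thesis
    by (simp add: LIMSEQ_const_iff)
qed

lemma E_Un:
  assumes A: "A \<in> sets circle_borel" "A' \<in> sets circle_borel" "A \<inter> A' = {}"
  shows "E (A \<union> A') u = E A u + E A' u"
proof -
  have "(\<lambda>n. E (binaryset A A' n) u) sums E (\<Union>n. binaryset A A' n) u"
    using A by (intro E_sums) (auto simp: binaryset_def disjoint_family_on_def)
  moreover have "(\<lambda>n. E (binaryset A A' n) u) sums (E A u + E A' u)"
    using binaryset_sums[of "\<lambda>A. E A u" A A'] by simp
  ultimately show ?thesis
    by (simp add: UN_binaryset_eq sums_unique2)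
qed

lemma E_UN:
  assumes "finite I" "\<And>i. i \<in> I \<Longrightarrow> A i \<in> sets circle_borel" "disjoint_family_on A I"
  shows "E (\<Union>i\<in>I. A i) u = (\<Sum>i\<in>I. E (A i) u)"
  using assms
proof (induction I)
  case (insert i I)
  have "A i \<inter> (\<Union>i\<in>I. A i) = {}"
    using insert by (auto simp: disjoint_family_on_def)
  moreover have "(\<Union>i\<in>I. A i) \<in> sets circle_borel"
    using insert by (intro sets.finite_UN) auto
  moreover have "disjoint_family_on A I"
    using insert.prems by (auto simp: disjoint_family_on_def)
  ultimately show ?case
    using insert by (simp add: E_Un)
qed simp

lemma E_norm_sq: "A \<in> sets circle_borel \<Longrightarrow> (norm (E A u))\<^sup>2 = inner (E A u) u"
  using E_sym[of A "E A u" u] E_Int[of A A u]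
  by (simp add: norm_sq_eq_cinner inner_eq_Re_cinner)

abbreviation \<mu> :: "'h \<Rightarrow> complex measure"
  where "\<mu> \<equiv> spectral_distribution E"

lemma sets_\<mu>: "sets (\<mu> u) = sets circle_borel"
proof -
  have "sets (\<mu> u) = sigma_sets (sphere 0 1) (sets circle_borel)"
    by (simp add: spectral_distribution_def sets_circle_borel_subset)
  also have "\<dots> = sets circle_borel"
    using sets.sigma_sets_eq[of circle_borel] by (simp add: space_circle_borel)
  finally show ?thesis .
qed

lemma space_\<mu>: "space (\<mu> u) = sphere 0 1"
  using sets_eq_imp_space_eq[OF sets_\<mu>] by (simp add: space_circle_borel)

lemma emeasure_\<mu>:
  assumes A: "A \<in> sets circle_borel"
  shows "emeasure (\<mu> u) A = ennreal ((norm (E A u))\<^sup>2)"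
proof (rule emeasure_measure_of)
  show "\<mu> u = measure_of (sphere 0 1) (sets circle_borel) (\<lambda>A. ennreal ((norm (E A u))\<^sup>2))"
    by (rule spectral_distribution_def)
  show "sets circle_borel \<subseteq> Pow (sphere 0 1)"
    by (rule sets_circle_borel_subset)
  show "A \<in> sets (\<mu> u)"
    using A by (simp add: sets_\<mu>)
  show "positive (sets (\<mu> u)) (\<lambda>A. ennreal ((norm (E A u))\<^sup>2))"
    by (simp add: positive_def)
  show "countably_additive (sets (\<mu> u)) (\<lambda>A. ennreal ((norm (E A u))\<^sup>2))"
    unfolding countably_additive_def sets_\<mu>
  proof (intro allI impI)
    fix A :: "nat \<Rightarrow> complex set"
    assume A: "range A \<subseteq> sets circle_borel" "disjoint_family A" "\<Union> (range A) \<in> sets circle_borel"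
    \<comment> \<open>Additivity is read off from the form in which \<open>E (A n) u\<close> enters
      linearly, and then returned to squared norms by \<open>E_norm_sq\<close>.\<close>
    have "(\<lambda>n. inner (E (A n) u) u) sums inner (E (\<Union> (range A)) u) u"
      by (rule bounded_linear.sums[OF bounded_linear_inner_left E_sums[OF A(1,2)]])
    then have "(\<lambda>n. (norm (E (A n) u))\<^sup>2) sums (norm (E (\<Union> (range A)) u))\<^sup>2"
      using A by (simp add: E_norm_sq range_subsetD)
    then show "(\<Sum>i. ennreal ((norm (E (A i) u))\<^sup>2)) = ennreal ((norm (E (\<Union> (range A)) u))\<^sup>2)"
      by (intro suminf_ennreal_eq) simp_all
  qed
qed

lemma measure_\<mu>: "A \<in> sets circle_borel \<Longrightarrow> measure (\<mu> u) A = (norm (E A u))\<^sup>2"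
  by (simp add: measure_def emeasure_\<mu>)

lemma sphere_sets [simp]: "sphere 0 1 \<in> sets circle_borel"
  using sets.top[of circle_borel] by (simp add: space_circle_borel)

lemma finite_measure_\<mu>: "finite_measure (\<mu> u)"
  by (rule finite_measureI) (simp add: space_\<mu> emeasure_\<mu>)

lemma measurable_\<mu>: "f \<in> borel_measurable borel \<Longrightarrow> f \<in> borel_measurable (\<mu> u)"
  unfolding measurable_cong_sets[OF sets_\<mu> refl] circle_borel_def
  by (rule measurable_restrict_space1)

lemma cinner_U: "cinner (U u) u = (LINT l|\<mu> u. l)"
  using spectral by (simp add: is_spectral_measure_def)

lemma integrable_id: "integrable (\<mu> u) (\<lambda>l. l)"
proof -
  interpret finite_measure "\<mu> u" by (rule finite_measure_\<mu>)
  show ?thesis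
    by (rule integrable_const_bound[where B = 1]) (auto intro!: AE_I2 measurable_\<mu> simp: space_\<mu>)
qed

lemma singleton_sets [simp]: "\<omega> \<in> sphere 0 1 \<Longrightarrow> {\<omega>} \<in> sets circle_borel"
  by (simp add: sets_circle_borel)

text \<open>The measure of \<open>v = E {\<omega>} u\<close> is concentrated at \<omega>, so the
  pairing of \<open>U v\<close> with \<open>v\<close> is \<omega> times the squared norm of
  \<open>v\<close>. As \<open>U\<close> preserves norms, this is equality in Cauchy-Schwarz.\<close>

lemma U_E_singleton:
  assumes \<omega>: "\<omega> \<in> sphere 0 1"
  shows "U (E {\<omega>} u) = \<omega> *\<^sub>C E {\<omega>} u"
proof -
  define v where "v = E {\<omega>} u"
  have sets: "sphere 0 1 - {\<omega>} \<in> sets circle_borel"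
    using \<omega> by (intro sets.Diff) auto
  have "emeasure (\<mu> v) (sphere 0 1 - {\<omega>}) = 0"
    using \<omega> sets by (simp add: emeasure_\<mu> v_def E_Int)
  then have "AE l in \<mu> v. l \<notin> sphere 0 1 - {\<omega>}"
    using sets by (intro AE_not_in) (simp add: null_sets_def sets_\<mu>)
  then have "AE l in \<mu> v. l = \<omega>"
    using AE_space by eventually_elim (auto simp: space_\<mu>)
  then have "(LINT l|\<mu> v. l) = (LINT l|\<mu> v. \<omega>)"
    by (intro integral_cong_AE) (auto intro: measurable_\<mu>)
  also have "\<dots> = (norm v)\<^sup>2 *\<^sub>R \<omega>"
    by (simp add: space_\<mu> measure_\<mu> E_sphere)
  finally have *: "cinner (U v) v = (norm v)\<^sup>2 *\<^sub>R \<omega>"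
    by (simp add: cinner_U)
  have "cnj \<omega> * \<omega> = 1"
    using \<omega> complex_norm_square[of \<omega>] by (simp add: mult.commute)
  then have cancel: "cnj \<omega> * (c * \<omega>) = c" "\<omega> * (c * cnj \<omega>) = c" for c
    by (simp_all add: mult.left_commute mult.commute[of \<omega>])
  have "cinner v (U v) = complex_of_real ((norm v)\<^sup>2) * cnj \<omega>"
    using cinner_commute[of v "U v"] by (simp add: * scaleR_conv_of_real)
  then have "cinner (U v) (\<omega> *\<^sub>C v) = (norm v)\<^sup>2" "cinner (\<omega> *\<^sub>C v) (U v) = (norm v)\<^sup>2"
    by (simp_all only: cinner_scaleC_left cinner_scaleC_right * scaleR_conv_of_real cancel
        cinner_self)
  moreover have "norm (\<omega> *\<^sub>C v) = norm v"
    using \<omega> by (simp add: norm_scaleC)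
  ultimately have "cinner (U v - \<omega> *\<^sub>C v) (U v - \<omega> *\<^sub>C v) = 0"
    unfolding cinner_diff_left cinner_diff_right U_iso by (simp add: cinner_self)
  then have "norm (U v - \<omega> *\<^sub>C v) = 0"
    by (simp add: cinner_self)
  then show ?thesis by (simp add: v_def)
qed

text \<open>The function \<open>1 - Re (cnj \<omega> * l)\<close> is nonnegative on the circle and
  vanishes there only at \<omega>. Its integral against the measure of \<open>m\<close> is zero, so
  that measure is concentrated at \<omega>.\<close>

lemma E_singleton_eigenvector:
  assumes m: "U m = \<omega> *\<^sub>C m" and \<omega>: "\<omega> \<in> sphere 0 1"
  shows "E {\<omega>} m = m"
proof -
  interpret finite_measure "\<mu> m" by (rule finite_measure_\<mu>)
  have norm: "cnj \<omega> * \<omega> = 1"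
    using \<omega> complex_norm_square[of \<omega>] by (simp add: mult.commute)
  have int_c: "integrable (\<mu> m) (\<lambda>l. cnj \<omega> * l)"
    by (intro integrable_mult_right integrable_id)
  have int: "integrable (\<mu> m) (\<lambda>l. 1 - Re (cnj \<omega> * l))"
    using integrable_Re[OF int_c] by auto
  have "(LINT l|\<mu> m. l) = \<omega> * (norm m)\<^sup>2"
    by (simp add: m cinner_scaleC_left cinner_self flip: cinner_U)
  then have "cnj \<omega> * (LINT l|\<mu> m. l) = (norm m)\<^sup>2"
    using norm by (simp add: mult.assoc[symmetric])
  then have "(LINT l|\<mu> m. Re (cnj \<omega> * l)) = (norm m)\<^sup>2"
    using integral_Re[OF int_c] by simp
  then have "(LINT l|\<mu> m. 1 - Re (cnj \<omega> * l)) = 0"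
    using integrable_Re[OF int_c]
    by (subst Bochner_Integration.integral_diff) (simp_all add: space_\<mu> measure_\<mu> E_sphere)
  moreover have nonneg: "0 \<le> 1 - Re (cnj \<omega> * l)" if "l \<in> sphere 0 1" for l
    using complex_Re_le_cmod[of "cnj \<omega> * l"] that \<omega> by (simp add: norm_mult)
  ultimately have "AE l in \<mu> m. 1 - Re (cnj \<omega> * l) = 0"
    using int by (subst (asm) integral_nonneg_eq_0_iff_AE) (auto simp: space_\<mu>)
  then have "AE l in \<mu> m. l = \<omega>"
    using AE_space
  proof eventually_elim
    case (elim l)
    have "cmod (cnj \<omega> * l) = 1"
      using elim(2) \<omega> by (simp add: norm_mult space_\<mu>)
    moreover have "Re (cnj \<omega> * l) = 1" using elim(1) by simp
    ultimately have "cnj \<omega> * l = 1"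
      by (simp add: complex_eq_iff cmod_def)
    then have "\<omega> * (cnj \<omega> * l) = \<omega>" by simp
    moreover have "\<omega> * (cnj \<omega> * l) = (cnj \<omega> * \<omega>) * l" by (simp only: mult_ac)
    ultimately show ?case using norm by simp
  qed
  moreover have sets: "sphere 0 1 - {\<omega>} \<in> sets circle_borel"
    using \<omega> by (intro sets.Diff) auto
  moreover have "sphere 0 1 - {\<omega>} = {l \<in> space (\<mu> m). l \<noteq> \<omega>}"
    by (auto simp: space_\<mu>)
  ultimately have "emeasure (\<mu> m) (sphere 0 1 - {\<omega>}) = 0"
    using emeasure_eq_0_AE[of "\<lambda>l. l \<noteq> \<omega>" "\<mu> m"] by simp
  then have "E (sphere 0 1 - {\<omega>}) m = 0"
    using sets by (simp add: emeasure_\<mu>)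
  moreover have "E (sphere 0 1) m = E {\<omega>} m + E (sphere 0 1 - {\<omega>}) m"
    using E_Un[of "{\<omega>}" "sphere 0 1 - {\<omega>}" m] sets \<omega> by (simp add: insert_absorb)
  ultimately show ?thesis
    by (simp add: E_sphere)
qed

lemma finite_partition_orthogonal:
  assumes I: "finite I" "\<And>i. i \<in> I \<Longrightarrow> P i \<in> sets circle_borel" "disjoint_family_on P I"
  shows "(norm (\<Sum>i\<in>I. c i *\<^sub>C E (P i) u))\<^sup>2 = (\<Sum>i\<in>I. (cmod (c i))\<^sup>2 * (norm (E (P i) u))\<^sup>2)"
proof -
  have "cinner (E (P i) u) (E (P j) u) = 0" if "i \<in> I" "j \<in> I" "i \<noteq> j" for i j
  proof -
    have "P i \<inter> P j = {}"
      using that I(3) by (auto simp: disjoint_family_on_def)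
    then have "cinner (E (P j) (E (P i) u)) u = 0"
      using that I(2) by (simp add: E_Int Int_commute)
    then show ?thesis
      using that I(2) by (simp add: E_sym)
  qed
  then show ?thesis
    by (subst norm_sum_orthogonal[OF I(1)])
      (simp_all add: norm_scaleC power_mult_distrib cinner_scaleC_left cinner_scaleC_right)
qed

text \<open>Compare \<open>U\<close> with a step-function approximation of the spectral integral that is subordinate
  to the given set.\<close>

lemma norm_E_le_opoly:
  assumes A: "A \<in> sets circle_borel" and r: "\<And>l. l \<in> A \<Longrightarrow> 1 \<le> cmod (poly r l)"
  shows "norm (E A u) \<le> norm (opoly U r u)"
proof -
  have "\<And>u. norm (U u) \<le> norm u"
    by (simp add: isometry_norm[of U, OF U_iso])
  then obtain C where C: "0 \<le> C" "\<And>V e u. clinear V \<Longrightarrow> (\<And>u. norm (V u) \<le> norm u) \<Longrightarrow> 0 \<le> e \<Longrightarrow>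
      (\<And>u. norm (U u - V u) \<le> e * norm u) \<Longrightarrow> norm (opoly U r u - opoly V r u) \<le> C * e * norm u"
    using opoly_perturbation[of U r] by blast
  \<comment> \<open>Points of one cell are at most \<open>2 * d\<close> apart; the outer factor 2 is
    the loss in \<open>quadratic_form_norm_le\<close>.\<close>
  have "norm (E A u) \<le> norm (opoly U r u) + C * (2 * (2 * d)) * norm u" if d: "0 < d" for d
  proof -
    \<comment> \<open>Labels of grid cells of side \<open>d\<close>; the last entry cuts the cells
      along \<open>A\<close>, so that \<open>A\<close> is a union of cells.\<close>
    define q where "q l = (\<lfloor>Re l / d\<rfloor>, \<lfloor>Im l / d\<rfloor>, l \<in> A)" for l
    define P where "P i = {l \<in> sphere 0 1. q l = i}" for i
    define I where "I = q ` sphere 0 1"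
    \<comment> \<open>Sample points lie in their cells, hence on the circle, which makes
      \<open>V\<close> below norm-preserving; for cells inside \<open>A\<close> they also satisfy
      the lower bound on \<open>r\<close>.\<close>
    define l where "l i = (SOME x. x \<in> P i)" for i
    have l: "l i \<in> P i" if i: "i \<in> I" for i
    proof -
      obtain x where "x \<in> P i" using i by (auto simp: I_def P_def)
      then show ?thesis unfolding l_def by (rule someI)
    qed
    have I: "finite I"
    proof (rule finite_subset)
      show "I \<subseteq> {\<lfloor>- 1 / d\<rfloor>..\<lfloor>1 / d\<rfloor>} \<times> {\<lfloor>- 1 / d\<rfloor>..\<lfloor>1 / d\<rfloor>} \<times> UNIV"
      proof -
        have "\<lfloor>x / d\<rfloor> \<in> {\<lfloor>- 1 / d\<rfloor>..\<lfloor>1 / d\<rfloor>}" if "\<bar>x\<bar> \<le> 1" for x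
        proof -
          have "- 1 / d \<le> x / d" "x / d \<le> 1 / d"
            using that d by (intro divide_right_mono; simp)+
          then show ?thesis
            using floor_mono by auto
        qed
        note floor_mem = this
        have "q l \<in> {\<lfloor>- 1 / d\<rfloor>..\<lfloor>1 / d\<rfloor>} \<times> {\<lfloor>- 1 / d\<rfloor>..\<lfloor>1 / d\<rfloor>} \<times> UNIV"
          if "l \<in> sphere 0 1" for l
          using floor_mem[of "Re l"] floor_mem[of "Im l"] abs_Re_le_cmod[of l] abs_Im_le_cmod[of l] that
          by (simp add: q_def)
        then show ?thesis unfolding I_def by blast
      qed
    qed simp
    have P: "P i \<in> sets circle_borel" for i
    proof -
      have [measurable]: "A \<in> sets borel" using A by (simp add: sets_circle_borel)
      have "{l \<in> space borel. cmod l = 1 \<and> \<lfloor>Re l / d\<rfloor> = fst i \<and> \<lfloor>Im l / d\<rfloor> = fst (snd i) \<and>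
          (l \<in> A \<longleftrightarrow> snd (snd i))} \<in> sets borel"
        by measurable
      then show ?thesis
        by (auto simp: sets_circle_borel P_def q_def prod_eq_iff elim: back_subst)
    qed
    have disj: "disjoint_family_on P J" for J
      by (auto simp: disjoint_family_on_def P_def)
    have UN: "(\<Union>i\<in>I. P i) = sphere 0 1"
      by (auto simp: P_def I_def)
    have expand: "(\<Sum>i\<in>I. E (P i) u) = u" for u
      using E_UN[OF I P disj, of u] by (simp add: UN E_sphere)
    have near: "cmod (x - y) \<le> 2 * d" if "x \<in> P i" "y \<in> P i" for x y i
    proof -
      have "\<bar>a - b\<bar> \<le> d" if "\<lfloor>a / d\<rfloor> = \<lfloor>b / d\<rfloor>" for a b
      proof -
        have "\<bar>a / d - b / d\<bar> \<le> 1" using that by linarith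
        then show ?thesis
          using d by (simp add: abs_divide pos_divide_le_eq flip: diff_divide_distrib)
      qed
      then have "\<bar>Re (x - y)\<bar> \<le> d" "\<bar>Im (x - y)\<bar> \<le> d"
        using that by (auto simp: P_def q_def)
      then show ?thesis
        using cmod_le[of "x - y"] by linarith
    qed
    define V where "V u = (\<Sum>i\<in>I. l i *\<^sub>C E (P i) u)" for u
    have V_lin: "clinear V"
      by (rule clinearI) (simp_all add: V_def clinear_add[OF E_lin[OF P]] clinear_scale[OF E_lin[OF P]]
          scaleC_add_right sum.distrib scaleC_sum_right mult.commute)
    have norm_V: "norm (V u) = norm u" for u
    proof -
      have "cmod (l i) = 1" if "i \<in> I" for i
        using l[OF that] by (simp add: P_def)
      then have "(norm (V u))\<^sup>2 = (\<Sum>i\<in>I. (norm (E (P i) u))\<^sup>2)"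
        unfolding V_def by (subst finite_partition_orthogonal[OF I P disj]) simp
      also have "\<dots> = (norm u)\<^sup>2"
        using finite_partition_orthogonal[OF I P disj, of "\<lambda>_. 1" u] by (simp add: expand)
      finally show ?thesis by simp
    qed
    have UV: "norm (U u - V u) \<le> 2 * (2 * d) * norm u" for u
    proof (rule quadratic_form_norm_le[where D = "\<lambda>u. U u - V u"])
      show "clinear (\<lambda>u. U u - V u)"
        by (rule clinearI) (simp_all add: clinear_add[OF U_lin] clinear_add[OF V_lin]
            clinear_scale[OF U_lin] clinear_scale[OF V_lin] scaleC_diff_right)
      fix v
      interpret finite_measure "\<mu> v" by (rule finite_measure_\<mu>)
      \<comment> \<open>The step function that represents the quadratic form of \<open>V\<close> as
        the identity function represents that of \<open>U\<close>.\<close>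
      define s where "s x = (\<Sum>i\<in>I. indicat_real (P i) x *\<^sub>R l i)" for x
      have s: "s x = l (q x)" if "x \<in> sphere 0 1" for x
      proof -
        have "s x = (\<Sum>i\<in>{q x}. indicat_real (P i) x *\<^sub>R l i)"
          unfolding s_def
          by (rule sum.mono_neutral_right) (use I that in \<open>auto simp: I_def P_def\<close>)
        also have "\<dots> = indicat_real (P (q x)) x *\<^sub>R l (q x)"
          by (simp only: sum.insert[OF finite.emptyI] sum.empty add_0_right empty_iff not_False_eq_True)
        also have "x \<in> P (q x)"
          using that unfolding P_def by blast
        then have "indicat_real (P (q x)) x *\<^sub>R l (q x) = l (q x)"
          by simp
        finally show ?thesis .
      qed
      have int_val: "(LINT x|\<mu> v. indicat_real (P i) x *\<^sub>R l i) = (norm (E (P i) v))\<^sup>2 *\<^sub>R l i" for i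
      proof -
        have "integrable (\<mu> v) (indicat_real (P i))"
          using P by (intro integrable_real_indicator) (simp_all add: sets_\<mu> emeasure_\<mu>)
        then have "(LINT x|\<mu> v. indicat_real (P i) x *\<^sub>R l i) =
            measure (\<mu> v) (P i \<inter> space (\<mu> v)) *\<^sub>R l i"
          by simp
        also have "P i \<inter> space (\<mu> v) = P i"
          by (auto simp: P_def space_\<mu>)
        finally show ?thesis
          using P by (simp only: measure_\<mu>)
      qed
      have int_i: "integrable (\<mu> v) (\<lambda>x. indicat_real (P i) x *\<^sub>R l i)" for i
        using P by (intro integrable_scaleR_left integrable_real_indicator)
          (simp_all add: sets_\<mu> emeasure_\<mu>)
      then have int_s: "integrable (\<mu> v) s"
        unfolding s_def by (intro Bochner_Integration.integrable_sum)
      have "(LINT x|\<mu> v. s x) = (\<Sum>i\<in>I. (norm (E (P i) v))\<^sup>2 *\<^sub>R l i)"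
        unfolding s_def by (subst Bochner_Integration.integral_sum) (simp_all only: int_i int_val)
      also have "\<dots> = cinner (V v) v"
      proof -
        have "cinner (E (P i) v) v = (norm (E (P i) v))\<^sup>2" for i
          using E_sym[OF P, of i "E (P i) v" v] E_Int[OF P P, of i i v]
          by (simp add: cinner_self)
        then show ?thesis
          by (simp add: V_def cinner_sum_left cinner_scaleC_left scaleR_conv_of_real mult.commute)
      qed
      finally have "cinner (U v - V v) v = (LINT x|\<mu> v. x - s x)"
        using int_s integrable_id by (simp add: cinner_diff_left cinner_U)
      also have "cmod \<dots> \<le> (LINT x|\<mu> v. cmod (x - s x))"
        by (rule integral_norm_bound)
      also have "\<dots> \<le> (LINT x|\<mu> v. 2 * d)"
      proof (rule integral_mono)
        fix x assume "x \<in> space (\<mu> v)"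
        then have x: "x \<in> sphere 0 1" by (simp add: space_\<mu>)
        then have "q x \<in> I" "x \<in> P (q x)" by (auto simp: I_def P_def)
        then show "cmod (x - s x) \<le> 2 * d"
          using near[of x "q x" "l (q x)"] l s[OF x] by simp
      qed (use int_s integrable_id in auto)
      also have "\<dots> = 2 * d * (norm v)\<^sup>2"
        by (simp add: space_\<mu> measure_\<mu> E_sphere)
      finally show "cmod (cinner (U v - V v) v) \<le> 2 * d * (norm v)\<^sup>2" .
    qed (use d in simp)
    have V_E: "V (E (P j) u) = l j *\<^sub>C E (P j) u" if "j \<in> I" for j
    proof -
      have "V (E (P j) u) = (\<Sum>i\<in>{j}. l i *\<^sub>C E (P i) (E (P j) u))"
        unfolding V_def
      proof (rule sum.mono_neutral_right)
        show "\<forall>i\<in>I - {j}. l i *\<^sub>C E (P i) (E (P j) u) = 0"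
        proof
          fix i assume "i \<in> I - {j}"
          then have "P i \<inter> P j = {}" by (auto simp: P_def)
          then show "l i *\<^sub>C E (P i) (E (P j) u) = 0"
            using P by (simp add: E_Int)
        qed
      qed (use I that in auto)
      then show ?thesis using P by (simp add: E_Int)
    qed
    have rV: "opoly V r u = (\<Sum>i\<in>I. poly r (l i) *\<^sub>C E (P i) u)"
    proof -
      have "opoly V r u = opoly V r (\<Sum>i\<in>I. E (P i) u)" by (simp add: expand)
      also have "\<dots> = (\<Sum>i\<in>I. poly r (l i) *\<^sub>C E (P i) u)"
        by (simp add: clinear_sum[OF clinear_opoly[OF V_lin]] opoly_eigenvector[OF V_lin V_E])
      finally show ?thesis .
    qed
    define J where "J = {i \<in> I. snd (snd i)}"
    have J: "finite J" "J \<subseteq> I" using I by (auto simp: J_def)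
    have "(\<Union>i\<in>J. P i) = A"
      using A by (auto simp: J_def P_def I_def q_def sets_circle_borel)
    then have "E A u = (\<Sum>i\<in>J. 1 *\<^sub>C E (P i) u)"
      using E_UN[OF J(1) P disj, of u] by simp
    then have "(norm (E A u))\<^sup>2 = (\<Sum>i\<in>J. (cmod 1)\<^sup>2 * (norm (E (P i) u))\<^sup>2)"
      by (simp only: finite_partition_orthogonal[OF J(1) P disj])
    also have "\<dots> \<le> (\<Sum>i\<in>J. (cmod (poly r (l i)))\<^sup>2 * (norm (E (P i) u))\<^sup>2)"
    proof (intro sum_mono mult_right_mono power_mono)
      fix i assume "i \<in> J"
      then have "q (l i) = i" "snd (snd i)" using l[of i] by (auto simp: J_def P_def)
      moreover have "snd (snd (q (l i))) \<longleftrightarrow> l i \<in> A" by (simp add: q_def)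
      ultimately have "l i \<in> A" by simp
      then show "cmod 1 \<le> cmod (poly r (l i))" using r by simp
    qed simp_all
    also have "\<dots> \<le> (\<Sum>i\<in>I. (cmod (poly r (l i)))\<^sup>2 * (norm (E (P i) u))\<^sup>2)"
      using I J by (intro sum_mono2) auto
    also have "\<dots> = (norm (opoly V r u))\<^sup>2"
      unfolding rV by (rule finite_partition_orthogonal[OF I P disj, symmetric])
    finally have "norm (E A u) \<le> norm (opoly V r u)"
      by (rule power2_le_imp_le) simp
    also have "\<dots> \<le> norm (opoly U r u) + norm (opoly U r u - opoly V r u)"
      using norm_triangle_ineq4[of "opoly U r u" "opoly U r u - opoly V r u"] by simp
    also have "norm (opoly U r u - opoly V r u) \<le> C * (2 * (2 * d)) * norm u"
      using d norm_V UV by (intro C(2) V_lin) simp_all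
    finally show ?thesis by simp
  qed
  moreover have "C * (2 * (2 * d)) * norm u = (C * 4 * norm u) * d" for d
    by (simp add: algebra_simps)
  ultimately have le: "norm (E A u) \<le> norm (opoly U r u) + (C * 4 * norm u) * d" if "0 < d" for d
    using that by metis
  have "((\<lambda>d. norm (opoly U r u) + (C * 4 * norm u) * d) \<longlongrightarrow> norm (opoly U r u) + (C * 4 * norm u) * 0) (at_right 0)"
    by (intro tendsto_intros)
  then have lim: "((\<lambda>d. norm (opoly U r u) + (C * 4 * norm u) * d) \<longlongrightarrow> norm (opoly U r u)) (at_right 0)"
    by simp
  have "\<forall>\<^sub>F d in at_right 0. norm (E A u) \<le> norm (opoly U r u) + (C * 4 * norm u) * d"
    using eventually_at_right_less[of "0 :: real"] by eventually_elim (rule le)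
  then show ?thesis
    by (rule tendsto_lowerbound[OF lim]) simp
qed

end

section \<open>The projection onto the continuous part, and inner regularity\<close>

lemma bounded_linear_cinner_right: "bounded_linear (cinner v)" for v :: "'a::complex_inner"
  by (rule bounded_linear_intro[of _ "norm v"])
    (simp_all add: cinner_add_right scaleR_scaleC cinner_scaleC_right scaleR_conv_of_real
      order_trans[OF norm_cinner_le] mult.commute)

lemma closed_cinner_eq_0: "closed {m. cinner v m = 0}" for v :: "'a::complex_inner"
  by (intro closed_Collect_eq continuous_on_const
      linear_continuous_on[OF bounded_linear_cinner_right])

lemma orthogonal_projection_eqI:
  assumes "p \<in> M" "\<And>m. m \<in> M \<Longrightarrow> cinner (u - p) m = 0"
  shows "orthogonal_projection M u = p"
  unfolding orthogonal_projection_def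
proof (rule the_equality)
  fix q assume q: "q \<in> M \<and> (\<forall>m\<in>M. cinner (u - q) m = 0)"
  have "cinner (p - q) m = 0" if "m \<in> M" for m
  proof -
    have "cinner (u - q) m - cinner (u - p) m = 0"
      using assms(2)[OF that] q that by simp
    then show ?thesis by (simp flip: cinner_diff_left)
  qed
  then have "cinner (p - q) (p - q) = 0"
    using assms(1) q unfolding cinner_diff_right[of "p - q"] by simp
  then show "q = p"
    by (simp add: cinner_self)
qed (use assms in auto)

context circle_spectral_measure
begin

lemma eigenvalue_in_sphere: "is_eigenvalue U \<omega> \<Longrightarrow> \<omega> \<in> sphere 0 1"
  using isometry_eigenvalue_norm[of U, OF U_iso] by (auto simp: is_eigenvalue_def)

text \<open>With finitely many eigenvalues, \<open>E F u\<close> is a finite sum of eigenvectors and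
  lies in their span. What remains is orthogonal to every eigenvector, because \<open>E F\<close> is
  symmetric and fixes each of them. This determines the definite description in
  \<open>orthogonal_projection\<close>.\<close>

lemma proj_cont_eq:
  assumes fin: "finite {\<omega>. is_eigenvalue U \<omega>}"
  shows "proj_cont U u = E (sphere 0 1 - {\<omega>. is_eigenvalue U \<omega>}) u"
proof -
  define F where "F = {\<omega>. is_eigenvalue U \<omega>}"
  have F: "finite F" "F \<subseteq> sphere 0 1"
    using fin eigenvalue_in_sphere by (auto simp: F_def)
  then have F_sets: "F \<in> sets circle_borel"
    by (simp add: sets_circle_borel borel_closed finite_imp_closed)
  have EF: "E F u = (\<Sum>\<omega>\<in>F. E {\<omega>} u)" for u
    using E_UN[of F "\<lambda>\<omega>. {\<omega>}" u] F by (simp add: disjoint_family_on_def subset_eq)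
  have span: "E F u \<in> complex_vector.span (eigenvectors U)"
    unfolding EF
  proof (rule complex_vector.span_sum)
    fix \<omega> assume "\<omega> \<in> F"
    then have "U (E {\<omega>} u) = \<omega> *\<^sub>C E {\<omega>} u"
      using F by (intro U_E_singleton) auto
    then show "E {\<omega>} u \<in> complex_vector.span (eigenvectors U)"
      by (cases "E {\<omega>} u = 0")
        (auto simp: eigenvectors_def complex_vector.span_zero intro: complex_vector.span_base)
  qed
  have orth: "cinner (u - E F u) m = 0" if m: "m \<in> eigenvectors U" for m
  proof -
    obtain \<omega> where \<omega>: "m \<noteq> 0" "U m = \<omega> *\<^sub>C m"
      using m unfolding eigenvectors_def by blast
    then have "\<omega> \<in> F" unfolding F_def is_eigenvalue_def by blast
    then have "\<omega> \<in> sphere 0 1" using F by blast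
    have Em: "E {\<omega>} m = m"
      by (rule E_singleton_eigenvector) fact+
    have "E F (E {\<omega>} m) = E (F \<inter> {\<omega>}) m"
      using F_sets \<open>\<omega> \<in> sphere 0 1\<close> by (intro E_Int singleton_sets)
    then have "E F m = m"
      using Em \<open>\<omega> \<in> F\<close> by simp
    then show ?thesis
      using E_sym[OF F_sets, of u m] by (simp add: cinner_diff_left)
  qed
  have "closure (complex_vector.span (eigenvectors U)) \<subseteq> {m. cinner (u - E F u) m = 0}"
    by (rule closure_minimal[OF _ closed_cinner_eq_0])
      (use cinner_span_eq_0[OF _ orth] in blast)
  then have "proj_point U u = E F u"
    unfolding proj_point_def using span closure_subset
    by (intro orthogonal_projection_eqI) blast+
  moreover have "u = E F u + E (sphere 0 1 - F) u"
  proof -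
    have "E (F \<union> (sphere 0 1 - F)) u = E F u + E (sphere 0 1 - F) u"
      using F_sets by (intro E_Un sets.Diff sphere_sets) auto
    moreover have "F \<union> (sphere 0 1 - F) = sphere 0 1" using F by blast
    ultimately show ?thesis by (simp add: E_sphere)
  qed
  ultimately show ?thesis
    unfolding proj_cont_def F_def[symmetric] by (metis add_diff_cancel_left')
qed

text \<open>Peak polynomials exist for closed sets; inner regularity of the finite measure of
  \<open>u\<close> carries the vanishing to Borel sets. \<open>M\<close> is that measure regarded as
  a Borel measure on the plane.\<close>

lemma E_eq_0_compact:
  assumes A: "A \<in> sets circle_borel" and K: "\<And>K. compact K \<Longrightarrow> K \<subseteq> A \<Longrightarrow> E K u = 0"
  shows "E A u = 0"
proof -
  interpret \<mu>: finite_measure "\<mu> u" by (rule finite_measure_\<mu>)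
  have id: "(\<lambda>x. x) \<in> measurable (\<mu> u) borel"
    by (rule measurable_\<mu>) simp
  define M where "M = distr (\<mu> u) borel (\<lambda>x. x)"
  have M: "emeasure M X = emeasure (\<mu> u) X" if "X \<in> sets circle_borel" for X
  proof -
    have "X \<in> sets borel" "X \<subseteq> sphere 0 1" using that by (auto simp only: sets_circle_borel)
    then show ?thesis
      by (simp add: M_def emeasure_distr[OF id] space_\<mu> Int_absorb2)
  qed
  have "emeasure M A = (SUP K \<in> {K. K \<subseteq> A \<and> compact K}. emeasure M K)"
  proof (rule inner_regular)
    show "sets M = sets borel" by (simp add: M_def)
    show "emeasure M (space M) \<noteq> \<infinity>"
      using finite_measure.emeasure_finite[OF \<mu>.finite_measure_distr[OF id]]
      by (simp add: M_def)
    show "A \<in> sets borel" using A by (simp add: sets_circle_borel)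
  qed
  also have "\<dots> = (SUP K \<in> {K. K \<subseteq> A \<and> compact K}. 0)"
  proof (rule SUP_cong)
    fix K assume "K \<in> {K. K \<subseteq> A \<and> compact K}"
    then have "compact K" "K \<subseteq> A" by auto
    moreover have "K \<in> sets circle_borel"
      using \<open>compact K\<close> \<open>K \<subseteq> A\<close> A
      by (auto simp only: sets_circle_borel intro: borel_closed compact_imp_closed)
    ultimately show "emeasure M K = 0"
      by (simp add: M emeasure_\<mu> K)
  qed simp
  also have "\<dots> = 0" by (rule SUP_const) auto
  finally show ?thesis
    using A by (simp add: M emeasure_\<mu>)
qed

end

section \<open>Polynomials on the circle\<close>

text \<open>On the circle \<open>cnj \<omega>\<close> is the inverse of \<omega>, so a polynomial in
  the real and imaginary parts is a Laurent polynomial. The power of \<omega> clears the negative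
  exponents without changing absolute values.\<close>

lemma real_polynomial_function_circle:
  fixes g :: "complex \<Rightarrow> real"
  assumes "real_polynomial_function g"
  shows "\<exists>p m. \<forall>\<omega>\<in>sphere 0 1. complex_of_real (g \<omega>) * \<omega> ^ m = poly p \<omega>"
  using assms
proof induction
  case (linear f)
  define a where "a = complex_of_real (f 1)"
  define b where "b = complex_of_real (f \<i>)"
  \<comment> \<open>Obtained from Re \<omega> = (\<omega> + 1/\<omega>)/2 and Im \<omega> = -i
    (\<omega> - 1/\<omega>)/2 after multiplication by \<omega>.\<close>
  have "complex_of_real (f \<omega>) * \<omega> ^ 1 = poly [:(a + \<i> * b) / 2, 0, (a - \<i> * b) / 2:] \<omega>"
    if "\<omega> \<in> sphere 0 1" for \<omega>
  proof -
    have "f \<omega> = f (Re \<omega> *\<^sub>R 1 + Im \<omega> *\<^sub>R \<i>)"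
      by (rule arg_cong[of _ _ f]) (simp add: complex_eq_iff)
    then have f: "f \<omega> = Re \<omega> * f 1 + Im \<omega> * f \<i>"
      using bounded_linear.linear[OF linear] by (simp add: linear_add linear_scale)
    have norm: "\<omega> * cnj \<omega> = 1"
      using that complex_norm_square[of \<omega>] by simp
    have re: "complex_of_real (Re \<omega>) = (\<omega> + cnj \<omega>) / 2"
      by (simp add: complex_eq_iff)
    have im: "complex_of_real (Im \<omega>) = - \<i> * (\<omega> - cnj \<omega>) / 2"
      by (simp add: complex_eq_iff)
    have mult: "complex_of_real (Re \<omega>) * \<omega> = (\<omega> * \<omega> + \<omega> * cnj \<omega>) / 2"
      "complex_of_real (Im \<omega>) * \<omega> = - \<i> * (\<omega> * \<omega> - \<omega> * cnj \<omega>) / 2"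
      unfolding re im by (simp_all add: field_simps)
    have "complex_of_real (f \<omega>) * \<omega> =
        a * (complex_of_real (Re \<omega>) * \<omega>) + b * (complex_of_real (Im \<omega>) * \<omega>)"
      unfolding f a_def b_def by (simp add: algebra_simps)
    also have "\<dots> = a * ((\<omega> * \<omega> + 1) / 2) + b * (- \<i> * (\<omega> * \<omega> - 1) / 2)"
      unfolding mult norm ..
    finally show ?thesis by (simp add: algebra_simps add_divide_distrib diff_divide_distrib)
  qed
  then show ?case by blast
next
  case (const c)
  show ?case by (intro exI[of _ "[:complex_of_real c:]"] exI[of _ 0]) simp
next
  case (add f g)
  then obtain p m q n where
    "\<forall>\<omega>\<in>sphere 0 1. complex_of_real (f \<omega>) * \<omega> ^ m = poly p \<omega>"
    "\<forall>\<omega>\<in>sphere 0 1. complex_of_real (g \<omega>) * \<omega> ^ n = poly q \<omega>" by blast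
  then have eq: "poly p \<omega> = complex_of_real (f \<omega>) * \<omega> ^ m" "poly q \<omega> = complex_of_real (g \<omega>) * \<omega> ^ n"
    if "\<omega> \<in> sphere 0 1" for \<omega>
    using that by simp_all
  have "complex_of_real (f \<omega> + g \<omega>) * \<omega> ^ (m + n) = poly (p * monom 1 n + q * monom 1 m) \<omega>"
    if "\<omega> \<in> sphere 0 1" for \<omega>
    by (simp add: poly_monom eq[OF that] power_add algebra_simps)
  then show ?case by blast
next
  case (mult f g)
  then obtain p m q n where
    "\<forall>\<omega>\<in>sphere 0 1. complex_of_real (f \<omega>) * \<omega> ^ m = poly p \<omega>"
    "\<forall>\<omega>\<in>sphere 0 1. complex_of_real (g \<omega>) * \<omega> ^ n = poly q \<omega>" by blast
  then have eq: "poly p \<omega> = complex_of_real (f \<omega>) * \<omega> ^ m" "poly q \<omega> = complex_of_real (g \<omega>) * \<omega> ^ n"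
    if "\<omega> \<in> sphere 0 1" for \<omega>
    using that by simp_all
  have "complex_of_real (f \<omega> * g \<omega>) * \<omega> ^ (m + n) = poly (p * q) \<omega>"
    if "\<omega> \<in> sphere 0 1" for \<omega>
    by (simp add: eq[OF that] power_add algebra_simps)
  then show ?case by blast
qed

lemma circle_polynomial_approximation:
  fixes f :: "complex \<Rightarrow> real"
  assumes "continuous_on (sphere 0 1) f" "0 < e"
  shows "\<exists>p. \<forall>\<omega>\<in>sphere 0 1. \<bar>cmod (poly p \<omega>) - \<bar>f \<omega>\<bar>\<bar> < e"
proof -
  obtain g where g: "real_polynomial_function g" "\<And>\<omega>. \<omega> \<in> sphere 0 1 \<Longrightarrow> \<bar>f \<omega> - g \<omega>\<bar> < e"
    using Stone_Weierstrass_real_polynomial_function[OF compact_sphere assms] by blast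
  obtain p m where p: "\<And>\<omega>. \<omega> \<in> sphere 0 1 \<Longrightarrow> complex_of_real (g \<omega>) * \<omega> ^ m = poly p \<omega>"
    using real_polynomial_function_circle[OF g(1)] by blast
  have "\<bar>cmod (poly p \<omega>) - \<bar>f \<omega>\<bar>\<bar> < e" if "\<omega> \<in> sphere 0 1" for \<omega>
  proof -
    have "cmod (poly p \<omega>) = \<bar>g \<omega>\<bar>"
      using that by (simp add: norm_mult norm_power flip: p)
    then show ?thesis using g(2)[OF that] by linarith
  qed
  then show ?thesis by blast
qed

text \<open>Tents of height 2 around \<open>K\<close> leave room for an approximation error of at
  most 1 on either side, whence the bounds 1 and 3. At a point off \<open>K\<close> the tents are
  eventually 0 and only the error \<open>1 / real (Suc j)\<close> is left. For empty
  \<open>K\<close> the value of \<open>infdist\<close> is 0, and the tents would not decay.\<close>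

lemma circle_peak_polynomials:
  assumes K: "closed K" "K \<noteq> {}"
  shows "\<exists>r :: nat \<Rightarrow> complex poly. (\<forall>j. \<forall>\<omega>\<in>K \<inter> sphere 0 1. 1 \<le> cmod (poly (r j) \<omega>)) \<and>
    (\<forall>j. \<forall>\<omega>\<in>sphere 0 1. cmod (poly (r j) \<omega>) \<le> 3) \<and>
    (\<forall>\<omega>\<in>sphere 0 1 - K. (\<lambda>j. poly (r j) \<omega>) \<longlonglongrightarrow> 0)"
proof -
  define f where "f j \<omega> = 2 * max 0 (1 - real j * infdist \<omega> K)" for j \<omega>
  have cont: "continuous_on (sphere 0 1) (f j)" for j
    unfolding f_def by (intro continuous_intros)
  have "\<exists>p. \<forall>\<omega>\<in>sphere 0 1. \<bar>cmod (poly p \<omega>) - \<bar>f j \<omega>\<bar>\<bar> < 1 / real (Suc j)" for j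
    by (rule circle_polynomial_approximation[OF cont]) simp
  then obtain r where r: "\<And>j \<omega>. \<omega> \<in> sphere 0 1 \<Longrightarrow> \<bar>cmod (poly (r j) \<omega>) - \<bar>f j \<omega>\<bar>\<bar> < 1 / real (Suc j)"
    by metis
  have le1: "1 / real (Suc j) \<le> 1" for j by simp
  have f: "0 \<le> f j \<omega>" "f j \<omega> \<le> 2" for j \<omega>
    unfolding f_def using infdist_nonneg[of \<omega> K] by (simp_all add: max_def)
  have "1 \<le> cmod (poly (r j) \<omega>)" if "\<omega> \<in> K \<inter> sphere 0 1" for j \<omega>
  proof -
    have "f j \<omega> = 2" using that by (simp add: f_def)
    then have "\<bar>cmod (poly (r j) \<omega>) - \<bar>2\<bar>\<bar> < 1 / real (Suc j)"
      using r[of \<omega> j] that by (auto simp only: Int_iff)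
    then show ?thesis using le1[of j] by linarith
  qed
  moreover have "cmod (poly (r j) \<omega>) \<le> 3" if "\<omega> \<in> sphere 0 1" for j \<omega>
    using r[OF that, of j] f[of j \<omega>] le1[of j] by linarith
  moreover have "(\<lambda>j. poly (r j) \<omega>) \<longlonglongrightarrow> 0" if \<omega>: "\<omega> \<in> sphere 0 1 - K" for \<omega>
  proof (rule tendsto_norm_zero_cancel, rule tendsto_sandwich[where f = "\<lambda>_. 0"])
    have "0 < infdist \<omega> K"
      using \<omega> K infdist_nonneg[of \<omega> K] in_closed_iff_infdist_zero[OF K] by fastforce
    then obtain N where N: "1 < real N * infdist \<omega> K"
      using reals_Archimedean3 by blast
    have "cmod (poly (r j) \<omega>) \<le> 1 / real (Suc j)" if "N \<le> j" for j
    proof -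
      have "real N * infdist \<omega> K \<le> real j * infdist \<omega> K"
        using that infdist_nonneg[of \<omega> K] by (intro mult_right_mono) auto
      then have "f j \<omega> = 0" using N by (simp add: f_def)
      moreover have "\<bar>cmod (poly (r j) \<omega>) - \<bar>f j \<omega>\<bar>\<bar> < 1 / real (Suc j)"
        using \<omega> by (intro r) blast
      ultimately show ?thesis by linarith
    qed
    then show "\<forall>\<^sub>F j in sequentially. cmod (poly (r j) \<omega>) \<le> 1 / real (Suc j)"
      by (rule eventually_sequentiallyI)
    show "(\<lambda>j. 1 / real (Suc j)) \<longlonglongrightarrow> 0"
      by (rule LIMSEQ_Suc[OF lim_1_over_n])
  qed simp_all
  ultimately show ?thesis by blast
qed

section \<open>Null sets of the circle and Cesaro means\<close>

lemma circle_null_subset: "circle_null K \<Longrightarrow> K' \<subseteq> K \<Longrightarrow> circle_null K'"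
  unfolding circle_null_def by (erule negligible_subset) blast

lemma circle_null_singleton: "circle_null {\<omega>}"
proof -
  have "s = s'" if "cis s = cis s'" "0 \<le> s" "s < 2 * pi" "0 \<le> s'" "s' < 2 * pi" for s s'
    by (rule Arg2pi_unique_lemma[of "cis s"]) (use that in \<open>simp_all add: is_Arg_def cis_conv_exp\<close>)
  then have "{s \<in> {0..<2 * pi}. cis s \<in> {\<omega>}} \<subseteq> {THE s. s \<in> {0..<2 * pi} \<and> cis s = \<omega>}"
    by (auto intro!: the_equality[symmetric])
  then show ?thesis
    unfolding circle_null_def by (rule negligible_subset[rotated]) simp
qed

lemma circle_null_null_sets:
  assumes "A \<in> null_sets circle_lebesgue"
  shows "circle_null A"
proof -
  have cis: "cis \<in> measurable (restrict_space lborel {0..<2 * pi}) circle_borel"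
    unfolding circle_borel_def
    by (intro measurable_restrict_space2 measurable_restrict_space1) auto
  have A: "A \<in> sets circle_borel" "emeasure circle_lebesgue A = 0"
    using assms by (auto simp: circle_lebesgue_def)
  then have "emeasure (restrict_space lborel {0..<2 * pi}) (cis -` A \<inter> {0..<2 * pi}) = 0"
    by (simp add: circle_lebesgue_def emeasure_distr[OF cis] space_restrict_space)
  then have "emeasure lborel (cis -` A \<inter> {0..<2 * pi}) = 0"
    by (subst (asm) emeasure_restrict_space) auto
  moreover have "cis -` A \<inter> {0..<2 * pi} \<in> sets lborel"
    using measurable_sets[OF cis A(1)] by (simp add: space_restrict_space sets_restrict_space_iff)
  ultimately have "cis -` A \<inter> {0..<2 * pi} \<in> null_sets lborel"
    by (auto simp: null_sets_def)
  then have "negligible (cis -` A \<inter> {0..<2 * pi})"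
    by (simp add: negligible_iff_null_sets null_sets_completionI)
  moreover have "cis -` A \<inter> {0..<2 * pi} = {s \<in> {0..<2 * pi}. cis s \<in> A}" by auto
  ultimately show ?thesis by (simp add: circle_null_def)
qed

text \<open>On the circle \<open>cnj \<omega>\<close> stands for 1/\<omega>. The values there stay
  in the unit disc, equal 1 at \<omega> and tend to 0 elsewhere.\<close>

definition cesaro :: "complex \<Rightarrow> nat \<Rightarrow> complex poly"
  where "cesaro \<omega> j = smult (1 / of_nat (Suc j)) (\<Sum>k\<le>j. monom (cnj \<omega> ^ k) k)"

lemma poly_cesaro: "poly (cesaro \<omega> j) l = (\<Sum>k\<le>j. (cnj \<omega> * l) ^ k) / of_nat (Suc j)"
  by (simp add: cesaro_def poly_sum poly_monom power_mult_distrib)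

lemma poly_cesaro_self:
  assumes "cmod \<omega> = 1"
  shows "poly (cesaro \<omega> j) \<omega> = 1"
proof -
  have "cnj \<omega> * \<omega> = 1"
    using assms complex_norm_square[of \<omega>] by (simp add: mult.commute)
  then show ?thesis
    by (simp add: poly_cesaro del: of_nat_Suc)
qed

lemma cmod_poly_cesaro_le:
  assumes "cmod \<omega> = 1" "cmod l = 1"
  shows "cmod (poly (cesaro \<omega> j) l) \<le> 1"
proof -
  have "cmod (\<Sum>k\<le>j. (cnj \<omega> * l) ^ k) \<le> (\<Sum>k\<le>j. 1)"
    by (rule sum_norm_le) (simp add: norm_power norm_mult assms)
  then show ?thesis
    by (simp add: poly_cesaro norm_divide del: of_nat_Suc)
qed

lemma poly_cesaro_tendsto_0:
  assumes "cmod \<omega> = 1" "cmod l = 1" "l \<noteq> \<omega>"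
  shows "(\<lambda>j. poly (cesaro \<omega> j) l) \<longlonglongrightarrow> 0"
proof (rule tendsto_0_le)
  define t where "t = cnj \<omega> * l"
  have "t \<noteq> 1"
  proof
    assume "t = 1"
    then have "\<omega> * (cnj \<omega> * l) = \<omega>" by (simp add: t_def)
    moreover have "\<omega> * (cnj \<omega> * l) = (\<omega> * cnj \<omega>) * l" by (simp only: mult.assoc)
    moreover have "\<omega> * cnj \<omega> = 1"
      using assms(1) complex_norm_square[of \<omega>] by simp
    ultimately show False using assms(3) by simp
  qed
  have "cmod (poly (cesaro \<omega> j) l) \<le> norm (1 / real (Suc j)) * (2 / cmod (1 - t))" for j
  proof -
    have "(\<Sum>k\<le>j. t ^ k) = (1 - t ^ Suc j) / (1 - t)"
      using sum_gp0[of t j] \<open>t \<noteq> 1\<close> by simp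
    moreover have "cmod (1 - t ^ Suc j) \<le> 2"
      using norm_triangle_ineq4[of 1 "t ^ Suc j"] assms
      by (simp add: norm_power norm_mult t_def del: power_Suc)
    ultimately have "cmod (\<Sum>k\<le>j. t ^ k) \<le> 2 / cmod (1 - t)"
      by (simp add: norm_divide divide_right_mono del: power_Suc)
    then have "cmod (\<Sum>k\<le>j. t ^ k) / real (Suc j) \<le> (2 / cmod (1 - t)) / real (Suc j)"
      by (intro divide_right_mono) simp_all
    then show ?thesis
      by (simp add: poly_cesaro norm_divide t_def mult.commute del: of_nat_Suc)
  qed
  then show "\<forall>\<^sub>F j in sequentially. norm (poly (cesaro \<omega> j) l) \<le> norm (1 / real (Suc j)) * (2 / cmod (1 - t))"
    by (intro always_eventually allI)
  show "(\<lambda>j. 1 / real (Suc j)) \<longlonglongrightarrow> 0"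
    by (rule LIMSEQ_Suc[OF lim_1_over_n])
qed

section \<open>The theorem\<close>

lemma cinner_opoly_eigenvector:
  fixes A :: "'a::complex_inner \<Rightarrow> 'a"
  assumes "\<And>u v. cinner (A u) (A v) = cinner u v" "A v = \<eta> *\<^sub>C v"
  shows "cinner (opoly A r u) v = poly r \<eta> * cinner u v"
proof (induction r arbitrary: u)
  case (pCons c r)
  then show ?case
    by (simp add: opoly_pCons cinner_add_left cinner_scaleC_left
        isometry_cinner_eigenvector[OF assms] algebra_simps)
qed simp

context periodic_walk
begin

text \<open>The eigenvector \<open>v\<close> need not have finite support, so the means are applied
  to \<open>w = delta x \<phi>\<close> instead. They leave the pairing of \<open>w\<close> with
  \<open>v\<close> unchanged while their norms tend to 0, which makes \<open>v\<close> orthogonal to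
  all delta functions.\<close>

lemma eigenvalue_symbol:
  assumes "is_eigenvalue U \<omega>" "z \<in> torus"
  shows "is_eigenvalue (symbol z) \<omega>"
proof (rule ccontr)
  assume neg: "\<not> is_eigenvalue (symbol z) \<omega>"
  obtain v where v: "v \<noteq> 0" "U v = \<omega> *\<^sub>C v"
    using assms(1) unfolding is_eigenvalue_def by blast
  have \<omega>: "cmod \<omega> = 1"
    by (rule isometry_eigenvalue_norm[OF iso v(2,1)])
  have "cinner v (delta x \<phi>) = 0" for x \<phi>
  proof -
    define w where "w = delta x \<phi>"
    have "(\<lambda>j. norm (opoly U (cesaro \<omega> j) w)) \<longlonglongrightarrow> 0"
      by (rule opoly_U_tendsto_0[where K = "{\<omega>}" and C = 1])
        (use \<omega> assms(2) neg in \<open>auto simp: circle_null_singleton w_def intro: cmod_poly_cesaro_le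
          poly_cesaro_tendsto_0\<close>)
    then have "(\<lambda>j. norm (opoly U (cesaro \<omega> j) w) * norm v) \<longlonglongrightarrow> 0"
      by (rule tendsto_mult_left_zero)
    moreover have "cmod (cinner w v) \<le> norm (opoly U (cesaro \<omega> j) w) * norm v" for j
      using norm_cinner_le[of "opoly U (cesaro \<omega> j) w" v]
      by (simp add: cinner_opoly_eigenvector[OF iso v(2)] poly_cesaro_self[OF \<omega>])
    ultimately have "cmod (cinner w v) \<le> 0"
      by (intro LIMSEQ_le_const) auto
    then show ?thesis
      using cinner_commute[of v w] by (simp add: w_def)
  qed
  then have "cinner (ell2_apply v x) (ell2_apply v x) = 0" for x
    by (simp only: cinner_delta)
  then have "v = 0"
    by (intro ell2_eqI) (simp add: cinner_self)
  with v(1) show False ..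
qed

text \<open>A unit eigenvector of the symbol is fixed by \<open>opoly (symbol z) r\<close>, so the Hilbert-Schmidt norm
  of that operator is at least one at every point of the torus.\<close>

lemma sum_norm_opoly_delta_ge_1:
  assumes ev: "\<And>z. z \<in> torus \<Longrightarrow> is_eigenvalue (symbol z) \<omega>" and r: "poly r \<omega> = 1"
  shows "1 \<le> (\<Sum>b\<in>B. (norm (opoly U r (delta 0 b)))\<^sup>2)"
proof -
  interpret I: prob_space unit_interval by (rule prob_space_unit_interval)
  interpret Q: prob_space "unit_cube :: ('d \<Rightarrow> real) measure" by (rule prob_space_unit_cube)
  interpret QI: pair_prob_space "unit_cube :: ('d \<Rightarrow> real) measure" unit_interval ..
  \<comment> \<open>By \<open>parseval\<close> every direction gives the same mean, so the direction
    0 is as good as any.\<close>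
  define h where "h b \<zeta> t = (norm (fhat (opoly U r (delta 0 b)) (torus_point 0 \<zeta> t)))\<^sup>2" for b \<zeta> t
  have supp: "fin_supp (opoly U r (delta 0 b))" for b
    by (simp add: fin_supp_opoly)
  have meas: "(\<lambda>(\<zeta>, t). h b \<zeta> t) \<in> borel_measurable (unit_cube \<Otimes>\<^sub>M unit_interval)" for b
    unfolding h_def by (rule measurable_norm_fhat[OF supp])
  have "\<exists>C. \<forall>\<zeta> t. norm (h b \<zeta> t) \<le> C" for b
    unfolding h_def
    by (intro exI[of _ "(\<Sum>x | ell2_apply (opoly U r (delta 0 b)) x \<noteq> 0.
      norm (ell2_apply (opoly U r (delta 0 b)) x))\<^sup>2"]) (simp add: power_mono norm_fhat_le torus_point_in_torus)
  then obtain C where C: "\<And>b \<zeta> t. norm (h b \<zeta> t) \<le> C b" by metis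
  have int1: "integrable unit_interval (h b \<zeta>)" if "\<zeta> \<in> space unit_cube" for b \<zeta>
    using measurable_compose_Pair1[OF that meas, of b] C
    by (intro I.integrable_const_bound[where B = "C b"]) auto
  have "integrable (unit_cube \<Otimes>\<^sub>M unit_interval) (\<lambda>(\<zeta>, t). h b \<zeta> t)" for b
    using C by (intro QI.integrable_const_bound[where B = "C b"] meas) auto
  then have int2: "integrable unit_cube (\<lambda>\<zeta>. LINT t|unit_interval. h b \<zeta> t)" for b
    using QI.integrable_fst by fastforce
  have ge: "1 \<le> (\<Sum>b\<in>B. h b \<zeta> t)" for \<zeta> t
  proof -
    let ?z = "torus_point 0 \<zeta> t"
    let ?T = "opoly (symbol ?z) r"
    \<comment> \<open>The eigenvector is chosen separately at each point. Only the sum over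
      \<open>B\<close>, which does not involve the choice, is integrated, so no measurable selection
      is required.\<close>
    obtain e0 where e0: "e0 \<noteq> 0" "symbol ?z e0 = \<omega> *\<^sub>C e0"
      using ev[OF torus_point_in_torus] unfolding is_eigenvalue_def by blast
    define e where "e = complex_of_real (1 / norm e0) *\<^sub>C e0"
    have e: "norm e = 1" "symbol ?z e = \<omega> *\<^sub>C e"
      using e0 by (simp_all add: e_def norm_scaleC norm_divide clinear_scale[OF symbol_lin] mult.commute)
    have "?T e = e"
      using opoly_eigenvector[OF symbol_lin e(2), of r] by (simp add: r scaleC_one)
    then have "e = ?T (\<Sum>b\<in>B. cinner e b *\<^sub>C b)"
      by (simp add: orthonormal_basis_expand[OF basis])
    also have "\<dots> = (\<Sum>b\<in>B. cinner e b *\<^sub>C ?T b)"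
      by (simp add: clinear_sum[OF clinear_opoly[OF symbol_lin]]
          clinear_scale[OF clinear_opoly[OF symbol_lin]])
    also have "norm \<dots> \<le> (\<Sum>b\<in>B. cmod (cinner e b) * norm (?T b))"
      by (rule sum_norm_le) (simp add: norm_scaleC)
    finally have "1 \<le> (\<Sum>b\<in>B. cmod (cinner e b) * norm (?T b))"
      by (simp add: e)
    then have "1\<^sup>2 \<le> (\<Sum>b\<in>B. cmod (cinner e b) * norm (?T b))\<^sup>2"
      by (intro power_mono) simp_all
    also have "\<dots> \<le> (\<Sum>b\<in>B. (cmod (cinner e b))\<^sup>2) * (\<Sum>b\<in>B. (norm (?T b))\<^sup>2)"
      by (rule Cauchy_Schwarz_ineq_sum)
    also have "(\<Sum>b\<in>B. (cmod (cinner e b))\<^sup>2) = 1"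
    proof -
      have unit: "norm b = 1" if "b \<in> B" for b
      proof -
        have "(norm b)\<^sup>2 = 1"
          using orthonormal_basis_cinner[OF basis that that] by (simp add: norm_sq_eq_cinner)
        then show ?thesis by (metis norm_ge_zero power2_eq_imp_eq one_power2 zero_le_one)
      qed
      have "(norm (\<Sum>b\<in>B. cinner e b *\<^sub>C b))\<^sup>2 = (\<Sum>b\<in>B. (norm (cinner e b *\<^sub>C b))\<^sup>2)"
        by (rule norm_sum_orthogonal[OF orthonormal_basis_finite[OF basis]])
          (simp add: cinner_scaleC_left cinner_scaleC_right orthonormal_basis_cinner[OF basis])
      also have "\<dots> = (\<Sum>b\<in>B. (cmod (cinner e b))\<^sup>2)"
        by (rule sum.cong) (simp_all add: norm_scaleC unit)
      finally show ?thesis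
        by (simp add: orthonormal_basis_expand[OF basis] e)
    qed
    also have "1 * (\<Sum>b\<in>B. (norm (?T b))\<^sup>2) = (\<Sum>b\<in>B. h b \<zeta> t)"
      by (simp add: h_def fhat_opoly torus_point_in_torus fhat_delta)
    finally show ?thesis by simp
  qed
  have inner: "1 \<le> (\<Sum>b\<in>B. LINT t|unit_interval. h b \<zeta> t)" if "\<zeta> \<in> space unit_cube" for \<zeta>
  proof -
    have "1 \<le> (LINT t|unit_interval. (\<Sum>b\<in>B. h b \<zeta> t))"
      by (rule I.integral_ge_const) (auto intro!: Bochner_Integration.integrable_sum int1 that ge)
    then show ?thesis
      by (subst (asm) Bochner_Integration.integral_sum) (auto intro: int1 that)
  qed
  have "1 \<le> (LINT \<zeta>|unit_cube. (\<Sum>b\<in>B. LINT t|unit_interval. h b \<zeta> t))"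
    by (rule Q.integral_ge_const) (auto intro!: Bochner_Integration.integrable_sum int2 AE_I2 inner)
  also have "\<dots> = (\<Sum>b\<in>B. LINT \<zeta>|unit_cube. LINT t|unit_interval. h b \<zeta> t)"
    by (rule Bochner_Integration.integral_sum) (rule int2)
  also have "\<dots> = (\<Sum>b\<in>B. (norm (opoly U r (delta 0 b)))\<^sup>2)"
    unfolding h_def by (simp only: parseval[OF supp, where n = 0])
  finally show ?thesis .
qed

text \<open>Dominated convergence speaks about sequences, so a failure of the Cauchy property is
  first turned into two index sequences tending to infinity. The differences vanish at \<omega>
  itself, where both means equal 1.\<close>

lemma Cauchy_cesaro:
  assumes \<omega>: "cmod \<omega> = 1" and f: "fin_supp f"
  shows "Cauchy (\<lambda>j. opoly U (cesaro \<omega> j) f)"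
proof (rule ccontr)
  assume "\<not> ?thesis"
  then obtain e where e: "0 < e" "\<forall>N. \<exists>m\<ge>N. \<exists>n\<ge>N.
      e \<le> dist (opoly U (cesaro \<omega> m) f) (opoly U (cesaro \<omega> n) f)"
    unfolding Cauchy_def by (auto simp: not_less)
  then obtain m n where mn: "\<And>N. N \<le> m N" "\<And>N. N \<le> n N"
    "\<And>N :: nat. e \<le> dist (opoly U (cesaro \<omega> (m N)) f) (opoly U (cesaro \<omega> (n N)) f)"
    by metis
  have top: "filterlim m at_top sequentially" "filterlim n at_top sequentially"
    using mn(1,2) by (auto intro: filterlim_at_top_mono[OF filterlim_ident])
  define r where "r N = cesaro \<omega> (m N) - cesaro \<omega> (n N)" for N
  have "(\<lambda>N. norm (opoly U (r N) f)) \<longlonglongrightarrow> 0"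
  proof (rule opoly_U_tendsto_0[where K = "{}" and C = 2, OF _ _ _ _ _ f])
    show "cmod (poly (r j) l) \<le> 2" if "cmod l = 1" for j l
      using norm_triangle_ineq4[of "poly (cesaro \<omega> (m j)) l" "poly (cesaro \<omega> (n j)) l"]
        cmod_poly_cesaro_le[OF \<omega> that, of "m j"] cmod_poly_cesaro_le[OF \<omega> that, of "n j"]
      by (simp add: r_def)
    show "(\<lambda>j. poly (r j) l) \<longlonglongrightarrow> 0" if "cmod l = 1" for l
    proof (cases "l = \<omega>")
      case False
      note lim = poly_cesaro_tendsto_0[OF \<omega> that False]
      show ?thesis
        using tendsto_diff[OF filterlim_compose[OF lim top(1)] filterlim_compose[OF lim top(2)]]
        by (simp add: r_def)
    qed (simp add: r_def poly_cesaro_self[OF \<omega>])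
  qed (simp_all add: circle_null_def)
  moreover have "e \<le> norm (opoly U (r N) f)" for N
    using mn(3)[of N] by (simp add: r_def opoly_diff dist_norm)
  ultimately have "e \<le> 0"
    by (intro LIMSEQ_le_const) auto
  with e(1) show False by simp
qed

text \<open>The limits of the means applied to \<open>delta 0 b\<close> satisfy the eigenvalue
  equation. Not all of them are zero, because the lower bound for the sum over \<open>B\<close>
  passes to the limit.\<close>

lemma symbol_eigenvalue:
  assumes ev: "\<And>z. z \<in> torus \<Longrightarrow> is_eigenvalue (symbol z) \<omega>"
  shows "is_eigenvalue U \<omega>"
proof -
  have \<omega>: "cmod \<omega> = 1"
    using ev[OF torus_point_in_torus] isometry_eigenvalue_norm[OF symbol_iso[OF torus_point_in_torus]]
    unfolding is_eigenvalue_def by metis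
  define X where "X b j = opoly U (cesaro \<omega> j) (delta 0 b)" for b j
  have "convergent (X b)" for b
    unfolding X_def by (intro ell2_convergent[OF basis] Cauchy_cesaro \<omega> fin_supp_delta)
  then obtain f where f: "\<And>b. X b \<longlonglongrightarrow> f b"
    unfolding convergent_def by metis
  have "U (f b) = \<omega> *\<^sub>C f b" for b
  proof -
    \<comment> \<open>The linear factor vanishes at \<omega> and the means tend to 0 elsewhere on
      the circle, so no exceptional set remains.\<close>
    have zero: "(\<lambda>j. norm (opoly U ([:- \<omega>, 1:] * cesaro \<omega> j) (delta 0 b))) \<longlonglongrightarrow> 0"
    proof (rule opoly_U_tendsto_0[where K = "{}" and C = 2])
      show "cmod (poly ([:- \<omega>, 1:] * cesaro \<omega> j) l) \<le> 2" if "cmod l = 1" for j l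
      proof -
        have "cmod (poly ([:- \<omega>, 1:] * cesaro \<omega> j) l) = cmod (l - \<omega>) * cmod (poly (cesaro \<omega> j) l)"
          by (simp only: poly_mult norm_mult) simp
        also have "\<dots> \<le> 2 * 1"
          using norm_triangle_ineq4[of l \<omega>] \<omega> that cmod_poly_cesaro_le[OF \<omega> that, of j]
          by (intro mult_mono) auto
        finally show ?thesis by simp
      qed
      show "(\<lambda>j. poly ([:- \<omega>, 1:] * cesaro \<omega> j) l) \<longlonglongrightarrow> 0" if "cmod l = 1" for l
      proof (cases "l = \<omega>")
        case False
        show ?thesis
          unfolding poly_mult
          by (rule tendsto_mult_right_zero) (rule poly_cesaro_tendsto_0[OF \<omega> that False])
      qed (simp add: poly_mult)
    qed (simp_all add: circle_null_def)
    have factor: "opoly U ([:- \<omega>, 1:] * r) w = U (opoly U r w) - \<omega> *\<^sub>C opoly U r w" for r w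
    proof -
      have "opoly U r (U w) = U (opoly U r w)"
      proof (induction r arbitrary: w)
        case (pCons c r)
        then show ?case
          by (simp add: opoly_pCons clinear_add[OF lin] clinear_scale[OF lin])
      qed (simp add: clinear_zero[OF lin])
      then show ?thesis
        by (simp add: opoly_add opoly_diff opoly_smult opoly_pCons)
    qed
    have "(\<lambda>j. U (X b j) - \<omega> *\<^sub>C X b j) \<longlonglongrightarrow> 0"
      using tendsto_norm_zero_cancel[OF zero] unfolding factor X_def .
    moreover have "(\<lambda>j. U (X b j) - \<omega> *\<^sub>C X b j) \<longlonglongrightarrow> U (f b) - \<omega> *\<^sub>C f b"
    proof (intro tendsto_diff)
      have lim: "(\<lambda>j. norm (X b j - f b)) \<longlonglongrightarrow> 0"
        using f[of b] by (simp add: LIM_zero tendsto_norm_zero)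
      have "norm (U (X b j) - U (f b)) = norm (X b j - f b)" for j
        by (simp add: isometry_norm[OF iso] flip: clinear_diff[OF lin])
      then show "(\<lambda>j. U (X b j)) \<longlonglongrightarrow> U (f b)"
        using lim by - (rule LIM_zero_cancel, rule tendsto_norm_zero_cancel, simp)
      have "norm (\<omega> *\<^sub>C X b j - \<omega> *\<^sub>C f b) = norm (X b j - f b)" for j
        by (simp add: norm_scaleC \<omega> flip: scaleC_diff_right)
      then show "(\<lambda>j. \<omega> *\<^sub>C X b j) \<longlonglongrightarrow> \<omega> *\<^sub>C f b"
        using lim by - (rule LIM_zero_cancel, rule tendsto_norm_zero_cancel, simp)
    qed
    ultimately have "U (f b) - \<omega> *\<^sub>C f b = 0"
      using LIMSEQ_unique by blast
    then show ?thesis by simp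
  qed
  moreover have "\<exists>b. f b \<noteq> 0"
  proof (rule ccontr)
    assume "\<not> ?thesis"
    then have "X b \<longlonglongrightarrow> 0" for b using f[of b] by simp
    then have "(\<lambda>j. \<Sum>b\<in>B. (norm (X b j))\<^sup>2) \<longlonglongrightarrow> (\<Sum>b\<in>B. 0\<^sup>2)"
      by (intro tendsto_sum tendsto_power tendsto_norm_zero)
    moreover have "1 \<le> (\<Sum>b\<in>B. (norm (X b j))\<^sup>2)" for j
      unfolding X_def by (rule sum_norm_opoly_delta_ge_1[OF ev poly_cesaro_self[OF \<omega>]])
    ultimately have "1 \<le> (\<Sum>b\<in>B. 0\<^sup>2 :: real)"
      by (intro LIMSEQ_le_const) auto
    then show False by simp
  qed
  ultimately show ?thesis
    unfolding is_eigenvalue_def by blast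
qed

text \<open>A single point of the torus suffices: the eigenvalues are roots of the characteristic
  polynomial there, which is nonzero because 0 is not an eigenvalue of an isometry.\<close>

lemma finite_eigenvalues: "finite {\<omega>. is_eigenvalue U \<omega>}"
proof -
  obtain X p where ev: "\<And>z \<omega>. z \<in> torus \<Longrightarrow>
      is_eigenvalue (symbol z) \<omega> \<longleftrightarrow> (\<Sum>x\<in>X. poly (p x) \<omega> * monomial z x) = 0"
    using eigenvalue_laurent by blast
  define z :: "complex ^ 'd" where "z = torus_point 0 (\<lambda>_. 0) 0"
  have z: "z \<in> torus" unfolding z_def by (rule torus_point_in_torus)
  define q where "q = (\<Sum>x\<in>X. smult (monomial z x) (p x))"
  have q: "is_eigenvalue (symbol z) \<omega> \<longleftrightarrow> poly q \<omega> = 0" for \<omega>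
    by (simp add: ev[OF z] q_def poly_sum mult.commute)
  have "\<not> is_eigenvalue (symbol z) 0"
    using isometry_eigenvalue_norm[OF symbol_iso[OF z], of _ 0] by (auto simp: is_eigenvalue_def)
  then have "q \<noteq> 0" using q[of 0] by auto
  then have "finite {\<omega>. poly q \<omega> = 0}" by (rule poly_roots_finite)
  then show ?thesis
    by (rule rev_finite_subset) (use eigenvalue_symbol[OF _ z] q in auto)
qed

text \<open>Peak polynomials of \<open>U\<close> tend to 0 on delta functions and dominate
  \<open>E K\<close>. The symmetry of \<open>E K\<close> then carries the vanishing to arbitrary
  \<open>u\<close>.\<close>

lemma spectral_measure_null:
  assumes E: "is_spectral_measure U E"
    and K: "compact K" "K \<subseteq> sphere 0 1" "circle_null K"
    and no_ev: "\<And>\<omega>. \<omega> \<in> K \<Longrightarrow> \<not> is_eigenvalue U \<omega>"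
  shows "E K u = 0"
proof -
  interpret S: circle_spectral_measure U E
    by (intro circle_spectral_measure.intro lin iso E)
  show ?thesis
  proof (cases "K = {}")
    case False
    have K_sets: "K \<in> sets circle_borel"
      using K by (auto simp only: sets_circle_borel intro: borel_closed compact_imp_closed)
    obtain r where r: "\<And>j \<omega>. \<omega> \<in> K \<inter> sphere 0 1 \<Longrightarrow> 1 \<le> cmod (poly (r j) \<omega>)"
      "\<And>j \<omega>. \<omega> \<in> sphere 0 1 \<Longrightarrow> cmod (poly (r j) \<omega>) \<le> 3"
      "\<And>\<omega>. \<omega> \<in> sphere 0 1 - K \<Longrightarrow> (\<lambda>j. poly (r j) \<omega>) \<longlonglongrightarrow> 0"
      using circle_peak_polynomials[OF compact_imp_closed[OF K(1)] False] by metis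
    have "E K (delta x \<phi>) = 0" for x \<phi>
    proof -
      have "(\<lambda>j. norm (opoly U (r j) (delta x \<phi>))) \<longlonglongrightarrow> 0"
      proof (rule opoly_U_tendsto_0[OF K(2,3)])
        \<comment> \<open>The contrapositive of \<open>symbol_eigenvalue\<close> supplies a point
          where the determinant does not vanish.\<close>
        show "\<exists>z\<in>torus. \<not> is_eigenvalue (symbol z) \<omega>" if "\<omega> \<in> K" for \<omega>
          using symbol_eigenvalue no_ev[OF that] by blast
      qed (use r in auto)
      moreover have "norm (E K (delta x \<phi>)) \<le> norm (opoly U (r j) (delta x \<phi>))" for j
        using K(2) by (intro S.norm_E_le_opoly K_sets r(1)) blast
      ultimately have "norm (E K (delta x \<phi>)) \<le> 0"
        by (intro LIMSEQ_le_const) auto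
      then show ?thesis by simp
    qed
    then have "cinner (E K u) (delta x \<phi>) = 0" for x \<phi>
      by (simp add: S.E_sym[OF K_sets])
    then have "cinner (ell2_apply (E K u) x) (ell2_apply (E K u) x) = 0" for x
      by (simp only: cinner_delta)
    then show ?thesis
      by (intro ell2_eqI) (simp add: cinner_self)
  qed simp
qed

text \<open>Passing to the continuous part removes the eigenvalues from the null set
  \<open>A\<close>; every compact subset of the rest is a null set free of eigenvalues.\<close>

lemma continuous_spectrum_ac:
  assumes E: "is_spectral_measure U E"
  shows "continuous_spectrum_ac U E"
  unfolding continuous_spectrum_ac_def absolutely_continuous_def
proof (intro allI subsetI)
  fix u A
  interpret S: circle_spectral_measure U E
    by (intro circle_spectral_measure.intro lin iso E)
  define F where "F = {\<omega>. is_eigenvalue U \<omega>}"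
  assume A: "A \<in> null_sets circle_lebesgue"
  then have A_sets: "A \<in> sets circle_borel"
    by (auto simp: circle_lebesgue_def)
  have "F \<subseteq> sphere 0 1" "finite F"
    using S.eigenvalue_in_sphere finite_eigenvalues by (auto simp: F_def)
  then have F_sets: "F \<in> sets circle_borel"
    by (simp add: sets_circle_borel borel_closed finite_imp_closed)
  have "E A (proj_cont U u) = E (A \<inter> (sphere 0 1 - F)) u"
    unfolding S.proj_cont_eq[OF finite_eigenvalues] F_def[symmetric]
    by (intro S.E_Int A_sets sets.Diff F_sets S.sphere_sets)
  also have "\<dots> = 0"
  proof (rule S.E_eq_0_compact)
    show "A \<inter> (sphere 0 1 - F) \<in> sets circle_borel"
      by (intro sets.Int A_sets sets.Diff F_sets S.sphere_sets)
    fix K assume K: "compact K" "K \<subseteq> A \<inter> (sphere 0 1 - F)"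
    then have "circle_null K"
      using circle_null_subset[OF circle_null_null_sets[OF A]] by blast
    then show "E K u = 0"
      using K by (intro spectral_measure_null[OF E]) (auto simp: F_def)
  qed
  finally show "A \<in> null_sets (spectral_distribution E (proj_cont U u))"
    using A_sets by (intro null_setsI) (simp_all add: S.emeasure_\<mu> S.sets_\<mu>)
qed

end

theorem theorem1p3:
  fixes U :: "(int ^ 'd, 'w::complex_inner) ell2 \<Rightarrow> (int ^ 'd, 'w) ell2"
  assumes fin_dim: "\<exists>B :: 'w set. finite B \<and> complex_vector.span B = UNIV"
    and U: "periodic_unitary_transition U"
  shows "(\<forall>\<omega>. is_eigenvalue U \<omega> \<longleftrightarrow> (\<forall>z\<in>torus. is_eigenvalue (fourier_symbol U z) \<omega>))
    \<and> finite {\<omega>. is_eigenvalue U \<omega>}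
    \<and> (\<forall>E. is_spectral_measure U E \<longrightarrow> continuous_spectrum_ac U E)"
proof -
  obtain B :: "'w set" where "orthonormal_basis B"
    using fin_dim orthonormal_basis_exists by blast
  then interpret periodic_walk U B
    by unfold_locales (rule U)
  show ?thesis
    using eigenvalue_symbol symbol_eigenvalue finite_eigenvalues continuous_spectrum_ac by blast
qed

end
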